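(* Let $(M,g)$ be a Riemannian manifold endowed with a Riemannian flow of codimension $q$ given by a unit vector field $\xi$, and let $m=[\frac q2]$. For any $p$ with $1\le p\le q-1$ and any basic $p$-form $\omega$, one has (pointwise) $$\langle \mathcal B^{[p]}_{\rm ext}\omega,\omega\rangle\ \ge\ -p(q-p)\,b_m^2\,|\omega|^2 .$$ If equality is attained (at a point where $\omega\neq0$) for some $p\in\{1,\dots,m\}$, then $|b_1|=\cdots=|b_m|$ (at that point). If $m=1$ and equality is attained (at a point where $\omega\neq0$), then $b_1=0$ (at that point).
   Context: A Riemannian flow on $(M^{q+1},g)$ is the foliation by the integral curves of a unit vector field $\xi$ such that $(\mathcal L_\xi g)(Y,Z)=0$ for all $Y,Z\in\Gamma(Q)$, where $Q=\xi^\perp$ has rank $q$. A form $\omega$ is basic if $\xi\lrcorner\omega=0$ and $\xi\lrcorner d\omega=0$. Vectors are identified with 1-forms via $g$. The O'Neill tensor is $h(X)=\nabla^M_X\xi$ ($\nabla^M$ the Levi-Civita connection), a skew-symmetric endomorphism of $Q$. At each point there is an orthonormal basis of $Q$ with $h(e_{2i-1})=b_ie_{2i}$, $h(e_{2i})=-b_ie_{2i-1}$, $i=1,\dots,m$ (and one extra vector $e_0$ with $h(e_0)=0$ if $q$ is odd), with $|b_1|\le\cdots\le|b_m|$. Define the symmetric operator $R_{\rm ext}:\Lambda^2Q\to\Lambda^2Q$ by $$g(R_{\rm ext}(X\wedge Y),Z\wedge W)=2g(hX,Y)g(hZ,W)-g(hY,Z)g(hX,W)-g(hZ,X)g(hY,W).$$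 Clifford multiplication on $\Lambda Q$: $X\cdot\omega=X\wedge\omega-X\lrcorner\omega$ for $X\in Q$, extended to forms by $(e_{i_1}\wedge\cdots\wedge e_{i_k})\cdot\omega=e_{i_1}\cdot\ldots\cdot e_{i_k}\cdot\omega$ for orthonormal $e_i$ and $i_1<\dots<i_k$; $[\omega_1,\omega_2]=\omega_1\cdot\omega_2-\omega_2\cdot\omega_1$. Then $\mathcal B^{[p]}_{\rm ext}$ is the endomorphism of $\Lambda^pQ$ given by $$\langle \mathcal B^{[p]}_{\rm ext}\omega,\varphi\rangle=\frac14\sum_{r,s=1}^{\binom q2}\langle R_{\rm ext}\psi_r,\psi_s\rangle\,\langle[\hat\psi_r,\omega],[\hat\psi_s,\varphi]\rangle,$$ where $\{\psi_r\}$ is any orthonormal frame of $\Lambda^2Q$ and $\{\hat\psi_r\}$ its dual basis (of 2-forms on $Q$). *)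

theory Defs
  imports "HOL-Analysis.Analysis"
begin

section \<open>Smooth manifolds, tensor fields and Riemannian flows\<close>

primrec Ck_on :: "nat \<Rightarrow> 'e::euclidean_space set \<Rightarrow> ('e \<Rightarrow> 'f::real_normed_vector) \<Rightarrow> bool" where
  "Ck_on 0 S f \<longleftrightarrow> continuous_on S f"
| "Ck_on (Suc k) S f \<longleftrightarrow>
     f differentiable_on S \<and> (\<forall>v. Ck_on k S (\<lambda>x. frechet_derivative f (at x) v))"

text \<open>Only used for open \<open>S\<close>.\<close>

definition smooth_on :: "'e::euclidean_space set \<Rightarrow> ('e \<Rightarrow> 'f::real_normed_vector) \<Rightarrow> bool" where
  "smooth_on S f \<longleftrightarrow> (\<forall>k. Ck_on k S f)"

type_synonym ('a, 'e) chart = "'a set \<times> ('a \<Rightarrow> 'e)"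

definition chart_image :: "('a, 'e) chart \<Rightarrow> 'e set" where
  "chart_image c = snd c ` fst c"

definition chart_inv :: "('a, 'e) chart \<Rightarrow> 'e \<Rightarrow> 'a" where
  "chart_inv c = inv_into (fst c) (snd c)"

definition smooth_atlas :: "'a topology \<Rightarrow> ('a, 'e::euclidean_space) chart set \<Rightarrow> bool" where
  "smooth_atlas M A \<longleftrightarrow>
     (\<Union>c\<in>A. fst c) = topspace M \<and>
     (\<forall>c\<in>A. openin M (fst c) \<and> open (chart_image c) \<and>
        homeomorphic_map (subtopology M (fst c)) (top_of_set (chart_image c)) (snd c)) \<and>
     (\<forall>c\<in>A. \<forall>d\<in>A. smooth_on (snd c ` (fst c \<inter> fst d)) (snd d \<circ> chart_inv c))"

definition smooth_manifold :: "'a topology \<Rightarrow> ('a, 'e::euclidean_space) chart set \<Rightarrow> bool" where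
  "smooth_manifold M A \<longleftrightarrow> Hausdorff_space M \<and> second_countable M \<and> smooth_atlas M A"

text \<open>A chart \<open>c\<close> around a point \<open>x\<close> identifies the tangent space at \<open>x\<close> with the model space
  \<open>'e\<close>. A tensor field is the family of its local expressions, indexed by the charts of the
  atlas and related by the differentials of the coordinate changes.\<close>

definition coord_change :: "('a, 'e::euclidean_space) chart \<Rightarrow> ('a, 'e) chart \<Rightarrow> 'a \<Rightarrow> 'e \<Rightarrow> 'e" where
  "coord_change c d x = frechet_derivative (snd d \<circ> chart_inv c) (at (snd c x))"

text \<open>Directional derivative, at the point \<open>x\<close> and along the vector \<open>v\<close> (both read in the chart
  \<open>c\<close>), of a function on the chart domain.\<close>

definition dir_deriv ::
  "('a, 'e::euclidean_space) chart \<Rightarrow> ('a \<Rightarrow> 'f::real_normed_vector) \<Rightarrow> 'a \<Rightarrow> 'e \<Rightarrow> 'f" where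
  "dir_deriv c F x v = frechet_derivative (F \<circ> chart_inv c) (at (snd c x)) v"

type_synonym ('a, 'e) vector_field = "('a, 'e) chart \<Rightarrow> 'a \<Rightarrow> 'e"
type_synonym ('a, 'e) metric_field = "('a, 'e) chart \<Rightarrow> 'a \<Rightarrow> 'e \<Rightarrow> 'e \<Rightarrow> real"

definition smooth_vector_field ::
  "('a, 'e::euclidean_space) chart set \<Rightarrow> ('a, 'e) vector_field \<Rightarrow> bool" where
  "smooth_vector_field A X \<longleftrightarrow>
     (\<forall>c\<in>A. smooth_on (chart_image c) (X c \<circ> chart_inv c)) \<and>
     (\<forall>c\<in>A. \<forall>d\<in>A. \<forall>x\<in>fst c \<inter> fst d. X d x = coord_change c d x (X c x))"

definition riemannian_metric ::
  "('a, 'e::euclidean_space) chart set \<Rightarrow> ('a, 'e) metric_field \<Rightarrow> bool" where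
  "riemannian_metric A g \<longleftrightarrow>
     (\<forall>c\<in>A. \<forall>x\<in>fst c. bilinear (g c x) \<and> (\<forall>u v. g c x u v = g c x v u) \<and>
        (\<forall>v. v \<noteq> 0 \<longrightarrow> g c x v v > 0)) \<and>
     (\<forall>c\<in>A. \<forall>u v. smooth_on (chart_image c) ((\<lambda>x. g c x u v) \<circ> chart_inv c)) \<and>
     (\<forall>c\<in>A. \<forall>d\<in>A. \<forall>x\<in>fst c \<inter> fst d. \<forall>u v.
        g c x u v = g d x (coord_change c d x u) (coord_change c d x v))"

definition riemannian_manifold ::
  "'a topology \<Rightarrow> ('a, 'e::euclidean_space) chart set \<Rightarrow> ('a, 'e) metric_field \<Rightarrow> bool" where
  "riemannian_manifold M A g \<longleftrightarrow> smooth_manifold M A \<and> riemannian_metric A g"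

text \<open>The fibre of \<open>Q\<close>, the orthogonal complement of \<open>Xi\<close> for the inner product \<open>G\<close>.\<close>

definition horizontal :: "('e \<Rightarrow> 'e \<Rightarrow> real) \<Rightarrow> 'e \<Rightarrow> 'e set" where
  "horizontal G Xi = {v. G v Xi = 0}"

text \<open>The value on the vectors \<open>y\<close>, \<open>z\<close> at \<open>x\<close> of the Lie derivative of \<open>g\<close> along \<open>X\<close>. Extending
  \<open>y\<close>, \<open>z\<close> to fields that are constant in the chart, the brackets in
  \<open>X(g(Y,Z)) - g([X,Y],Z) - g(Y,[X,Z])\<close> are \<open>[X,Y] = - D\<^sub>y X\<close> and \<open>[X,Z] = - D\<^sub>z X\<close>.\<close>

definition lie_deriv_metric ::
  "('a, 'e::euclidean_space) metric_field \<Rightarrow> ('a, 'e) vector_field \<Rightarrow> ('a, 'e) chart \<Rightarrow> 'a \<Rightarrow>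
     'e \<Rightarrow> 'e \<Rightarrow> real" where
  "lie_deriv_metric g X c x y z =
     dir_deriv c (\<lambda>x'. g c x' y z) x (X c x)
     + g c x (dir_deriv c (X c) x y) z + g c x y (dir_deriv c (X c) x z)"

definition riemannian_flow ::
  "('a, 'e::euclidean_space) chart set \<Rightarrow> ('a, 'e) metric_field \<Rightarrow> ('a, 'e) vector_field \<Rightarrow> bool" where
  "riemannian_flow A g \<xi> \<longleftrightarrow>
     smooth_vector_field A \<xi> \<and>
     (\<forall>c\<in>A. \<forall>x\<in>fst c. g c x (\<xi> c x) (\<xi> c x) = 1) \<and>
     (\<forall>c\<in>A. \<forall>x\<in>fst c. \<forall>Y\<in>horizontal (g c x) (\<xi> c x). \<forall>Z\<in>horizontal (g c x) (\<xi> c x).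
        lie_deriv_metric g \<xi> c x Y Z = 0)"

text \<open>The vector \<open>\<Gamma>(u,v)\<close> built from the Christoffel symbols of the metric in the chart \<open>c\<close>.\<close>

definition christoffel ::
  "('a, 'e::euclidean_space) metric_field \<Rightarrow> ('a, 'e) chart \<Rightarrow> 'a \<Rightarrow> 'e \<Rightarrow> 'e \<Rightarrow> 'e" where
  "christoffel g c x u v = (THE t. \<forall>w. g c x t w =
     (dir_deriv c (\<lambda>x'. g c x' v w) x u + dir_deriv c (\<lambda>x'. g c x' u w) x v
      - dir_deriv c (\<lambda>x'. g c x' u v) x w) / 2)"

text \<open>\<open>levi_civita g X c x v\<close> is the covariant derivative of \<open>X\<close> at \<open>x\<close> in the direction \<open>v\<close>.\<close>

definition levi_civita ::
  "('a, 'e::euclidean_space) metric_field \<Rightarrow> ('a, 'e) vector_field \<Rightarrow> ('a, 'e) chart \<Rightarrow> 'a \<Rightarrow>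
     'e \<Rightarrow> 'e" where
  "levi_civita g X c x v = dir_deriv c (X c) x v + christoffel g c x v (X c x)"

definition oneill ::
  "('a, 'e::euclidean_space) metric_field \<Rightarrow> ('a, 'e) vector_field \<Rightarrow> ('a, 'e) chart \<Rightarrow> 'a \<Rightarrow>
     'e \<Rightarrow> 'e" where
  "oneill g \<xi> c x X = levi_civita g \<xi> c x X"

section \<open>Exterior forms\<close>

text \<open>A form, possibly of mixed degree, is a function on lists of vectors; its component of degree
  \<open>k\<close> is its restriction to the lists of length \<open>k\<close>.\<close>

type_synonym 'e form = "'e list \<Rightarrow> real"

definition alternating_form :: "'e::euclidean_space form \<Rightarrow> bool" where
  "alternating_form \<omega> \<longleftrightarrow>
     (\<forall>us vs. linear (\<lambda>v. \<omega> (us @ v # vs))) \<and>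
     (\<forall>us v ws vs. \<omega> (us @ v # ws @ v # vs) = 0)"

definition p_form :: "nat \<Rightarrow> 'e::euclidean_space form \<Rightarrow> bool" where
  "p_form p \<omega> \<longleftrightarrow> alternating_form \<omega> \<and> (\<forall>vs. length vs \<noteq> p \<longrightarrow> \<omega> vs = 0)"

definition interior_prod :: "'e \<Rightarrow> 'e form \<Rightarrow> 'e form" where
  "interior_prod X \<omega> = (\<lambda>vs. \<omega> (X # vs))"

definition omit :: "nat \<Rightarrow> 'e list \<Rightarrow> 'e list" where
  "omit i vs = take i vs @ drop (Suc i) vs"

text \<open>The exterior product of the covector \<open>G(X, _)\<close> with \<open>\<omega>\<close>.\<close>

definition wedge :: "('e \<Rightarrow> 'e \<Rightarrow> real) \<Rightarrow> 'e \<Rightarrow> 'e form \<Rightarrow> 'e form" where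
  "wedge G X \<omega> = (\<lambda>vs. \<Sum>i<length vs. (-1) ^ i * G X (vs ! i) * \<omega> (omit i vs))"

definition unit_form :: "'e form" where
  "unit_form = (\<lambda>vs. if vs = [] then 1 else 0)"

definition wedge2 :: "('e \<Rightarrow> 'e \<Rightarrow> real) \<Rightarrow> 'e \<Rightarrow> 'e \<Rightarrow> 'e form" where
  "wedge2 G X Y = wedge G X (wedge G Y unit_form)"

type_synonym ('a, 'e) form_field = "('a, 'e) chart \<Rightarrow> 'a \<Rightarrow> 'e form"

definition smooth_form_field ::
  "('a, 'e::euclidean_space) chart set \<Rightarrow> nat \<Rightarrow> ('a, 'e) form_field \<Rightarrow> bool" where
  "smooth_form_field A p \<omega> \<longleftrightarrow>
     (\<forall>c\<in>A. \<forall>x\<in>fst c. p_form p (\<omega> c x)) \<and>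
     (\<forall>c\<in>A. \<forall>vs. smooth_on (chart_image c) ((\<lambda>x. \<omega> c x vs) \<circ> chart_inv c)) \<and>
     (\<forall>c\<in>A. \<forall>d\<in>A. \<forall>x\<in>fst c \<inter> fst d. \<forall>vs.
        \<omega> c x vs = \<omega> d x (map (coord_change c d x) vs))"

definition ext_deriv ::
  "('a, 'e::euclidean_space) form_field \<Rightarrow> ('a, 'e) form_field" where
  "ext_deriv \<omega> c x = (\<lambda>vs. \<Sum>i<length vs.
     (-1) ^ i * dir_deriv c (\<lambda>x'. \<omega> c x' (omit i vs)) x (vs ! i))"

definition basic_form ::
  "('a, 'e::euclidean_space) chart set \<Rightarrow> ('a, 'e) vector_field \<Rightarrow> nat \<Rightarrow> ('a, 'e) form_field \<Rightarrow>
     bool" where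
  "basic_form A \<xi> p \<omega> \<longleftrightarrow> smooth_form_field A p \<omega> \<and>
     (\<forall>c\<in>A. \<forall>x\<in>fst c. interior_prod (\<xi> c x) (\<omega> c x) = (\<lambda>_. 0) \<and>
        interior_prod (\<xi> c x) (ext_deriv \<omega> c x) = (\<lambda>_. 0))"

section \<open>Linear algebra on a fibre of \<open>Q\<close>\<close>

text \<open>Below, \<open>G\<close> is the inner product and \<open>Xi\<close> the unit vector of the flow at a point, and \<open>f\<close> is an
  orthonormal frame \<open>f\<^sub>1, \<dots>, f\<^sub>q\<close> of the fibre of \<open>Q\<close>. Inner products and Clifford products of
  forms do not depend on the choice of \<open>f\<close>. Vectors and bivectors are identified with forms via
  \<open>G\<close>, and forms on \<open>Q\<close> with the forms annihilated by the interior product with \<open>Xi\<close>.\<close>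

definition orthonormal_frame ::
  "('e::euclidean_space \<Rightarrow> 'e \<Rightarrow> real) \<Rightarrow> 'e \<Rightarrow> 'i set \<Rightarrow> ('i \<Rightarrow> 'e) \<Rightarrow> bool" where
  "orthonormal_frame G Xi I e \<longleftrightarrow> finite I \<and>
     (\<forall>i\<in>I. e i \<in> horizontal G Xi) \<and>
     (\<forall>i\<in>I. \<forall>j\<in>I. G (e i) (e j) = (if i = j then 1 else 0)) \<and>
     (\<forall>v\<in>horizontal G Xi. v = (\<Sum>i\<in>I. G v (e i) *\<^sub>R e i))"

text \<open>\<open>e\<^sub>1, \<dots>, e\<^sub>2\<^sub>m\<close> together with \<open>e\<^sub>0\<close> if \<open>q\<close> is odd, where \<open>m = \<lfloor>q/2\<rfloor>\<close>.\<close>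

definition adapted_frame ::
  "nat \<Rightarrow> ('e::euclidean_space \<Rightarrow> 'e \<Rightarrow> real) \<Rightarrow> 'e \<Rightarrow> ('e \<Rightarrow> 'e) \<Rightarrow> (nat \<Rightarrow> 'e) \<Rightarrow> (nat \<Rightarrow> real) \<Rightarrow> bool" where
  "adapted_frame q G Xi h e b \<longleftrightarrow>
     orthonormal_frame G Xi (if even q then {1..q} else {0..<q}) e \<and>
     (\<forall>i\<in>{1..q div 2}. h (e (2*i - 1)) = b i *\<^sub>R e (2*i) \<and> h (e (2*i)) = - b i *\<^sub>R e (2*i - 1)) \<and>
     (odd q \<longrightarrow> h (e 0) = 0) \<and>
     (\<forall>i\<in>{1..q div 2}. \<forall>j\<in>{1..q div 2}. i \<le> j \<longrightarrow> \<bar>b i\<bar> \<le> \<bar>b j\<bar>)"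

definition ext_power :: "'e::euclidean_space \<Rightarrow> nat \<Rightarrow> 'e form set" where
  "ext_power Xi p = {\<omega>. p_form p \<omega> \<and> interior_prod Xi \<omega> = (\<lambda>_. 0)}"

definition frame_list :: "(nat \<Rightarrow> 'e) \<Rightarrow> nat set \<Rightarrow> 'e list" where
  "frame_list f I = map f (sorted_list_of_set I)"

text \<open>The inner product for which the \<open>f\<^sub>i\<^sub>1 \<and> \<dots> \<and> f\<^sub>i\<^sub>k\<close> with \<open>i\<^sub>1 < \<dots> < i\<^sub>k\<close> are orthonormal.\<close>

definition form_inner :: "nat \<Rightarrow> (nat \<Rightarrow> 'e) \<Rightarrow> 'e form \<Rightarrow> 'e form \<Rightarrow> real" where
  "form_inner q f \<omega> \<phi> = (\<Sum>I\<in>Pow {1..q}. \<omega> (frame_list f I) * \<phi> (frame_list f I))"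

definition clifford_vec :: "('e \<Rightarrow> 'e \<Rightarrow> real) \<Rightarrow> 'e \<Rightarrow> 'e form \<Rightarrow> 'e form" where
  "clifford_vec G X \<omega> = (\<lambda>vs. wedge G X \<omega> vs - interior_prod X \<omega> vs)"

text \<open>The coefficient of \<open>\<eta>\<close> along \<open>f\<^sub>i\<^sub>1 \<and> \<dots> \<and> f\<^sub>i\<^sub>k\<close> is \<open>\<eta>(f\<^sub>i\<^sub>1, \<dots>, f\<^sub>i\<^sub>k)\<close>, and that basis element acts
  as \<open>f\<^sub>i\<^sub>1 \<cdot> \<dots> \<cdot> f\<^sub>i\<^sub>k\<close>.\<close>

definition clifford ::
  "nat \<Rightarrow> ('e \<Rightarrow> 'e \<Rightarrow> real) \<Rightarrow> (nat \<Rightarrow> 'e) \<Rightarrow> 'e form \<Rightarrow> 'e form \<Rightarrow> 'e form" where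
  "clifford q G f \<eta> \<omega> = (\<lambda>vs. \<Sum>I\<in>Pow {1..q}.
     \<eta> (frame_list f I) * foldr (clifford_vec G) (frame_list f I) \<omega> vs)"

definition clifford_comm ::
  "nat \<Rightarrow> ('e \<Rightarrow> 'e \<Rightarrow> real) \<Rightarrow> (nat \<Rightarrow> 'e) \<Rightarrow> 'e form \<Rightarrow> 'e form \<Rightarrow> 'e form" where
  "clifford_comm q G f \<eta> \<omega> = (\<lambda>vs. clifford q G f \<eta> \<omega> vs - clifford q G f \<omega> \<eta> vs)"

definition is_R_ext ::
  "nat \<Rightarrow> ('e::euclidean_space \<Rightarrow> 'e \<Rightarrow> real) \<Rightarrow> 'e \<Rightarrow> ('e \<Rightarrow> 'e) \<Rightarrow> (nat \<Rightarrow> 'e) \<Rightarrow>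
     ('e form \<Rightarrow> 'e form) \<Rightarrow> bool" where
  "is_R_ext q G Xi h f R \<longleftrightarrow>
     (\<forall>\<alpha>\<in>ext_power Xi 2. R \<alpha> \<in> ext_power Xi 2) \<and>
     (\<forall>\<alpha>\<in>ext_power Xi 2. \<forall>\<beta>\<in>ext_power Xi 2. \<forall>s t.
        R (\<lambda>vs. s * \<alpha> vs + t * \<beta> vs) = (\<lambda>vs. s * R \<alpha> vs + t * R \<beta> vs)) \<and>
     (\<forall>X\<in>horizontal G Xi. \<forall>Y\<in>horizontal G Xi. \<forall>Z\<in>horizontal G Xi. \<forall>W\<in>horizontal G Xi.
        form_inner q f (R (wedge2 G X Y)) (wedge2 G Z W) =
          2 * G (h X) Y * G (h Z) W - G (h Y) Z * G (h X) W - G (h Z) X * G (h Y) W)"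

text \<open>The defining properties determine the operator on \<open>ext_power Xi 2\<close>; outside this space its
  values are irrelevant.\<close>

definition R_ext ::
  "nat \<Rightarrow> ('e::euclidean_space \<Rightarrow> 'e \<Rightarrow> real) \<Rightarrow> 'e \<Rightarrow> ('e \<Rightarrow> 'e) \<Rightarrow> (nat \<Rightarrow> 'e) \<Rightarrow>
     'e form \<Rightarrow> 'e form" where
  "R_ext q G Xi h f = (SOME R. is_R_ext q G Xi h f R)"

definition orthonormal_2frame ::
  "nat \<Rightarrow> 'e::euclidean_space \<Rightarrow> (nat \<Rightarrow> 'e) \<Rightarrow> (nat \<Rightarrow> 'e form) \<Rightarrow> bool" where
  "orthonormal_2frame q Xi f \<psi> \<longleftrightarrow>
     (\<forall>r\<in>{1..q choose 2}. \<psi> r \<in> ext_power Xi 2) \<and>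
     (\<forall>r\<in>{1..q choose 2}. \<forall>s\<in>{1..q choose 2}.
        form_inner q f (\<psi> r) (\<psi> s) = (if r = s then 1 else 0)) \<and>
     (\<forall>\<alpha>\<in>ext_power Xi 2. \<alpha> = (\<lambda>vs. \<Sum>r=1..q choose 2. form_inner q f \<alpha> (\<psi> r) * \<psi> r vs))"

text \<open>Under the identification of bivectors with 2-forms, the duality pairing is the inner product.\<close>

definition dual_2frame ::
  "nat \<Rightarrow> 'e::euclidean_space \<Rightarrow> (nat \<Rightarrow> 'e) \<Rightarrow> (nat \<Rightarrow> 'e form) \<Rightarrow> (nat \<Rightarrow> 'e form) \<Rightarrow> bool" where
  "dual_2frame q Xi f \<psi> \<psi>' \<longleftrightarrow>
     (\<forall>r\<in>{1..q choose 2}. \<psi>' r \<in> ext_power Xi 2) \<and>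
     (\<forall>r\<in>{1..q choose 2}. \<forall>s\<in>{1..q choose 2}.
        form_inner q f (\<psi>' r) (\<psi> s) = (if r = s then 1 else 0))"

definition B_ext ::
  "nat \<Rightarrow> ('e::euclidean_space \<Rightarrow> 'e \<Rightarrow> real) \<Rightarrow> 'e \<Rightarrow> ('e \<Rightarrow> 'e) \<Rightarrow> (nat \<Rightarrow> 'e) \<Rightarrow>
     (nat \<Rightarrow> 'e form) \<Rightarrow> (nat \<Rightarrow> 'e form) \<Rightarrow> nat \<Rightarrow> 'e form \<Rightarrow> 'e form" where
  "B_ext q G Xi h f \<psi> \<psi>' p \<omega> = (THE \<theta>. \<theta> \<in> ext_power Xi p \<and>
     (\<forall>\<phi>\<in>ext_power Xi p. form_inner q f \<theta> \<phi> =
        (\<Sum>r=1..q choose 2. \<Sum>s=1..q choose 2.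
           form_inner q f (R_ext q G Xi h f (\<psi> r)) (\<psi> s) *
           form_inner q f (clifford_comm q G f (\<psi>' r) \<omega>) (clifford_comm q G f (\<psi>' s) \<phi>)) / 4))"

end

theory Submission
  imports Defs
begin

text \<open>Everything happens in the fibre of \<open>Q\<close> at one point. Left and right Clifford multiplications by
vectors commute with each other, so the commutator with \<open>u \<cdot> v\<close>, for orthogonal \<open>u\<close> and \<open>v\<close>, is the
difference of two left and two right multiplications; the parts that change the degree cancel.
Hence the commutator with a 2-form \<open>\<alpha>\<close> is \<open>-2\<close> times the derivation
\<open>\<omega> \<mapsto> \<Sum> \<alpha>(e\<^sub>j, e\<^sub>k) e\<^sub>j \<and> (e\<^sub>k \<lrcorner> \<omega>)\<close> (\<open>clifford_comm_derivation\<close>). This expression has the same form in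
every orthonormal frame, and summing over an orthonormal basis of 2-forms turns the quadratic form
into \<open>\<Sum> R\<^sub>i\<^sub>j\<^sub>k\<^sub>l \<langle>e\<^sub>i \<and> (e\<^sub>j \<lrcorner> \<omega>), e\<^sub>k \<and> (e\<^sub>l \<lrcorner> \<omega>)\<rangle>\<close> in the adapted frame (\<open>B_ext_curvature_sum\<close>).

Inserting the components of the curvature operator and using the anticommutation relations gives
\<open>|D \<omega>|\<^sup>2 + 2 \<Sum>\<^sub>s |h e\<^sub>s \<lrcorner> \<omega>|\<^sup>2 - |\<Sum>\<^sub>s e\<^sub>s \<lrcorner> (h e\<^sub>s \<lrcorner> \<omega>)|\<^sup>2\<close>, where \<open>D\<close> is the derivation defined by \<open>h\<close>
(\<open>curvature_sum_identity\<close>, \<open>curvature_form_lower_bound\<close>). The first term is nonnegative and is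
dropped. The last one equals \<open>4 |\<Sum> b\<^sub>i \<Lambda>\<^sub>i \<omega>|\<^sup>2\<close>, where \<open>\<Lambda>\<^sub>i\<close> contracts with \<open>e\<^sub>2\<^sub>i\<^sub>-\<^sub>1\<close> and \<open>e\<^sub>2\<^sub>i\<close>. Its
diagonal part \<open>4 \<Sum> b\<^sub>i\<^sup>2 |\<Lambda>\<^sub>i \<omega>|\<^sup>2\<close> is absorbed by the middle term. An off-diagonal product
\<open>\<langle>\<Lambda>\<^sub>i \<omega>, \<Lambda>\<^sub>j \<omega>\<rangle>\<close> couples the coefficient of \<open>\<omega>\<close> at an index set \<open>I\<close> that contains the pair \<open>i\<close> and
misses the pair \<open>j\<close> with the coefficient at the set in which these pairs are exchanged. The inequality
between arithmetic and geometric means therefore bounds the quadratic form from below by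
\<open>-4 \<Sum>\<^sub>I \<omega>\<^sub>I\<^sup>2 \<Sum> |b\<^sub>i b\<^sub>j|\<close>, the inner sum being over the pairs \<open>i\<close> contained in \<open>I\<close> and the pairs \<open>j\<close>
disjoint from \<open>I\<close> (\<open>B_ext_exchange_bound\<close>).

If \<open>I\<close> has \<open>p\<close> elements, contains \<open>k\<close> pairs and is disjoint from \<open>l\<close> pairs, then \<open>2 k \<le> p\<close> and
\<open>2 l \<le> q - p\<close>, so the inner sum is at most \<open>k l b\<^sub>m\<^sup>2 \<le> p (q - p) b\<^sub>m\<^sup>2 / 4\<close>; this is the inequality.
Suppose equality holds with \<open>b\<^sub>m \<noteq> 0\<close>. Then every \<open>I\<close> with \<open>\<omega>\<^sub>I \<noteq> 0\<close> has \<open>2 k = p\<close> and \<open>2 l = q - p\<close>,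
so each of the \<open>m\<close> pairs is contained in \<open>I\<close> or disjoint from it, both cases occur (whence \<open>m \<ge> 2\<close>), and
\<open>|b\<^sub>i b\<^sub>j| = b\<^sub>m\<^sup>2\<close> for all \<open>i\<close> of the first and \<open>j\<close> of the second kind. Hence all \<open>|b\<^sub>i|\<close> are equal to
\<open>|b\<^sub>m|\<close> (\<open>exchange_weight_eq\<close>).\<close>

section \<open>Contraction and exterior multiplication\<close>

abbreviation contract :: "'e \<Rightarrow> 'e form \<Rightarrow> 'e form" ("\<iota>") where
  "\<iota> \<equiv> interior_prod"

lemma contract_apply: "\<iota> v \<omega> vs = \<omega> (v # vs)"
  by (simp add: interior_prod_def)

lemma alternating_linear: "alternating_form \<omega> \<Longrightarrow> linear (\<lambda>v. \<omega> (us @ v # vs))"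
  by (simp add: alternating_form_def)

lemma alternating_linear_hd: "alternating_form \<omega> \<Longrightarrow> linear (\<lambda>v. \<omega> (v # vs))"
  using alternating_linear[of \<omega> "[]"] by simp

lemma alternating_repeat: "alternating_form \<omega> \<Longrightarrow> \<omega> (us @ v # ws @ v # vs) = 0"
  by (simp add: alternating_form_def)

lemma alternating_swap:
  assumes "alternating_form \<omega>"
  shows "\<omega> (us @ u # v # vs) = - \<omega> (us @ v # u # vs)"
proof -
  have z: "\<omega> (us @ w # w # vs) = 0" for w
    using alternating_repeat[OF assms, of us w "[]" vs] by simp
  have l1: "\<omega> (us @ (u + v) # w # vs) = \<omega> (us @ u # w # vs) + \<omega> (us @ v # w # vs)" for w
    using linear_add[OF alternating_linear[OF assms, of us "w # vs"], of u v] by simp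
  have l2: "\<omega> (us @ w # (u + v) # vs) = \<omega> (us @ w # u # vs) + \<omega> (us @ w # v # vs)" for w
    using linear_add[OF alternating_linear[OF assms, of "us @ [w]" "vs"], of u v] by simp
  from z[of "u + v"] show ?thesis
    unfolding l1 l2 using z[of u] z[of v] by simp
qed

lemma alternating_move:
  assumes "alternating_form \<omega>"
  shows "\<omega> (us @ v # vs) = (-1) ^ length us * \<omega> (v # us @ vs)"
proof (induction us arbitrary: vs rule: rev_induct)
  case (snoc u us)
  show ?case
    using alternating_swap[OF assms, of us u v vs] snoc.IH[of "u # vs"] by simp
qed simp

lemma alternating_contract:
  assumes "alternating_form \<omega>"
  shows "alternating_form (\<iota> X \<omega>)"
  using alternating_linear[OF assms, of "X # _"] alternating_repeat[OF assms, of "X # _"]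
  by (simp add: alternating_form_def interior_prod_def)

lemma alternating_sum:
  fixes \<omega> :: "'i \<Rightarrow> 'e::euclidean_space form"
  assumes "\<And>i. i \<in> A \<Longrightarrow> alternating_form (\<omega> i)"
  shows "alternating_form (\<lambda>vs. \<Sum>i\<in>A. c i * \<omega> i vs)"
  unfolding alternating_form_def
proof (intro conjI allI)
  fix us vs :: "'e list"
  have "linear (\<lambda>v. c i * \<omega> i (us @ v # vs))" if "i \<in> A" for i
    using alternating_linear[OF assms[OF that], of us vs]
    by (simp add: linear_iff algebra_simps)
  then show "linear (\<lambda>v. \<Sum>i\<in>A. c i * \<omega> i (us @ v # vs))"
    by (rule linear_compose_sum[rule_format])
qed (simp add: alternating_repeat[OF assms])

lemma alternating_comb:
  assumes "alternating_form \<alpha>" "alternating_form \<beta>"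
  shows "alternating_form (\<lambda>vs. s * \<alpha> vs + t * \<beta> vs)"
proof -
  have "linear (\<lambda>v. s * \<alpha> (us @ v # vs) + t * \<beta> (us @ v # vs))" for us vs
    using alternating_linear[OF assms(1), of us vs] alternating_linear[OF assms(2), of us vs]
    by (auto simp: linear_iff distrib_left)
  then show ?thesis
    by (simp add: alternating_form_def alternating_repeat[OF assms(1)] alternating_repeat[OF assms(2)])
qed

lemma contract_anticommute:
  "alternating_form \<omega> \<Longrightarrow> \<iota> u (\<iota> v \<omega>) vs = - \<iota> v (\<iota> u \<omega>) vs"
  using alternating_swap[of \<omega> "[]" v u vs] by (simp add: interior_prod_def)

lemma contract_twice: "alternating_form \<omega> \<Longrightarrow> \<iota> v (\<iota> v \<omega>) vs = 0"
  using alternating_repeat[of \<omega> "[]" v "[]" vs] by (simp add: interior_prod_def)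

lemma omit_Cons_0: "omit 0 (v # vs) = vs" by (simp add: omit_def)

lemma omit_Cons_Suc: "omit (Suc i) (v # vs) = v # omit i vs" by (simp add: omit_def)

lemma wedge_Nil: "wedge G X \<omega> [] = 0" by (simp add: wedge_def)

text \<open>Expanding along the first vector gives a recursion over the list of arguments. It contains the
relation between exterior and interior product, and it lets most facts on \<open>wedge\<close> be proved by
induction over that list, for all forms at once.\<close>

lemma wedge_Cons:
  "wedge G X \<omega> (v # vs) = G X v * \<omega> vs - wedge G X (\<iota> v \<omega>) vs"
  unfolding wedge_def
  by (simp add: sum.lessThan_Suc_shift omit_Cons_0 omit_Cons_Suc interior_prod_def
      sum_negf mult.assoc del: sum.lessThan_Suc)

lemma contract_wedge:
  "\<iota> v (wedge G X \<omega>) = (\<lambda>vs. G X v * \<omega> vs - wedge G X (\<iota> v \<omega>) vs)"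
  by (rule ext) (simp add: contract_apply wedge_Cons)

lemma wedge_sum:
  "wedge G X (\<lambda>vs. \<Sum>i\<in>A. c i * \<omega> i vs) vs = (\<Sum>i\<in>A. c i * wedge G X (\<omega> i) vs)"
  unfolding wedge_def sum_distrib_left
  by (subst sum.swap) (simp add: algebra_simps)

lemma wedge_comb:
  "wedge G X (\<lambda>vs. s * \<alpha> vs + t * \<beta> vs) vs = s * wedge G X \<alpha> vs + t * wedge G X \<beta> vs"
  unfolding wedge_def sum_distrib_left sum.distrib[symmetric] by (simp add: algebra_simps)

lemma wedge_diff:
  "wedge G X (\<lambda>vs. \<alpha> vs - \<beta> vs) vs = wedge G X \<alpha> vs - wedge G X \<beta> vs"
  unfolding wedge_def sum_subtractf[symmetric] by (simp add: algebra_simps)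

lemma wedge_scale: "wedge G X (\<lambda>vs. s * \<alpha> vs) vs = s * wedge G X \<alpha> vs"
  unfolding wedge_def sum_distrib_left by (simp add: algebra_simps)

lemma wedge_zero: "wedge G X (\<lambda>_. 0) = (\<lambda>_. 0)"
  unfolding wedge_def by simp

lemma wedge_orthogonal:
  "(\<And>v. v \<in> set vs \<Longrightarrow> G X v = 0) \<Longrightarrow> wedge G X \<omega> vs = 0"
  unfolding wedge_def by simp

lemma wedge_anticommute:
  "wedge G X (wedge G Y \<omega>) vs = - wedge G Y (wedge G X \<omega>) vs"
proof (induction vs arbitrary: \<omega>)
  case (Cons v vs)
  show ?case
    using Cons.IH[of "\<iota> v \<omega>"] by (simp add: wedge_Cons contract_wedge wedge_diff wedge_scale)
qed (simp add: wedge_Nil)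

lemma linear_wedge_arg:
  assumes "bilinear G" 
  shows "linear (\<lambda>X. wedge G X \<omega> vs)"
  using assms unfolding wedge_def
  by (intro linear_compose_sum[rule_format])
     (simp add: linear_iff algebra_simps bilinear_ladd bilinear_lmul)

text \<open>When \<open>\<omega>\<close> vanishes on every list that contains \<open>v\<close>, only the summand that feeds \<open>v\<close> to the covector
\<open>G(X, _)\<close> survives. For \<open>\<omega> = \<iota> v \<phi>\<close> this is what makes the wedge product with an alternating form
alternating again.\<close>

lemma wedge_eq_if_repeat:
  assumes "\<And>us' vs'. \<omega> (us' @ v # vs') = 0"
  shows "wedge G X \<omega> (us @ v # vs) = (-1) ^ length us * G X v * \<omega> (us @ vs)"
  using assms
proof (induction us arbitrary: \<omega>)
  case Nil
  have "\<iota> v \<omega> = (\<lambda>_. 0)" using Nil[of "[]"] by (auto simp: contract_apply)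
  then show ?case by (simp add: wedge_Cons wedge_zero)
next
  case (Cons u us)
  have "wedge G X (\<iota> u \<omega>) (us @ v # vs) = (-1) ^ length us * G X v * \<iota> u \<omega> (us @ vs)"
    by (rule Cons.IH) (use Cons.prems[of "u # _"] in \<open>simp add: contract_apply\<close>)
  with Cons.prems[of us vs] show ?case by (simp add: wedge_Cons contract_apply)
qed

lemma alternating_wedge:
  assumes "bilinear G" "alternating_form \<omega>"
  shows "alternating_form (wedge G X \<omega>)"
  unfolding alternating_form_def
proof (intro conjI allI)
  fix us vs :: "'a list"
  have GX: "linear (G X)" using assms(1) by (simp add: bilinear_def)
  show "linear (\<lambda>v. wedge G X \<omega> (us @ v # vs))"
    using assms(2)
  proof (induction us arbitrary: \<omega>)
    case Nil
    have "linear (\<lambda>v. wedge G X (\<iota> v \<omega>) vs)"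
      unfolding wedge_def interior_prod_def
      by (intro linear_compose_sum[rule_format])
        (use linear_iff[THEN iffD1, OF alternating_linear_hd[OF Nil]] in
          \<open>auto simp add: linear_iff algebra_simps\<close>)
    with GX show ?case by (simp add: wedge_Cons linear_iff algebra_simps)
  next
    case (Cons u us)
    have "linear (\<lambda>v. wedge G X (\<iota> u \<omega>) (us @ v # vs))"
      by (intro Cons.IH alternating_contract Cons.prems)
    with alternating_linear[OF Cons.prems, of us vs] show ?case
      by (simp add: wedge_Cons linear_iff algebra_simps)
  qed
next
  fix us ws vs :: "'a list" and v :: 'a
  show "wedge G X \<omega> (us @ v # ws @ v # vs) = 0"
    using assms(2)
  proof (induction us arbitrary: \<omega>)
    case Nil
    have "wedge G X (\<iota> v \<omega>) (ws @ v # vs) = (-1) ^ length ws * G X v * \<iota> v \<omega> (ws @ vs)"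
      by (rule wedge_eq_if_repeat)
        (use alternating_repeat[OF Nil, of "[]" v] in \<open>simp add: contract_apply\<close>)
    with alternating_move[OF Nil, of ws v vs] show ?case
      by (simp add: wedge_Cons contract_apply)
  next
    case (Cons u us)
    then show ?case
      using alternating_repeat[OF Cons.prems, of us v ws vs]
      by (simp add: wedge_Cons alternating_contract)
  qed
qed

text \<open>Forms on \<open>Q\<close> of possibly mixed degree. Clifford products leave the homogeneous forms, so the degree
is only imposed where it matters.\<close>

definition horizontal_form :: "'e::euclidean_space \<Rightarrow> 'e form \<Rightarrow> bool" where
  "horizontal_form Xi \<omega> \<longleftrightarrow> alternating_form \<omega> \<and> \<iota> Xi \<omega> = (\<lambda>_. 0)"

lemma ext_power_iff:
  "\<omega> \<in> ext_power Xi p \<longleftrightarrow> horizontal_form Xi \<omega> \<and> (\<forall>vs. length vs \<noteq> p \<longrightarrow> \<omega> vs = 0)"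
  by (auto simp: ext_power_def p_form_def horizontal_form_def)

lemma horizontal_form_contract:
  assumes "horizontal_form Xi \<omega>"
  shows "horizontal_form Xi (\<iota> v \<omega>)"
proof -
  have "\<iota> Xi (\<iota> v \<omega>) = (\<lambda>_. 0)"
  proof
    fix vs
    have "\<iota> Xi (\<iota> v \<omega>) vs = - \<iota> Xi \<omega> (v # vs)"
      using assms contract_anticommute[of \<omega> Xi v vs]
      by (simp add: horizontal_form_def contract_apply)
    also have "\<iota> Xi \<omega> (v # vs) = 0" using assms by (simp only: horizontal_form_def)
    finally show "\<iota> Xi (\<iota> v \<omega>) vs = 0" by simp
  qed
  with assms show ?thesis by (simp add: horizontal_form_def alternating_contract)
qed

lemma horizontal_form_sum:
  "(\<And>i. i \<in> A \<Longrightarrow> horizontal_form Xi (\<omega> i)) \<Longrightarrow> horizontal_form Xi (\<lambda>vs. \<Sum>i\<in>A. c i * \<omega> i vs)"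
  unfolding horizontal_form_def by (auto simp: alternating_sum contract_apply fun_eq_iff)

lemma horizontal_form_comb:
  "horizontal_form Xi \<alpha> \<Longrightarrow> horizontal_form Xi \<beta> \<Longrightarrow> horizontal_form Xi (\<lambda>vs. s * \<alpha> vs + t * \<beta> vs)"
  unfolding horizontal_form_def by (auto simp: alternating_comb contract_apply fun_eq_iff)

lemma horizontal_form_wedge:
  "bilinear G \<Longrightarrow> G X Xi = 0 \<Longrightarrow> horizontal_form Xi \<omega> \<Longrightarrow> horizontal_form Xi (wedge G X \<omega>)"
  unfolding horizontal_form_def
  by (simp add: alternating_wedge contract_wedge wedge_zero)

lemma horizontal_form_unit: "horizontal_form Xi unit_form"
  unfolding horizontal_form_def alternating_form_def unit_form_def
  by (auto simp: interior_prod_def linear_iff)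

lemma ext_power_contract: "\<omega> \<in> ext_power Xi p \<Longrightarrow> \<iota> v \<omega> \<in> ext_power Xi (p - 1)"
  by (auto simp: ext_power_iff horizontal_form_contract contract_apply)

lemma ext_power_wedge:
  assumes "bilinear G" "G X Xi = 0" "\<omega> \<in> ext_power Xi p" 
  shows "wedge G X \<omega> \<in> ext_power Xi (Suc p)"
proof -
  have "wedge G X \<omega> vs = 0" if "length vs \<noteq> Suc p" for vs
    unfolding wedge_def
  proof (rule sum.neutral, rule ballI)
    fix i assume "i \<in> {..<length vs}"
    then have "length (omit i vs) \<noteq> p" using that by (auto simp: omit_def)
    then show "(- 1) ^ i * G X (vs ! i) * \<omega> (omit i vs) = 0"
      using assms(3) by (simp add: ext_power_iff)
  qed
  then show ?thesis using assms by (simp add: ext_power_iff horizontal_form_wedge)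
qed

lemma ext_power_sum:
  "(\<And>i. i \<in> A \<Longrightarrow> \<omega> i \<in> ext_power Xi p) \<Longrightarrow> (\<lambda>vs. \<Sum>i\<in>A. c i * \<omega> i vs) \<in> ext_power Xi p"
  by (auto simp: ext_power_iff horizontal_form_sum)

lemma ext_power_comb:
  "\<alpha> \<in> ext_power Xi p \<Longrightarrow> \<beta> \<in> ext_power Xi p \<Longrightarrow> (\<lambda>vs. s * \<alpha> vs + t * \<beta> vs) \<in> ext_power Xi p"
  by (auto simp: ext_power_iff horizontal_form_comb)

lemma ext_power_unit: "unit_form \<in> ext_power Xi 0"
  by (auto simp: ext_power_iff horizontal_form_unit) (simp add: unit_form_def)

section \<open>Coefficients and inner products in an orthonormal frame\<close>

lemma insort_split: "\<exists>us vs. insort i xs = us @ i # vs \<and> xs = us @ vs"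
proof (induction xs)
  case (Cons x xs)
  then obtain us vs where "insort i xs = us @ i # vs" "xs = us @ vs" by blast
  then show ?case
    by (cases "i \<le> x") (auto intro: exI[of _ "[]"] exI[of _ "x # us"])
qed auto

text \<open>The sign of the permutation that sorts \<open>i\<close> into \<open>J\<close> depends on the index sets alone. Products and
squares of coefficients of arbitrary alternating forms can therefore be compared without computing it.\<close>

lemma alternating_insert_sign:
  assumes "finite J" "i \<notin> J"
  obtains \<sigma> :: real where "\<sigma> * \<sigma> = 1"
    "\<And>\<omega>. alternating_form \<omega> \<Longrightarrow> \<omega> (frame_list f (insert i J)) = \<sigma> * \<omega> (f i # frame_list f J)"
proof -
  obtain us vs where *: "insort i (sorted_list_of_set J) = us @ i # vs"
    "sorted_list_of_set J = us @ vs"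
    using insort_split by blast
  have "\<omega> (frame_list f (insert i J)) = (-1) ^ length us * \<omega> (f i # frame_list f J)"
    if "alternating_form \<omega>" for \<omega>
    using alternating_move[OF that, of "map f us" "f i" "map f vs"] assms *
    by (simp add: frame_list_def)
  moreover have "(-1) ^ length us * (-1) ^ length us = (1 :: real)"
    by (simp add: power_add[symmetric])
  ultimately show ?thesis by (intro that)
qed

lemma alternating_repeat_mem:
  "alternating_form \<omega> \<Longrightarrow> v \<in> set vs \<Longrightarrow> \<omega> (v # vs) = 0"
  by (metis alternating_repeat append_Nil split_list)

lemma frame_list_mem: "finite J \<Longrightarrow> i \<in> J \<Longrightarrow> f i \<in> set (frame_list f J)"
  by (simp add: frame_list_def)

lemma length_frame_list: "length (frame_list f I) = card I"
  by (simp add: frame_list_def)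

lemma frame_list_empty: "frame_list f {} = []"
  by (simp add: frame_list_def)

lemma form_inner_sum_left:
  "form_inner q f (\<lambda>vs. \<Sum>i\<in>A. c i * \<omega> i vs) \<phi> = (\<Sum>i\<in>A. c i * form_inner q f (\<omega> i) \<phi>)"
  unfolding form_inner_def sum_distrib_left sum_distrib_right
  by (subst sum.swap) (simp add: mult.assoc)

lemma form_inner_sym: "form_inner q f \<omega> \<phi> = form_inner q f \<phi> \<omega>"
  unfolding form_inner_def by (simp add: mult.commute)

lemma form_inner_sum_right:
  "form_inner q f \<phi> (\<lambda>vs. \<Sum>i\<in>A. c i * \<omega> i vs) = (\<Sum>i\<in>A. c i * form_inner q f \<phi> (\<omega> i))"
  unfolding form_inner_sym[of q f \<phi>] by (rule form_inner_sum_left)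

lemma form_inner_comb_left:
  "form_inner q f (\<lambda>vs. s * \<alpha> vs + t * \<beta> vs) \<phi> = s * form_inner q f \<alpha> \<phi> + t * form_inner q f \<beta> \<phi>"
  unfolding form_inner_def sum_distrib_left sum.distrib[symmetric] by (simp add: algebra_simps)

lemma form_inner_scale_left: "form_inner q f (\<lambda>vs. s * \<alpha> vs) \<phi> = s * form_inner q f \<alpha> \<phi>"
  using form_inner_comb_left[of q f s \<alpha> 0 \<alpha> \<phi>] by simp

lemma form_inner_scale_right: "form_inner q f \<phi> (\<lambda>vs. s * \<alpha> vs) = s * form_inner q f \<phi> \<alpha>"
  unfolding form_inner_sym[of q f \<phi>] by (rule form_inner_scale_left)

lemma form_inner_diff_left:
  "form_inner q f (\<lambda>vs. \<alpha> vs - \<beta> vs) \<phi> = form_inner q f \<alpha> \<phi> - form_inner q f \<beta> \<phi>"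
  using form_inner_comb_left[of q f 1 \<alpha> "-1" \<beta> \<phi>] by simp

lemma form_inner_nonneg: "0 \<le> form_inner q f \<omega> \<omega>"
  unfolding form_inner_def by (rule sum_nonneg) simp

text \<open>On the coefficients, contraction with a frame vector restricts to the index sets that contain its
index; the signs occur twice and cancel.\<close>

lemma form_inner_contract_frame:
  assumes "alternating_form \<omega>" "alternating_form \<phi>" "i \<in> {1..q}"
  shows "form_inner q f (\<iota> (f i) \<omega>) (\<iota> (f i) \<phi>) =
    (\<Sum>I\<in>{I\<in>Pow {1..q}. i \<in> I}. \<omega> (frame_list f I) * \<phi> (frame_list f I))"
proof -
  have fin: "finite J" if "J \<in> Pow {1..q}" for J using that finite_subset by auto
  have "form_inner q f (\<iota> (f i) \<omega>) (\<iota> (f i) \<phi>) =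
    (\<Sum>J\<in>{J\<in>Pow {1..q}. i \<notin> J}. \<omega> (f i # frame_list f J) * \<phi> (f i # frame_list f J))"
    unfolding form_inner_def contract_apply
  proof (rule sum.mono_neutral_right)
    show "\<forall>J\<in>Pow {1..q} - {J\<in>Pow {1..q}. i \<notin> J}.
        \<omega> (f i # frame_list f J) * \<phi> (f i # frame_list f J) = 0"
    proof
      fix J assume "J \<in> Pow {1..q} - {J\<in>Pow {1..q}. i \<notin> J}"
      then have "\<omega> (f i # frame_list f J) = 0"
        by (intro alternating_repeat_mem[OF assms(1)] frame_list_mem fin) auto
      then show "\<omega> (f i # frame_list f J) * \<phi> (f i # frame_list f J) = 0" by simp
    qed
  qed auto
  also have "\<dots> = (\<Sum>J\<in>{J\<in>Pow {1..q}. i \<notin> J}.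
      \<omega> (frame_list f (insert i J)) * \<phi> (frame_list f (insert i J)))"
  proof (rule sum.cong[OF refl])
    fix J assume J: "J \<in> {J\<in>Pow {1..q}. i \<notin> J}"
    then obtain \<sigma> where s: "\<sigma> * \<sigma> = 1" "\<And>\<omega>. alternating_form \<omega> \<Longrightarrow>
        \<omega> (frame_list f (insert i J)) = \<sigma> * \<omega> (f i # frame_list f J)"
      using alternating_insert_sign[of J i f] fin by auto
    have "\<omega> (frame_list f (insert i J)) * \<phi> (frame_list f (insert i J))
      = (\<sigma> * \<sigma>) * (\<omega> (f i # frame_list f J) * \<phi> (f i # frame_list f J))"
      unfolding s(2)[OF assms(1)] s(2)[OF assms(2)] by (simp only: mult_ac)
    then show "\<omega> (f i # frame_list f J) * \<phi> (f i # frame_list f J) =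
      \<omega> (frame_list f (insert i J)) * \<phi> (frame_list f (insert i J))"
      by (simp add: s(1))
  qed
  also have "\<dots> = (\<Sum>I\<in>{I\<in>Pow {1..q}. i \<in> I}. \<omega> (frame_list f I) * \<phi> (frame_list f I))"
    by (rule sum.reindex_bij_witness[of _ "\<lambda>I. I - {i}" "insert i"])
      (use assms(3) in \<open>auto simp: insert_absorb\<close>)
  finally show ?thesis .
qed

lemma ext_power_coeff_zero:
  "\<omega> \<in> ext_power Xi p \<Longrightarrow> card I \<noteq> p \<Longrightarrow> \<omega> (frame_list f I) = 0"
  by (simp add: ext_power_iff length_frame_list)

text \<open>The sum of \<open>e\<^sub>i \<and> (e\<^sub>i \<lrcorner> _)\<close> counts the degree. Here it reduces the inner product of \<open>p\<close>-forms to inner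
products of \<open>(p - 1)\<close>-forms, which gives an induction over the degree.\<close>

lemma form_inner_contract_sum:
  assumes "\<omega> \<in> ext_power Xi p" "\<phi> \<in> ext_power Xi p"
  shows "(\<Sum>i\<in>{1..q}. form_inner q f (\<iota> (f i) \<omega>) (\<iota> (f i) \<phi>)) = real p * form_inner q f \<omega> \<phi>"
proof -
  have alt: "alternating_form \<omega>" "alternating_form \<phi>"
    using assms by (auto simp: ext_power_iff horizontal_form_def)
  have "(\<Sum>i\<in>{1..q}. form_inner q f (\<iota> (f i) \<omega>) (\<iota> (f i) \<phi>)) =
    (\<Sum>i\<in>{1..q}. \<Sum>I\<in>{I\<in>Pow {1..q}. i \<in> I}. \<omega> (frame_list f I) * \<phi> (frame_list f I))"
    by (intro sum.cong refl form_inner_contract_frame alt)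
  also have "\<dots> = (\<Sum>I\<in>Pow {1..q}. \<Sum>i\<in>{i\<in>{1..q}. i \<in> I}. \<omega> (frame_list f I) * \<phi> (frame_list f I))"
    by (rule sum.swap_restrict) auto
  also have "\<dots> = (\<Sum>I\<in>Pow {1..q}. real p * (\<omega> (frame_list f I) * \<phi> (frame_list f I)))"
  proof (rule sum.cong[OF refl])
    fix I assume "I \<in> Pow {1..q}"
    then have "{i\<in>{1..q}. i \<in> I} = I" by auto
    then show "(\<Sum>i\<in>{i\<in>{1..q}. i \<in> I}. \<omega> (frame_list f I) * \<phi> (frame_list f I)) =
      real p * (\<omega> (frame_list f I) * \<phi> (frame_list f I))"
      using ext_power_coeff_zero[OF assms(1), of I f] by (cases "card I = p") auto
  qed
  finally show ?thesis by (simp add: form_inner_def sum_distrib_left)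
qed

text \<open>The data at one point: an inner product, a unit vector, and an orthonormal frame of its orthogonal
complement. The lemmas are applied both to the given frame and to the adapted one.\<close>

locale horizontal_frame =
  fixes G :: "'e::euclidean_space \<Rightarrow> 'e \<Rightarrow> real" and Xi :: 'e and q :: nat and f :: "nat \<Rightarrow> 'e"
  assumes bilinear: "bilinear G" and sym: "\<And>u v. G u v = G v u" and unit: "G Xi Xi = 1"
    and frame: "orthonormal_frame G Xi {1..q} f"
begin

abbreviation inner_form ("\<langle>_, _\<rangle>") where "\<langle>\<omega>, \<phi>\<rangle> \<equiv> form_inner q f \<omega> \<phi>"

lemma frame_horizontal: "i \<in> {1..q} \<Longrightarrow> G (f i) Xi = 0"
  using frame unfolding orthonormal_frame_def horizontal_def by auto

lemma frame_orthonormal: "i \<in> {1..q} \<Longrightarrow> j \<in> {1..q} \<Longrightarrow> G (f i) (f j) = (if i = j then 1 else 0)"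
  using frame unfolding orthonormal_frame_def by blast

lemma frame_expand: "G v Xi = 0 \<Longrightarrow> (\<Sum>i\<in>{1..q}. G v (f i) *\<^sub>R f i) = v"
  using frame unfolding orthonormal_frame_def horizontal_def by auto

lemma full_expand: "v = G v Xi *\<^sub>R Xi + (\<Sum>i\<in>{1..q}. G v (f i) *\<^sub>R f i)"
proof -
  let ?w = "v - G v Xi *\<^sub>R Xi"
  have "G ?w Xi = 0"
    by (simp add: bilinear_lsub[OF bilinear] bilinear_lmul[OF bilinear] unit)
  from frame_expand[OF this]
  have "(\<Sum>i\<in>{1..q}. G v (f i) *\<^sub>R f i) = ?w"
    by (simp add: bilinear_lsub[OF bilinear] bilinear_lmul[OF bilinear] sym[of Xi "f _"] frame_horizontal)
  then show ?thesis by (simp add: algebra_simps)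
qed

lemma linear_expand:
  assumes "linear L" "G v Xi = 0"
  shows "L v = (\<Sum>i\<in>{1..q}. G v (f i) * (L (f i) :: real))"
proof -
  have "L v = L (\<Sum>i\<in>{1..q}. G v (f i) *\<^sub>R f i)" by (simp only: frame_expand[OF assms(2)])
  also have "\<dots> = (\<Sum>i\<in>{1..q}. G v (f i) * L (f i))"
    by (simp add: linear_sum[OF assms(1)] linear_cmul[OF assms(1)])
  finally show ?thesis .
qed

lemma horizontal_form_expand:
  assumes "horizontal_form Xi \<omega>"
  shows "\<omega> (v # vs) = (\<Sum>i\<in>{1..q}. G v (f i) * \<omega> (f i # vs))"
proof -
  have lin: "linear (\<lambda>v. \<omega> (v # vs))"
    using assms by (simp add: horizontal_form_def alternating_linear_hd)
  have "\<omega> (Xi # vs) = \<iota> Xi \<omega> vs" by (simp add: contract_apply)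
  also have "\<dots> = 0" using assms by (simp add: horizontal_form_def)
  finally have X0: "\<omega> (Xi # vs) = 0" .
  have "\<omega> (v # vs) = \<omega> ((G v Xi *\<^sub>R Xi + (\<Sum>i\<in>{1..q}. G v (f i) *\<^sub>R f i)) # vs)"
    by (simp only: full_expand[of v, symmetric])
  also have "\<dots> = (\<Sum>i\<in>{1..q}. G v (f i) * \<omega> (f i # vs))"
    using X0 by (simp add: linear_add[OF lin] linear_sum[OF lin] linear_cmul[OF lin])
  finally show ?thesis .
qed

text \<open>By horizontality the first argument may be expanded in the frame, and the coefficients of the
contraction with a frame vector are, up to sign, coefficients of \<open>\<omega>\<close> or zero. Induction over the list of
arguments then reaches arbitrary vectors.\<close>

lemma horizontal_form_zeroI:
  assumes "horizontal_form Xi \<omega>" "\<And>I. I \<subseteq> {1..q} \<Longrightarrow> \<omega> (frame_list f I) = 0"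
  shows "\<omega> vs = 0"
  using assms
proof (induction vs arbitrary: \<omega>)
  case Nil
  from Nil(2)[of "{}"] show ?case by (simp add: frame_list_empty)
next
  case (Cons v vs)
  have alt: "alternating_form \<omega>" using Cons.prems by (simp add: horizontal_form_def)
  have "\<omega> (f i # vs) = 0" if i: "i \<in> {1..q}" for i
  proof -
    have "\<iota> (f i) \<omega> vs = 0"
    proof (rule Cons.IH)
      show "horizontal_form Xi (\<iota> (f i) \<omega>)" by (rule horizontal_form_contract[OF Cons.prems(1)])
      fix J assume J: "J \<subseteq> {1..q}"
      then have fin: "finite J" by (rule finite_subset) simp
      show "\<iota> (f i) \<omega> (frame_list f J) = 0"
      proof (cases "i \<in> J")
        case True
        then show ?thesis
          using alternating_repeat_mem[OF alt frame_list_mem[OF fin]] by (simp add: contract_apply)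
      next
        case False
        then obtain \<sigma> :: real where s: "\<sigma> * \<sigma> = 1"
          "\<And>\<omega>. alternating_form \<omega> \<Longrightarrow> \<omega> (frame_list f (insert i J)) = \<sigma> * \<omega> (f i # frame_list f J)"
          using alternating_insert_sign[OF fin] by metis
        have "\<sigma> * \<omega> (f i # frame_list f J) = 0"
          using s(2)[OF alt] Cons.prems(2)[of "insert i J"] i J by simp
        moreover have "\<sigma> \<noteq> 0" using s(1) by auto
        ultimately show ?thesis by (simp add: contract_apply)
      qed
    qed
    then show ?thesis by (simp add: contract_apply)
  qed
  then show ?case by (simp add: horizontal_form_expand[OF Cons.prems(1), of v])
qed

lemma horizontal_form_eqI:
  assumes "horizontal_form Xi \<omega>" "horizontal_form Xi \<phi>"
    "\<And>I. I \<subseteq> {1..q} \<Longrightarrow> \<omega> (frame_list f I) = \<phi> (frame_list f I)"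
  shows "\<omega> = \<phi>"
proof
  fix vs
  have "horizontal_form Xi (\<lambda>vs. 1 * \<omega> vs + (-1) * \<phi> vs)"
    by (rule horizontal_form_comb[OF assms(1,2)])
  from horizontal_form_zeroI[OF this, of vs] assms(3) show "\<omega> vs = \<phi> vs" by simp
qed

lemma form_inner_definite:
  assumes "horizontal_form Xi \<omega>" "\<langle>\<omega>, \<omega>\<rangle> = 0"
  shows "\<omega> = (\<lambda>_. 0)"
proof
  fix vs
  have "\<forall>I\<in>Pow {1..q}. \<omega> (frame_list f I) * \<omega> (frame_list f I) = 0"
    using assms(2) unfolding form_inner_def
    by (rule sum_nonneg_eq_0_iff[THEN iffD1, rotated 2]) simp_all
  then show "\<omega> vs = 0" using horizontal_form_zeroI[OF assms(1), of vs] by auto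
qed

text \<open>Only index sets containing \<open>i\<close> contribute on the left, so this side is an inner product of contractions
with \<open>f i\<close>. The anticommutation relation then leaves \<open>\<omega>\<close> minus \<open>f\<^sub>i \<and> (f\<^sub>i \<lrcorner> \<omega>)\<close>; the coefficients of the latter
live on index sets containing \<open>i\<close>, those of a contraction with \<open>f i\<close> on the other ones.\<close>

lemma wedge_contract_adjoint_frame:
  assumes "alternating_form \<omega>" "alternating_form \<phi>" "i \<in> {1..q}"
  shows "\<langle>wedge G (f i) \<omega>, \<phi>\<rangle> = \<langle>\<omega>, \<iota> (f i) \<phi>\<rangle>"
proof -
  have z: "wedge G (f i) \<theta> (frame_list f I) = 0" if "I \<subseteq> {1..q}" "i \<notin> I" for \<theta> I
  proof (rule wedge_orthogonal)
    have fin: "finite I" using that(1) by (rule finite_subset) simp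
    fix v assume "v \<in> set (frame_list f I)"
    then obtain j where "j \<in> I" "v = f j" using fin by (auto simp: frame_list_def)
    then show "G (f i) v = 0" using that frame_orthonormal[OF assms(3), of j] by auto
  qed
  have "\<langle>wedge G (f i) \<omega>, \<phi>\<rangle> = (\<Sum>I\<in>{I\<in>Pow {1..q}. i \<in> I}.
      wedge G (f i) \<omega> (frame_list f I) * \<phi> (frame_list f I))"
    unfolding form_inner_def by (rule sum.mono_neutral_right) (auto simp: z)
  also have "\<dots> = \<langle>\<iota> (f i) (wedge G (f i) \<omega>), \<iota> (f i) \<phi>\<rangle>"
    by (rule form_inner_contract_frame[OF alternating_wedge[OF bilinear assms(1)] assms(2,3), symmetric])
  also have "\<dots> = \<langle>\<omega>, \<iota> (f i) \<phi>\<rangle> - \<langle>wedge G (f i) (\<iota> (f i) \<omega>), \<iota> (f i) \<phi>\<rangle>"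
    unfolding contract_wedge form_inner_diff_left by (simp add: frame_orthonormal[OF assms(3,3)])
  also have "\<langle>wedge G (f i) (\<iota> (f i) \<omega>), \<iota> (f i) \<phi>\<rangle> = 0"
    unfolding form_inner_def
  proof (rule sum.neutral, rule ballI)
    fix I assume I: "I \<in> Pow {1..q}"
    then have fin: "finite I" using finite_subset by auto
    show "wedge G (f i) (\<iota> (f i) \<omega>) (frame_list f I) * \<iota> (f i) \<phi> (frame_list f I) = 0"
      using alternating_repeat_mem[OF assms(2) frame_list_mem[OF fin]] z[of I] I
      by (cases "i \<in> I") (auto simp: contract_apply)
  qed
  finally show ?thesis by simp
qed

lemma wedge_contract_adjoint:
  assumes "alternating_form \<omega>" "alternating_form \<phi>" "G X Xi = 0"
  shows "\<langle>wedge G X \<omega>, \<phi>\<rangle> = \<langle>\<omega>, \<iota> X \<phi>\<rangle>"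
proof -
  have l1: "linear (\<lambda>X. \<langle>wedge G X \<omega>, \<phi>\<rangle>)"
    unfolding form_inner_def
    using linear_wedge_arg[OF bilinear]
    by (intro linear_compose_sum[rule_format]) (simp add: linear_iff algebra_simps)
  have l2: "linear (\<lambda>X. \<langle>\<omega>, \<iota> X \<phi>\<rangle>)"
    unfolding form_inner_def contract_apply
    using alternating_linear_hd[OF assms(2)]
    by (intro linear_compose_sum[rule_format]) (simp add: linear_iff algebra_simps)
  show ?thesis
    unfolding linear_expand[OF l1 assms(3)] linear_expand[OF l2 assms(3)]
    by (intro sum.cong refl arg_cong2[of _ _ _ _ "(*)"] wedge_contract_adjoint_frame assms)
qed

lemma wedge2_ext_power:
  assumes "G X Xi = 0" "G Y Xi = 0"
  shows "wedge2 G X Y \<in> ext_power Xi 2"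
proof -
  have "wedge G Y unit_form \<in> ext_power Xi (Suc 0)"
    by (rule ext_power_wedge[OF bilinear assms(2) ext_power_unit])
  from ext_power_wedge[OF bilinear assms(1) this] show ?thesis
    by (simp add: wedge2_def numeral_2_eq_2)
qed

lemma form_inner_unit: "\<langle>unit_form, \<phi>\<rangle> = \<phi> []"
proof -
  have "\<langle>unit_form, \<phi>\<rangle> = (\<Sum>I\<in>Pow {1..q}. if I = {} then \<phi> [] else 0)"
    unfolding form_inner_def
  proof (rule sum.cong[OF refl])
    fix I assume "I \<in> Pow {1..q}"
    then have "finite I" using finite_subset by auto
    then have "frame_list f I = [] \<longleftrightarrow> I = {}" by (auto simp: frame_list_def)
    then show "unit_form (frame_list f I) * \<phi> (frame_list f I) = (if I = {} then \<phi> [] else 0)"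
      by (auto simp: unit_form_def frame_list_empty)
  qed
  also have "\<dots> = \<phi> []" by (subst sum.delta) auto
  finally show ?thesis .
qed

lemma form_inner_wedge2:
  assumes "G X Xi = 0" "G Y Xi = 0" "alternating_form \<alpha>"
  shows "\<langle>\<alpha>, wedge2 G X Y\<rangle> = \<alpha> [X, Y]"
proof -
  have u: "alternating_form (unit_form :: 'e form)"
    using horizontal_form_unit by (auto simp: horizontal_form_def)
  have "\<langle>\<alpha>, wedge2 G X Y\<rangle> = \<langle>unit_form, \<iota> Y (\<iota> X \<alpha>)\<rangle>"
    unfolding form_inner_sym[of q f \<alpha>] wedge2_def
    by (simp add: wedge_contract_adjoint assms alternating_wedge[OF bilinear] alternating_contract u)
  then show ?thesis by (simp add: form_inner_unit contract_apply)
qed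

text \<open>The trace of the bilinear form \<open>S(u) T(v)\<close> over \<open>Q\<close> does not see the frame. All changes of frame below
reduce to this, one index at a time.\<close>

lemma frame_trace:
  assumes e: "orthonormal_frame G Xi {1..q} e" and S: "linear S" and T: "linear T"
  shows "(\<Sum>i\<in>{1..q}. S (e i) * T (e i)) = (\<Sum>i\<in>{1..q}. S (f i) * (T (f i) :: real))"
proof -
  interpret e: horizontal_frame G Xi q e
    by unfold_locales (use bilinear sym unit e in auto)
  have "(\<Sum>i\<in>{1..q}. S (e i) * T (e i)) =
      (\<Sum>i\<in>{1..q}. \<Sum>j\<in>{1..q}. G (e i) (f j) * S (f j) * T (e i))"
    by (intro sum.cong refl)
      (simp add: linear_expand[OF S e.frame_horizontal] sum_distrib_right)
  also have "\<dots> = (\<Sum>j\<in>{1..q}. \<Sum>i\<in>{1..q}. S (f j) * (G (f j) (e i) * T (e i)))"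
    by (subst sum.swap) (simp add: sym[of "f _"] mult_ac)
  also have "\<dots> = (\<Sum>j\<in>{1..q}. S (f j) * T (f j))"
    by (intro sum.cong refl) (simp add: e.linear_expand[OF T frame_horizontal] sum_distrib_left)
  finally show ?thesis .
qed

text \<open>Induction over the degree: \<open>p\<close> times the inner product is a trace over \<open>Q\<close> of inner products of
contractions, and both ingredients do not depend on the frame.\<close>

lemma form_inner_frame_invariant:
  assumes e: "orthonormal_frame G Xi {1..q} e"
    and "\<omega> \<in> ext_power Xi p" "\<phi> \<in> ext_power Xi p"
  shows "form_inner q e \<omega> \<phi> = form_inner q f \<omega> \<phi>"
  using assms(2,3)
proof (induction p arbitrary: \<omega> \<phi>)
  case 0
  have "form_inner q f' \<omega> \<phi> = (\<Sum>I\<in>Pow {1..q}. if I = {} then \<omega> [] * \<phi> [] else 0)"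
    for f' :: "nat \<Rightarrow> 'e"
    unfolding form_inner_def
  proof (rule sum.cong[OF refl])
    fix I assume "I \<in> Pow {1..q}"
    then have "finite I" using finite_subset by auto
    then show "\<omega> (frame_list f' I) * \<phi> (frame_list f' I) = (if I = {} then \<omega> [] * \<phi> [] else 0)"
      using ext_power_coeff_zero[OF 0(1), of I f'] by (auto simp: frame_list_empty)
  qed
  then show ?case by simp
next
  case (Suc p)
  interpret e: horizontal_frame G Xi q e
    by unfold_locales (use bilinear sym unit e in auto)
  have c: "\<iota> v \<omega> \<in> ext_power Xi p" "\<iota> v \<phi> \<in> ext_power Xi p" for v
    using ext_power_contract[OF Suc.prems(1)] ext_power_contract[OF Suc.prems(2)] by simp_all
  have alt: "alternating_form \<omega>" "alternating_form \<phi>"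
    using Suc.prems by (auto simp: ext_power_iff horizontal_form_def)
  have "real (Suc p) * form_inner q e \<omega> \<phi> =
      (\<Sum>i\<in>{1..q}. form_inner q e (\<iota> (e i) \<omega>) (\<iota> (e i) \<phi>))"
    by (rule form_inner_contract_sum[OF Suc.prems, symmetric])
  also have "\<dots> = (\<Sum>i\<in>{1..q}. \<langle>\<iota> (e i) \<omega>, \<iota> (e i) \<phi>\<rangle>)"
    by (intro sum.cong refl Suc.IH c)
  also have "\<dots> = (\<Sum>i\<in>{1..q}. \<Sum>I\<in>Pow {1..q}. \<omega> (e i # frame_list f I) * \<phi> (e i # frame_list f I))"
    by (simp add: form_inner_def contract_apply)
  also have "\<dots> = (\<Sum>I\<in>Pow {1..q}. \<Sum>i\<in>{1..q}. \<omega> (e i # frame_list f I) * \<phi> (e i # frame_list f I))"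
    by (rule sum.swap)
  also have "\<dots> = (\<Sum>I\<in>Pow {1..q}. \<Sum>i\<in>{1..q}. \<omega> (f i # frame_list f I) * \<phi> (f i # frame_list f I))"
    by (intro sum.cong refl frame_trace[OF e] alternating_linear_hd alt)
  also have "\<dots> = (\<Sum>i\<in>{1..q}. \<Sum>I\<in>Pow {1..q}. \<omega> (f i # frame_list f I) * \<phi> (f i # frame_list f I))"
    by (rule sum.swap)
  also have "\<dots> = (\<Sum>i\<in>{1..q}. \<langle>\<iota> (f i) \<omega>, \<iota> (f i) \<phi>\<rangle>)"
    by (simp add: form_inner_def contract_apply)
  also have "\<dots> = real (Suc p) * form_inner q f \<omega> \<phi>"
    by (rule form_inner_contract_sum[OF Suc.prems])
  finally show ?case by simp
qed

end

section \<open>The Clifford commutator with a 2-form\<close>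

lemma alternating_pair_swap: "alternating_form \<alpha> \<Longrightarrow> \<alpha> [u, v] = - \<alpha> [v, u]"
  using alternating_swap[of \<alpha> "[]" u v "[]"] by simp

lemma alternating_pair_diag: "alternating_form \<alpha> \<Longrightarrow> \<alpha> [v, v] = 0"
  using alternating_repeat[of \<alpha> "[]" v "[]" "[]"] by simp

definition index_pairs :: "nat \<Rightarrow> (nat \<times> nat) set" where
  "index_pairs q = {(j, k). j \<in> {1..q} \<and> k \<in> {1..q} \<and> j < k}"

lemma sum_index_pairs:
  fixes A :: "nat \<Rightarrow> nat \<Rightarrow> real"
  assumes "\<And>j. A j j = 0"
  shows "(\<Sum>j\<in>{1..q}. \<Sum>k\<in>{1..q}. A j k) = (\<Sum>(j, k)\<in>index_pairs q. A j k + A k j)"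
proof -
  let ?P = "index_pairs q" and ?P' = "prod.swap ` index_pairs q" and ?D = "(\<lambda>j. (j, j)) ` {1..q}"
  have fin: "finite ?P"
    by (rule finite_subset[of _ "{1..q} \<times> {1..q}"]) (auto simp: index_pairs_def)
  have "(\<Sum>j\<in>{1..q}. \<Sum>k\<in>{1..q}. A j k) = (\<Sum>(j, k)\<in>{1..q} \<times> {1..q}. A j k)"
    by (simp add: sum.cartesian_product)
  also have "{1..q} \<times> {1..q} = (?P \<union> ?P') \<union> ?D"
    by (auto simp: index_pairs_def image_iff)
  also have "(\<Sum>(j, k)\<in>(?P \<union> ?P') \<union> ?D. A j k) =
      (\<Sum>(j, k)\<in>?P \<union> ?P'. A j k) + (\<Sum>(j, k)\<in>?D. A j k)"
    using fin by (intro sum.union_disjoint) (auto simp: index_pairs_def)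
  also have "(\<Sum>(j, k)\<in>?D. A j k) = 0"
    using assms by (intro sum.neutral) auto
  also have "(\<Sum>(j, k)\<in>?P \<union> ?P'. A j k) = (\<Sum>(j, k)\<in>?P. A j k) + (\<Sum>(j, k)\<in>?P'. A j k)"
    using fin by (intro sum.union_disjoint) (auto simp: index_pairs_def)
  also have "(\<Sum>(j, k)\<in>?P'. A j k) = (\<Sum>(j, k)\<in>?P. A k j)"
    by (subst sum.reindex) (auto simp: inj_on_def intro!: sum.cong)
  finally show ?thesis by (simp add: sum.distrib split_def)
qed

lemma sum_coeff_2form:
  assumes "\<alpha> \<in> ext_power Xi 2"
  shows "(\<Sum>I\<in>Pow {1..q}. \<alpha> (frame_list f I) * H (frame_list f I)) =
    (\<Sum>(j, k)\<in>index_pairs q. \<alpha> [f j, f k] * H [f j, f k])"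
proof -
  let ?S = "{I\<in>Pow {1..q}. card I = 2}"
  have im: "?S = (\<lambda>(j, k). {j, k}) ` index_pairs q"
  proof (intro equalityI subsetI)
    fix I assume I: "I \<in> ?S"
    then obtain a b where ab: "I = {a, b}" "a \<noteq> b" by (auto simp: card_2_iff)
    define j k where "j = min a b" and "k = max a b"
    have "I = {j, k}" "j < k" using ab by (auto simp: j_def k_def min_def max_def)
    with I show "I \<in> (\<lambda>(j, k). {j, k}) ` index_pairs q"
      by (intro image_eqI[of _ _ "(j, k)"]) (auto simp: index_pairs_def)
  qed (auto simp: index_pairs_def)
  have inj: "inj_on (\<lambda>(j, k). {j, k}) (index_pairs q)"
    by (auto simp: inj_on_def index_pairs_def doubleton_eq_iff)
  have "(\<Sum>I\<in>Pow {1..q}. \<alpha> (frame_list f I) * H (frame_list f I)) =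
      (\<Sum>I\<in>?S. \<alpha> (frame_list f I) * H (frame_list f I))"
    by (rule sum.mono_neutral_right) (auto simp: ext_power_coeff_zero[OF assms])
  also have "\<dots> = (\<Sum>(j, k)\<in>index_pairs q. \<alpha> (frame_list f {j, k}) * H (frame_list f {j, k}))"
    unfolding im by (subst sum.reindex[OF inj]) (simp add: o_def split_def)
  also have "\<dots> = (\<Sum>(j, k)\<in>index_pairs q. \<alpha> [f j, f k] * H [f j, f k])"
  proof (rule sum.cong[OF refl], clarify)
    fix j k assume "(j, k) \<in> index_pairs q"
    then have "frame_list f {j, k} = [f j, f k]"
      by (simp add: index_pairs_def frame_list_def sorted_list_of_set_insert)
    then show "\<alpha> (frame_list f {j, k}) * H (frame_list f {j, k}) = \<alpha> [f j, f k] * H [f j, f k]"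
      by simp
  qed
  finally show ?thesis .
qed

context horizontal_frame
begin

lemma alternating_clifford_vec: "alternating_form \<omega> \<Longrightarrow> alternating_form (clifford_vec G v \<omega>)"
  using alternating_comb[OF alternating_wedge[OF bilinear] alternating_contract, of \<omega> \<omega> 1 v "-1" v]
  by (simp add: clifford_vec_def[abs_def])

lemma horizontal_form_clifford_vec:
  "G v Xi = 0 \<Longrightarrow> horizontal_form Xi \<omega> \<Longrightarrow> horizontal_form Xi (clifford_vec G v \<omega>)"
  using horizontal_form_comb[OF horizontal_form_wedge[OF bilinear] horizontal_form_contract,
      of v Xi \<omega> \<omega> 1 "-1" v]
  by (simp add: clifford_vec_def[abs_def])

lemma alternating_unit: "alternating_form (unit_form :: 'e form)"
  using horizontal_form_unit by (auto simp: horizontal_form_def)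

abbreviation clifford_word :: "'e list \<Rightarrow> 'e form \<Rightarrow> 'e form" where
  "clifford_word \<equiv> foldr (clifford_vec G)"

lemma alternating_clifford_word: "alternating_form \<omega> \<Longrightarrow> alternating_form (clifford_word us \<omega>)"
  by (induction us) (auto simp: alternating_clifford_vec)

lemma horizontal_form_clifford_word:
  "(\<And>u. u \<in> set us \<Longrightarrow> G u Xi = 0) \<Longrightarrow> horizontal_form Xi \<omega> \<Longrightarrow>
    horizontal_form Xi (clifford_word us \<omega>)"
  by (induction us) (auto simp: horizontal_form_clifford_vec)

lemma contract_clifford_word:
  assumes "j \<in> {1..q}" "set is \<subseteq> {1..q}" "j \<notin> set is"
  shows "\<iota> (f j) (clifford_word (map f is) unit_form) = (\<lambda>_. 0)"
  using assms
proof (induction "is")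
  case Nil
  show ?case by (auto simp: contract_apply unit_form_def)
next
  case (Cons i "is")
  let ?W = "clifford_word (map f is) unit_form"
  have IH: "\<iota> (f j) ?W = (\<lambda>_. 0)" using Cons by simp
  have "G (f i) (f j) = 0" using Cons.prems frame_orthonormal[of i j] by auto
  moreover have "\<iota> (f j) (\<iota> (f i) ?W) vs = 0" for vs
  proof -
    have "\<iota> (f j) (\<iota> (f i) ?W) vs = - \<iota> (f j) ?W (f i # vs)"
      using contract_anticommute[OF alternating_clifford_word[OF alternating_unit], of "f j" "f i" "map f is" vs]
      by (simp add: contract_apply)
    then show ?thesis by (simp add: IH)
  qed
  moreover have "\<iota> (f j) (wedge G (f i) ?W) vs = G (f i) (f j) * ?W vs" for vs
    unfolding contract_wedge IH wedge_zero by simp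
  ultimately show ?case
    by (simp add: fun_eq_iff clifford_vec_def[of G "f i" ?W] contract_apply)
qed

text \<open>Applying \<open>f\<^sub>i\<^sub>1 \<cdot> \<dots> \<cdot> f\<^sub>i\<^sub>k\<close> to \<open>1\<close> yields \<open>f\<^sub>i\<^sub>1 \<and> \<dots> \<and> f\<^sub>i\<^sub>k\<close>, because for distinct indices the contraction parts
vanish; hence the coefficients are those of a basis element.\<close>

lemma clifford_word_coeff:
  assumes "sorted_wrt (<) is" "sorted_wrt (<) js" "set is \<subseteq> {1..q}" "set js \<subseteq> {1..q}"
  shows "clifford_word (map f is) unit_form (map f js) = (if is = js then 1 else 0)"
  using assms
proof (induction "is" arbitrary: js)
  case Nil
  show ?case by (simp add: unit_form_def)
next
  case (Cons i "is")
  let ?W = "clifford_word (map f is) unit_form"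
  have i: "i \<in> {1..q}" "i \<notin> set is" "set is \<subseteq> {1..q}" using Cons.prems by auto
  have step: "clifford_word (map f (i # is)) unit_form = wedge G (f i) ?W"
    using contract_clifford_word[OF i(1,3,2)] by (simp add: clifford_vec_def[of G "f i" ?W])
  show ?case
  proof (cases js)
    case Nil
    then show ?thesis unfolding step by (simp add: wedge_Nil)
  next
    case js: (Cons j js')
    have j: "j \<in> {1..q}" using Cons.prems js by auto
    consider "j \<notin> set (i # is)" | "j = i" | "j \<in> set is" by auto
    then show ?thesis
    proof cases
      case 1
      have "clifford_word (map f (i # is)) unit_form (map f js) =
          \<iota> (f j) (clifford_word (map f (i # is)) unit_form) (map f js')"
        by (simp only: contract_apply js list.map)
      then show ?thesis using 1 js contract_clifford_word[OF j Cons.prems(3) 1] by auto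
    next
      case 2
      have "clifford_word (map f (i # is)) unit_form (map f js) = ?W (map f js')"
        unfolding step js
        by (simp add: 2 wedge_Cons wedge_zero contract_clifford_word[OF i(1,3,2)]
            frame_orthonormal[OF i(1) i(1)])
      also have "\<dots> = (if is = js' then 1 else 0)"
        using Cons.prems js by (intro Cons.IH) auto
      finally show ?thesis using 2 js by simp
    next
      case 3
      then have "i < j" using Cons.prems by auto
      then have less: "i < k" if "k \<in> set js" for k using that Cons.prems js by auto
      have "wedge G (f i) ?W (map f js) = 0"
      proof (rule wedge_orthogonal)
        fix v assume "v \<in> set (map f js)"
        then obtain k where "k \<in> set js" "v = f k" by auto
        then show "G (f i) v = 0"
          using frame_orthonormal[OF i(1), of k] less[of k] Cons.prems by auto
      qed
      then show ?thesis using \<open>i < j\<close> js by (simp only: step) auto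
    qed
  qed
qed

text \<open>This expansion lets a form that acts from the left in \<open>clifford\<close> be recovered from its action on \<open>1\<close>.\<close>

lemma horizontal_form_reproduce:
  assumes "horizontal_form Xi \<omega>"
  shows "(\<lambda>vs. \<Sum>I\<in>Pow {1..q}. \<omega> (frame_list f I) * clifford_word (frame_list f I) unit_form vs) = \<omega>"
proof (rule horizontal_form_eqI[OF _ assms])
  have fin: "finite I" if "I \<subseteq> {1..q}" for I using that finite_subset by auto
  show "horizontal_form Xi
      (\<lambda>vs. \<Sum>I\<in>Pow {1..q}. \<omega> (frame_list f I) * clifford_word (frame_list f I) unit_form vs)"
  proof (intro horizontal_form_sum horizontal_form_clifford_word horizontal_form_unit)
    fix I u assume "I \<in> Pow {1..q}" "u \<in> set (frame_list f I)"
    then show "G u Xi = 0" using fin by (auto simp: frame_list_def intro!: frame_horizontal)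
  qed
  fix J assume J: "J \<subseteq> {1..q}"
  have "clifford_word (frame_list f I) unit_form (frame_list f J) = (if I = J then 1 else 0)"
    if "I \<in> Pow {1..q}" for I
    using clifford_word_coeff[of "sorted_list_of_set I" "sorted_list_of_set J"] fin[of I] fin[of J] J that
      sorted_list_of_set_inject[of I J]
    by (auto simp: frame_list_def strict_sorted_list_of_set)
  then have "(\<Sum>I\<in>Pow {1..q}. \<omega> (frame_list f I) *
      clifford_word (frame_list f I) unit_form (frame_list f J)) =
    (\<Sum>I\<in>Pow {1..q}. if I = J then \<omega> (frame_list f J) else 0)"
    by (intro sum.cong refl) auto
  also have "\<dots> = \<omega> (frame_list f J)" using J by (subst sum.delta) auto
  finally show "(\<Sum>I\<in>Pow {1..q}. \<omega> (frame_list f I) *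
      clifford_word (frame_list f I) unit_form (frame_list f J)) = \<omega> (frame_list f J)" .
qed

text \<open>Clifford multiplication by \<open>v\<close> from the right. For a form \<open>\<omega>\<close> of degree \<open>n\<close> it is
\<open>(-1)\<^sup>n (v \<and> \<omega> + v \<lrcorner> \<omega>)\<close>; both terms live in degrees of the other parity, so the sign read off from the
number of arguments is opposite.\<close>

definition clifford_right :: "'e \<Rightarrow> 'e form \<Rightarrow> 'e form" where
  "clifford_right v \<omega> = (\<lambda>vs. - ((-1) ^ length vs * (wedge G v \<omega> vs + \<iota> v \<omega> vs)))"

lemma wedge_parity:
  "wedge G' X (\<lambda>vs. (-1) ^ length vs * \<omega> vs) vs = - ((-1) ^ length vs * wedge G' X \<omega> vs)"
proof -
  have "(-1) ^ length (omit i vs) = - ((-1) ^ length vs :: real)" if "i < length vs" for i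
  proof -
    have "Suc (length (omit i vs)) = length vs" using that by (simp add: omit_def)
    then show ?thesis by (metis mult_minus1 minus_minus power_Suc)
  qed
  then show ?thesis
    unfolding wedge_def sum_distrib_left sum_negf[symmetric]
    by (intro sum.cong refl) simp
qed

lemma wedge_clifford_right:
  "wedge G u (clifford_right v \<omega>) vs = (-1) ^ length vs * (wedge G u (wedge G v \<omega>) vs + wedge G u (\<iota> v \<omega>) vs)"
proof -
  have "wedge G u (clifford_right v \<omega>) vs =
    wedge G u (\<lambda>vs. (-1) ^ length vs * ((-1) * wedge G v \<omega> vs + (-1) * \<iota> v \<omega> vs)) vs"
    by (simp add: clifford_right_def algebra_simps)
  then show ?thesis unfolding wedge_parity wedge_comb by (simp add: algebra_simps)
qed

text \<open>Associativity of the Clifford product in the only form used here. The operators \<open>u \<and> _ - u \<lrcorner> _\<close> and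
\<open>v \<and> _ + v \<lrcorner> _\<close> anticommute, since the two contributions of \<open>G(u, v)\<close> cancel, and the parity sign
turns this into commutation.\<close>

lemma clifford_left_right_commute:
  assumes "alternating_form \<omega>"
  shows "clifford_vec G u (clifford_right v \<omega>) = clifford_right v (clifford_vec G u \<omega>)"
proof
  fix vs :: "'e list"
  let ?s = "(-1) ^ length vs :: real"
  have "clifford_vec G u (clifford_right v \<omega>) vs =
     ?s * (wedge G u (wedge G v \<omega>) vs + wedge G u (\<iota> v \<omega>) vs - (\<iota> u (wedge G v \<omega>) vs + \<iota> u (\<iota> v \<omega>) vs))"
    by (simp add: clifford_vec_def wedge_clifford_right contract_apply)
      (simp add: clifford_right_def contract_apply algebra_simps)
  also have "\<dots> = ?s * (wedge G u (wedge G v \<omega>) vs + wedge G u (\<iota> v \<omega>) vs - G u v * \<omega> vs + wedge G v (\<iota> u \<omega>) vs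
      - \<iota> u (\<iota> v \<omega>) vs)"
    by (simp add: contract_wedge sym[of v u])
  also have "\<dots> = - (?s * (wedge G v (wedge G u \<omega>) vs - wedge G v (\<iota> u \<omega>) vs +
      (\<iota> v (wedge G u \<omega>) vs - \<iota> v (\<iota> u \<omega>) vs)))"
    by (simp add: contract_wedge wedge_anticommute[of G u v] contract_anticommute[OF assms, of u v]
        algebra_simps)
  also have "\<dots> = clifford_right v (clifford_vec G u \<omega>) vs"
    unfolding clifford_right_def clifford_vec_def wedge_diff
    by (simp add: contract_apply[of v])
  finally show "clifford_vec G u (clifford_right v \<omega>) vs = clifford_right v (clifford_vec G u \<omega>) vs" .
qed

lemma clifford_word_right_commute:
  assumes "alternating_form \<omega>"
  shows "clifford_word us (clifford_right v \<omega>) = clifford_right v (clifford_word us \<omega>)"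
  by (induction us)
    (simp_all add: clifford_left_right_commute alternating_clifford_word assms)

lemma clifford_vec_unit: "clifford_vec G v unit_form = clifford_right v unit_form"
proof
  fix vs
  have "(\<lambda>vs. (-1) ^ length vs * unit_form vs) = (unit_form :: 'e form)"
    by (auto simp: unit_form_def)
  with wedge_parity[of G v unit_form vs]
  have "wedge G v unit_form vs = - ((-1) ^ length vs * wedge G v unit_form vs)" by simp
  then show "clifford_vec G v unit_form vs = clifford_right v unit_form vs"
    by (simp add: clifford_vec_def clifford_right_def contract_apply) (simp add: unit_form_def)
qed

lemma clifford_word_sum:
  "clifford_word us (\<lambda>vs. \<Sum>i\<in>A. c i * \<omega> i vs) = (\<lambda>vs. \<Sum>i\<in>A. c i * clifford_word us (\<omega> i) vs)"
  by (induction us)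
    (auto simp: clifford_vec_def wedge_sum contract_apply sum_subtractf right_diff_distrib)

lemma clifford_right_sum:
  "clifford_right v (\<lambda>vs. \<Sum>i\<in>A. c i * \<omega> i vs) = (\<lambda>vs. \<Sum>i\<in>A. c i * clifford_right v (\<omega> i) vs)"
  by (auto simp: clifford_right_def wedge_sum contract_apply sum.distrib[symmetric]
      sum_distrib_left sum_negf[symmetric] algebra_simps intro!: sum.cong)

lemma clifford_left_pair:
  "\<alpha> \<in> ext_power Xi 2 \<Longrightarrow> clifford q G f \<alpha> \<omega> =
    (\<lambda>vs. \<Sum>(j, k)\<in>index_pairs q. \<alpha> [f j, f k] * clifford_vec G (f j) (clifford_vec G (f k) \<omega>) vs)"
  unfolding clifford_def by (rule ext, subst sum_coeff_2form) (auto intro!: sum.cong)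

text \<open>Write \<open>\<alpha>\<close> as a combination of \<open>f\<^sub>j \<cdot> f\<^sub>k \<cdot> 1\<close>, replace these left multiplications of \<open>1\<close> by right
multiplications, and move the latter past all left multiplications coming from \<open>\<omega>\<close>.\<close>

lemma clifford_right_pair:
  assumes "\<alpha> \<in> ext_power Xi 2" "horizontal_form Xi \<omega>"
  shows "clifford q G f \<omega> \<alpha> =
    (\<lambda>vs. \<Sum>(j, k)\<in>index_pairs q. \<alpha> [f j, f k] * clifford_right (f k) (clifford_right (f j) \<omega>) vs)"
proof
  fix vs
  let ?c = "\<lambda>I. \<omega> (frame_list f I)" and ?u = "unit_form :: 'e form"
  let ?R = "\<lambda>p \<omega>. clifford_right (f (snd p)) (clifford_right (f (fst p)) \<omega>)"
  have u: "alternating_form ?u" by (rule alternating_unit)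
  have \<alpha>: "\<alpha> = (\<lambda>vs. \<Sum>p\<in>index_pairs q. \<alpha> [f (fst p), f (snd p)] * ?R p ?u vs)"
  proof
    fix vs
    have word2: "clifford_word [f j, f k] ?u = clifford_right (f k) (clifford_right (f j) ?u)" for j k
      by (simp add: clifford_vec_unit clifford_left_right_commute[OF u])
    have "horizontal_form Xi \<alpha>" using assms by (simp add: ext_power_iff)
    then have "\<alpha> vs = (\<Sum>I\<in>Pow {1..q}. \<alpha> (frame_list f I) * clifford_word (frame_list f I) ?u vs)"
      by (rule fun_cong[OF horizontal_form_reproduce[symmetric]])
    also have "\<dots> = (\<Sum>(j, k)\<in>index_pairs q. \<alpha> [f j, f k] * clifford_word [f j, f k] ?u vs)"
      by (rule sum_coeff_2form[OF assms(1)])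
    also have "\<dots> = (\<Sum>p\<in>index_pairs q. \<alpha> [f (fst p), f (snd p)] * ?R p ?u vs)"
      by (simp only: word2 split_def)
    finally show "\<alpha> vs = (\<Sum>p\<in>index_pairs q. \<alpha> [f (fst p), f (snd p)] * ?R p ?u vs)" .
  qed
  have au: "alternating_form (clifford_right v ?u)" for v
    by (simp add: clifford_vec_unit[symmetric] alternating_clifford_vec u)
  have word: "clifford_word us (?R p ?u) = ?R p (clifford_word us ?u)" for us p
    by (simp add: clifford_word_right_commute u au)
  have "clifford q G f \<omega> \<alpha> vs = (\<Sum>I\<in>Pow {1..q}. ?c I *
      (\<Sum>p\<in>index_pairs q. \<alpha> [f (fst p), f (snd p)] * ?R p (clifford_word (frame_list f I) ?u) vs))"
    unfolding clifford_def by (subst \<alpha>) (simp only: clifford_word_sum word)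
  also have "\<dots> = (\<Sum>p\<in>index_pairs q. \<alpha> [f (fst p), f (snd p)] *
      (\<Sum>I\<in>Pow {1..q}. ?c I * ?R p (clifford_word (frame_list f I) ?u) vs))"
    unfolding sum_distrib_left by (subst sum.swap) (simp only: mult_ac)
  also have "\<dots> = (\<Sum>p\<in>index_pairs q. \<alpha> [f (fst p), f (snd p)] *
      ?R p (\<lambda>vs. \<Sum>I\<in>Pow {1..q}. ?c I * clifford_word (frame_list f I) ?u vs) vs)"
    by (simp only: clifford_right_sum)
  also have "\<dots> = (\<Sum>p\<in>index_pairs q. \<alpha> [f (fst p), f (snd p)] * ?R p \<omega> vs)"
    by (simp only: horizontal_form_reproduce[OF assms(2)])
  finally show "clifford q G f \<omega> \<alpha> vs = (\<Sum>(j, k)\<in>index_pairs q.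
      \<alpha> [f j, f k] * clifford_right (f k) (clifford_right (f j) \<omega>) vs)"
    by (simp add: split_def)
qed

text \<open>The action of the skew endomorphism that corresponds to \<open>\<alpha>\<close> on forms by derivations.\<close>

definition derivation :: "'e form \<Rightarrow> 'e form \<Rightarrow> 'e form" where
  "derivation \<alpha> \<omega> = (\<lambda>vs. \<Sum>j\<in>{1..q}. \<Sum>k\<in>{1..q}. \<alpha> [f j, f k] * wedge G (f j) (\<iota> (f k) \<omega>) vs)"

text \<open>The terms \<open>u \<and> v \<and> \<omega>\<close> and the double contractions occur in both products and cancel, so that the
commutator preserves the degree.\<close>

lemma clifford_comm_pair:
  assumes "alternating_form \<omega>" "G u v = 0"
  shows "clifford_vec G u (clifford_vec G v \<omega>) vs - clifford_right v (clifford_right u \<omega>) vs =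
    -2 * (wedge G u (\<iota> v \<omega>) vs - wedge G v (\<iota> u \<omega>) vs)"
proof -
  have uv: "G v u = 0" using assms(2) sym by simp
  have s: "(-1) ^ length vs * ((-1) ^ length vs * r) = (r :: real)" for r
    by (simp add: mult.assoc[symmetric] power_add[symmetric])
  have "clifford_right v (clifford_right u \<omega>) vs =
      - (wedge G v (wedge G u \<omega>) vs + wedge G v (\<iota> u \<omega>) vs + \<iota> v (wedge G u \<omega>) vs + \<iota> v (\<iota> u \<omega>) vs)"
  proof -
    have "clifford_right v (clifford_right u \<omega>) vs = - ((-1) ^ length vs *
        (wedge G v (clifford_right u \<omega>) vs + clifford_right u \<omega> (v # vs)))"
      by (simp add: clifford_right_def[of v] contract_apply)
    also have "clifford_right u \<omega> (v # vs) = (-1) ^ length vs * (\<iota> v (wedge G u \<omega>) vs + \<iota> v (\<iota> u \<omega>) vs)"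
      by (simp add: clifford_right_def contract_apply)
    finally show ?thesis unfolding wedge_clifford_right
      by (simp add: distrib_left s)
  qed
  moreover have "clifford_vec G u (clifford_vec G v \<omega>) vs =
      wedge G u (wedge G v \<omega>) vs - wedge G u (\<iota> v \<omega>) vs - \<iota> u (wedge G v \<omega>) vs + \<iota> u (\<iota> v \<omega>) vs"
    unfolding clifford_vec_def wedge_diff by (simp add: contract_apply[of u])
  ultimately show ?thesis
    by (simp add: contract_wedge assms(2) uv wedge_anticommute[of G u v]
        contract_anticommute[OF assms(1), of u v] algebra_simps)
qed

lemma clifford_comm_derivation:
  assumes "\<alpha> \<in> ext_power Xi 2" "horizontal_form Xi \<omega>"
  shows "clifford_comm q G f \<alpha> \<omega> = (\<lambda>vs. -2 * derivation \<alpha> \<omega> vs)"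
proof
  fix vs
  have a: "alternating_form \<alpha>" and w: "alternating_form \<omega>"
    using assms by (simp_all add: ext_power_iff horizontal_form_def)
  let ?A = "\<lambda>j k. \<alpha> [f j, f k] * wedge G (f j) (\<iota> (f k) \<omega>) vs"
  have "clifford_comm q G f \<alpha> \<omega> vs = (\<Sum>(j, k)\<in>index_pairs q. \<alpha> [f j, f k] *
      (clifford_vec G (f j) (clifford_vec G (f k) \<omega>) vs - clifford_right (f k) (clifford_right (f j) \<omega>) vs))"
    unfolding clifford_comm_def clifford_left_pair[OF assms(1)] clifford_right_pair[OF assms]
    by (simp add: sum_subtractf[symmetric] split_def right_diff_distrib)
  also have "\<dots> = (\<Sum>(j, k)\<in>index_pairs q. -2 * (?A j k + ?A k j))"
  proof (rule sum.cong[OF refl], clarify)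
    fix j k assume "(j, k) \<in> index_pairs q"
    then have "G (f j) (f k) = 0" using frame_orthonormal[of j k] by (auto simp: index_pairs_def)
    then show "\<alpha> [f j, f k] * (clifford_vec G (f j) (clifford_vec G (f k) \<omega>) vs -
        clifford_right (f k) (clifford_right (f j) \<omega>) vs) = -2 * (?A j k + ?A k j)"
      by (simp add: clifford_comm_pair[OF w] alternating_pair_swap[OF a, of "f k" "f j"] algebra_simps)
  qed
  also have "\<dots> = -2 * (\<Sum>(j, k)\<in>index_pairs q. ?A j k + ?A k j)"
    by (simp add: sum_distrib_left split_def)
  also have "\<dots> = -2 * derivation \<alpha> \<omega> vs"
    unfolding derivation_def by (subst sum_index_pairs) (simp_all add: alternating_pair_diag[OF a])
  finally show "clifford_comm q G f \<alpha> \<omega> vs = -2 * derivation \<alpha> \<omega> vs" .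
qed

end

section \<open>Reduction of the curvature sum\<close>

text \<open>Here \<open>M\<close> and \<open>F\<close> stand for the inner products of single and of double contractions of \<open>\<omega>\<close>. In the terms with
the Kronecker symbol, \<open>H i j * H k l\<close> and \<open>- H j k * H i l\<close> give the same sum and \<open>H k i * H j l\<close>
gives nothing. In the others, exchanging \<open>i\<close> with \<open>l\<close> identifies the third product with the first.\<close>

lemma curvature_sum_identity:
  fixes H M :: "nat \<Rightarrow> nat \<Rightarrow> real" and F :: "nat \<Rightarrow> nat \<Rightarrow> nat \<Rightarrow> nat \<Rightarrow> real"
  assumes skew: "\<And>i j. i \<in> N \<Longrightarrow> j \<in> N \<Longrightarrow> H i j = - H j i"
    and F: "\<And>k j i l. F k j i l = - F k j l i" and "finite N"
  defines "T \<equiv> \<lambda>i j k l. (if k = i then M j l else 0) - F k j i l"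
  shows "(\<Sum>j\<in>N. \<Sum>i\<in>N. \<Sum>l\<in>N. \<Sum>k\<in>N.
      (2 * H i j * H k l - H j k * H i l - H k i * H j l) * T i j k l) =
    (\<Sum>j\<in>N. \<Sum>i\<in>N. \<Sum>l\<in>N. \<Sum>k\<in>N. H i j * H k l * T i j k l)
    + 2 * (\<Sum>j\<in>N. \<Sum>i\<in>N. \<Sum>l\<in>N. H i j * H i l * M j l)
    - (\<Sum>j\<in>N. \<Sum>i\<in>N. \<Sum>l\<in>N. \<Sum>k\<in>N. H k j * H i l * F k j i l)"
proof -
  define S4 where "S4 t = (\<Sum>j\<in>N. \<Sum>i\<in>N. \<Sum>l\<in>N. \<Sum>k\<in>N. t i j k l :: real)" for t
  have cong: "S4 t = S4 u" if "\<And>i j k l. i \<in> N \<Longrightarrow> j \<in> N \<Longrightarrow> k \<in> N \<Longrightarrow> l \<in> N \<Longrightarrow> t i j k l = u i j k l" for t u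
    unfolding S4_def using that by (intro sum.cong refl) auto
  let ?D = "\<lambda>i j k l. if k = i then M j l else 0"
  let ?N = "\<Sum>j\<in>N. \<Sum>i\<in>N. \<Sum>l\<in>N. H i j * H i l * M j l"
  let ?X = "S4 (\<lambda>i j k l. H i j * H k l * F k j i l)"
  let ?P = "S4 (\<lambda>i j k l. H k j * H i l * F k j i l)"
  have delta: "S4 (\<lambda>i j k l. t i j k l * ?D i j k l) = (\<Sum>j\<in>N. \<Sum>i\<in>N. \<Sum>l\<in>N. t i j i l * M j l)" for t
    unfolding S4_def
  proof (intro sum.cong refl)
    fix i j l assume "i \<in> N"
    have "(\<Sum>k\<in>N. t i j k l * (if k = i then M j l else 0)) = (\<Sum>k\<in>N. if k = i then t i j i l * M j l else 0)"
      by (rule sum.cong) auto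
    then show "(\<Sum>k\<in>N. t i j k l * (if k = i then M j l else 0)) = t i j i l * M j l"
      using \<open>i \<in> N\<close> \<open>finite N\<close> by simp
  qed
  have A1: "S4 (\<lambda>i j k l. H i j * H k l * ?D i j k l) = ?N"
    by (rule delta)
  have "S4 (\<lambda>i j k l. H j k * H i l * ?D i j k l) = (\<Sum>j\<in>N. \<Sum>i\<in>N. \<Sum>l\<in>N. H j i * H i l * M j l)"
    by (rule delta)
  also have "\<dots> = (\<Sum>j\<in>N. \<Sum>i\<in>N. \<Sum>l\<in>N. - (H i j * H i l * M j l))"
  proof (intro sum.cong refl)
    fix j i l assume "j \<in> N" "i \<in> N"
    then show "H j i * H i l * M j l = - (H i j * H i l * M j l)" by (simp add: skew[of j i])
  qed
  also have "\<dots> = - ?N" by (simp add: sum_negf)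
  finally have A2: "S4 (\<lambda>i j k l. H j k * H i l * ?D i j k l) = - ?N" .
  have diag: "H i i = 0" if "i \<in> N" for i using skew[OF that that] by simp
  have A3: "S4 (\<lambda>i j k l. H k i * H j l * ?D i j k l) = 0"
    unfolding delta by (intro sum.neutral ballI) (simp add: diag)
  have B2: "S4 (\<lambda>i j k l. H j k * H i l * F k j i l) = - ?P"
  proof -
    have "S4 (\<lambda>i j k l. H j k * H i l * F k j i l) = S4 (\<lambda>i j k l. - (H k j * H i l * F k j i l))"
    proof (rule cong)
      fix i j k l assume "j \<in> N" "k \<in> N"
      then show "H j k * H i l * F k j i l = - (H k j * H i l * F k j i l)" by (simp add: skew[of j k])
    qed
    then show ?thesis by (simp add: S4_def sum_negf)
  qed
  have "S4 (\<lambda>i j k l. H k i * H j l * F k j i l) = S4 (\<lambda>i j k l. H k l * H j i * F k j l i)"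
    unfolding S4_def by (intro sum.cong refl sum.swap)
  also have "\<dots> = ?X"
  proof (rule cong)
    fix i j k l assume "i \<in> N" "j \<in> N"
    then show "H k l * H j i * F k j l i = H i j * H k l * F k j i l"
      using skew[of j i] F[of k j l i] by simp
  qed
  finally have B3: "S4 (\<lambda>i j k l. H k i * H j l * F k j i l) = ?X" .
  have "S4 (\<lambda>i j k l. (2 * H i j * H k l - H j k * H i l - H k i * H j l) * T i j k l) =
    2 * (S4 (\<lambda>i j k l. H i j * H k l * ?D i j k l) - ?X)
    - (S4 (\<lambda>i j k l. H j k * H i l * ?D i j k l) - S4 (\<lambda>i j k l. H j k * H i l * F k j i l))
    - (S4 (\<lambda>i j k l. H k i * H j l * ?D i j k l) - S4 (\<lambda>i j k l. H k i * H j l * F k j i l))"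
    unfolding T_def S4_def by (simp add: sum_subtractf sum.distrib sum_distrib_left algebra_simps)
  also have "\<dots> = 3 * ?N - ?X - ?P" unfolding A1 A2 A3 B2 B3 by simp
  also have "\<dots> = S4 (\<lambda>i j k l. H i j * H k l * T i j k l) + 2 * ?N - ?P"
  proof -
    have "S4 (\<lambda>i j k l. H i j * H k l * T i j k l) =
        S4 (\<lambda>i j k l. H i j * H k l * ?D i j k l) - ?X"
      unfolding T_def S4_def by (simp add: sum_subtractf right_diff_distrib)
    then show ?thesis unfolding A1 by simp
  qed
  finally show ?thesis unfolding S4_def .
qed

lemma form_inner_sum2_left:
  "form_inner q f (\<lambda>vs. \<Sum>i\<in>A. \<Sum>j\<in>B. c i j * \<omega> i j vs) \<phi> =
    (\<Sum>i\<in>A. \<Sum>j\<in>B. c i j * form_inner q f (\<omega> i j) \<phi>)"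
  using form_inner_sum_left[where A = A and c = "\<lambda>_. 1" and \<phi> = \<phi> and q = q and f = f and
      \<omega> = "\<lambda>i vs. \<Sum>j\<in>B. c i j * \<omega> i j vs"]
  by (simp add: form_inner_sum_left)

lemma form_inner_sum2_right:
  "form_inner q f \<phi> (\<lambda>vs. \<Sum>i\<in>A. \<Sum>j\<in>B. c i j * \<omega> i j vs) =
    (\<Sum>i\<in>A. \<Sum>j\<in>B. c i j * form_inner q f \<phi> (\<omega> i j))"
  unfolding form_inner_sym[of q f \<phi>] by (rule form_inner_sum2_left)

lemma sum_split_pairs:
  fixes F :: "nat \<Rightarrow> real"
  assumes "odd q \<Longrightarrow> F q = 0"
  shows "(\<Sum>s\<in>{1..q}. F s) = (\<Sum>i\<in>{1..q div 2}. F (2 * i - 1) + F (2 * i))"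
proof -
  have *: "(\<Sum>s\<in>{1..2 * n}. F s) = (\<Sum>i\<in>{1..n}. F (2 * i - 1) + F (2 * i))" for n
    by (induction n) (simp_all add: algebra_simps)
  show ?thesis
  proof (cases "even q")
    case True
    then show ?thesis using *[of "q div 2"] by simp
  next
    case False
    then have q: "q = Suc (2 * (q div 2))" by presburger
    have "(\<Sum>s\<in>{1..q}. F s) = (\<Sum>s\<in>{1..2 * (q div 2)}. F s) + F q"
      by (subst (1 3) q) simp
    then show ?thesis using *[of "q div 2"] assms False by simp
  qed
qed

context horizontal_frame
begin

lemma form_inner_wedge_contract:
  assumes "alternating_form \<omega>" "i \<in> {1..q}" "k \<in> {1..q}"
  shows "\<langle>wedge G (f i) (\<iota> (f j) \<omega>), wedge G (f k) (\<iota> (f l) \<omega>)\<rangle> =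
    (if k = i then \<langle>\<iota> (f j) \<omega>, \<iota> (f l) \<omega>\<rangle> else 0)
    - \<langle>\<iota> (f k) (\<iota> (f j) \<omega>), \<iota> (f i) (\<iota> (f l) \<omega>)\<rangle>"
proof -
  note alt = alternating_contract[OF assms(1)]
  have "\<langle>wedge G (f i) (\<iota> (f j) \<omega>), wedge G (f k) (\<iota> (f l) \<omega>)\<rangle> =
      \<langle>\<iota> (f j) \<omega>, \<iota> (f i) (wedge G (f k) (\<iota> (f l) \<omega>))\<rangle>"
    by (intro wedge_contract_adjoint alt alternating_wedge bilinear frame_horizontal assms)
  also have "\<dots> = \<langle>\<iota> (f i) (wedge G (f k) (\<iota> (f l) \<omega>)), \<iota> (f j) \<omega>\<rangle>" by (rule form_inner_sym)
  also have "\<dots> = G (f k) (f i) * \<langle>\<iota> (f l) \<omega>, \<iota> (f j) \<omega>\<rangle>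
      - \<langle>wedge G (f k) (\<iota> (f i) (\<iota> (f l) \<omega>)), \<iota> (f j) \<omega>\<rangle>"
    unfolding contract_wedge form_inner_diff_left form_inner_scale_left ..
  also have "\<langle>wedge G (f k) (\<iota> (f i) (\<iota> (f l) \<omega>)), \<iota> (f j) \<omega>\<rangle> =
      \<langle>\<iota> (f i) (\<iota> (f l) \<omega>), \<iota> (f k) (\<iota> (f j) \<omega>)\<rangle>"
    by (intro wedge_contract_adjoint alternating_contract frame_horizontal assms)
  finally show ?thesis
    using frame_orthonormal[OF assms(3,2)]
    by (simp add: form_inner_sym[of q f "\<iota> (f l) \<omega>"] form_inner_sym[of q f "\<iota> (f i) _"])
qed

text \<open>The term that is discarded is the squared norm of \<open>\<Sum> H i j f\<^sub>i \<and> (f\<^sub>j \<lrcorner> \<omega>)\<close>.\<close>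

lemma curvature_form_lower_bound:
  assumes "horizontal_form Xi \<omega>"
    and skew: "\<And>i j. i \<in> {1..q} \<Longrightarrow> j \<in> {1..q} \<Longrightarrow> H i j = - H j i"
  shows "(\<Sum>j\<in>{1..q}. \<Sum>i\<in>{1..q}. \<Sum>l\<in>{1..q}. \<Sum>k\<in>{1..q}.
      (2 * H i j * H k l - H j k * H i l - H k i * H j l) *
        \<langle>wedge G (f i) (\<iota> (f j) \<omega>), wedge G (f k) (\<iota> (f l) \<omega>)\<rangle>)
    \<ge> 2 * (\<Sum>s\<in>{1..q}. \<langle>\<lambda>vs. \<Sum>j\<in>{1..q}. H s j * \<iota> (f j) \<omega> vs, \<lambda>vs. \<Sum>j\<in>{1..q}. H s j * \<iota> (f j) \<omega> vs\<rangle>)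
      - \<langle>\<lambda>vs. \<Sum>i\<in>{1..q}. \<Sum>j\<in>{1..q}. H i j * \<iota> (f i) (\<iota> (f j) \<omega>) vs,
         \<lambda>vs. \<Sum>i\<in>{1..q}. \<Sum>j\<in>{1..q}. H i j * \<iota> (f i) (\<iota> (f j) \<omega>) vs\<rangle>"
proof -
  let ?N = "{1..q}"
  let ?Q = "\<lambda>i j k l. \<langle>wedge G (f i) (\<iota> (f j) \<omega>), wedge G (f k) (\<iota> (f l) \<omega>)\<rangle>"
  let ?M = "\<lambda>j l. \<langle>\<iota> (f j) \<omega>, \<iota> (f l) \<omega>\<rangle>"
  let ?F = "\<lambda>k j i l. \<langle>\<iota> (f k) (\<iota> (f j) \<omega>), \<iota> (f i) (\<iota> (f l) \<omega>)\<rangle>"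
  let ?T = "\<lambda>i j k l. (if k = i then ?M j l else 0) - ?F k j i l"
  have alt: "alternating_form \<omega>" using assms(1) by (simp add: horizontal_form_def)
  have Q: "?Q i j k l = ?T i j k l" if "i \<in> ?N" "k \<in> ?N" for i j k l
    by (rule form_inner_wedge_contract[OF alt that])
  have F: "?F k j i l = - ?F k j l i" for k j i l
  proof -
    have "\<iota> (f i) (\<iota> (f l) \<omega>) = (\<lambda>vs. (-1) * \<iota> (f l) (\<iota> (f i) \<omega>) vs)"
      using contract_anticommute[OF alt, of "f i" "f l"] by auto
    then show ?thesis by (simp only: form_inner_scale_right)
  qed
  have "(\<Sum>j\<in>?N. \<Sum>i\<in>?N. \<Sum>l\<in>?N. \<Sum>k\<in>?N.
      (2 * H i j * H k l - H j k * H i l - H k i * H j l) * ?Q i j k l) =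
    (\<Sum>j\<in>?N. \<Sum>i\<in>?N. \<Sum>l\<in>?N. \<Sum>k\<in>?N.
      (2 * H i j * H k l - H j k * H i l - H k i * H j l) * ?T i j k l)"
    by (intro sum.cong refl arg_cong2[of _ _ _ _ "(*)"] Q)
  also have "\<dots> = (\<Sum>j\<in>?N. \<Sum>i\<in>?N. \<Sum>l\<in>?N. \<Sum>k\<in>?N. H i j * H k l * ?T i j k l)
    + 2 * (\<Sum>j\<in>?N. \<Sum>i\<in>?N. \<Sum>l\<in>?N. H i j * H i l * ?M j l)
    - (\<Sum>j\<in>?N. \<Sum>i\<in>?N. \<Sum>l\<in>?N. \<Sum>k\<in>?N. H k j * H i l * ?F k j i l)"
    by (rule curvature_sum_identity[OF skew F]) simp_all
  also have "(\<Sum>j\<in>?N. \<Sum>i\<in>?N. \<Sum>l\<in>?N. \<Sum>k\<in>?N. H i j * H k l * ?T i j k l) =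
      (\<Sum>j\<in>?N. \<Sum>i\<in>?N. \<Sum>l\<in>?N. \<Sum>k\<in>?N. H i j * H k l * ?Q i j k l)"
    by (intro sum.cong refl arg_cong2[of _ _ _ _ "(*)"] Q[symmetric])
  also have "\<dots> = \<langle>\<lambda>vs. \<Sum>j\<in>?N. \<Sum>i\<in>?N. H i j * wedge G (f i) (\<iota> (f j) \<omega>) vs,
      \<lambda>vs. \<Sum>l\<in>?N. \<Sum>k\<in>?N. H k l * wedge G (f k) (\<iota> (f l) \<omega>) vs\<rangle>"
    unfolding form_inner_sum2_left form_inner_sum2_right by (simp add: sum_distrib_left mult.assoc)
  also have "(\<Sum>j\<in>?N. \<Sum>i\<in>?N. \<Sum>l\<in>?N. H i j * H i l * ?M j l) =
    (\<Sum>s\<in>?N. \<langle>\<lambda>vs. \<Sum>j\<in>?N. H s j * \<iota> (f j) \<omega> vs, \<lambda>vs. \<Sum>j\<in>?N. H s j * \<iota> (f j) \<omega> vs\<rangle>)"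
    unfolding form_inner_sum_left form_inner_sum_right
    by (subst sum.swap) (simp add: sum_distrib_left mult.assoc)
  also have "(\<Sum>j\<in>?N. \<Sum>i\<in>?N. \<Sum>l\<in>?N. \<Sum>k\<in>?N. H k j * H i l * ?F k j i l) =
    \<langle>\<lambda>vs. \<Sum>i\<in>?N. \<Sum>j\<in>?N. H i j * \<iota> (f i) (\<iota> (f j) \<omega>) vs,
         \<lambda>vs. \<Sum>i\<in>?N. \<Sum>j\<in>?N. H i j * \<iota> (f i) (\<iota> (f j) \<omega>) vs\<rangle>"
  proof -
    have "(\<Sum>j\<in>?N. \<Sum>i\<in>?N. \<Sum>l\<in>?N. \<Sum>k\<in>?N. H k j * H i l * ?F k j i l) =
      (\<Sum>j\<in>?N. \<Sum>i\<in>?N. \<Sum>k\<in>?N. \<Sum>l\<in>?N. H k j * H i l * ?F k j i l)"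
      by (intro sum.cong refl sum.swap)
    also have "\<dots> = (\<Sum>j\<in>?N. \<Sum>k\<in>?N. \<Sum>i\<in>?N. \<Sum>l\<in>?N. H k j * H i l * ?F k j i l)"
      by (intro sum.cong refl sum.swap)
    also have "\<dots> = (\<Sum>k\<in>?N. \<Sum>j\<in>?N. \<Sum>i\<in>?N. \<Sum>l\<in>?N. H k j * H i l * ?F k j i l)"
      by (rule sum.swap)
    finally show ?thesis
      unfolding form_inner_sum2_left form_inner_sum2_right by (simp add: sum_distrib_left mult.assoc)
  qed
  finally show ?thesis
    using form_inner_nonneg[of q f "\<lambda>vs. \<Sum>j\<in>?N. \<Sum>i\<in>?N. H i j * wedge G (f i) (\<iota> (f j) \<omega>) vs"] by simp
qed

end

section \<open>Contractions with the planes of an adapted frame\<close>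

definition full_pair :: "nat set \<Rightarrow> nat \<Rightarrow> bool" where
  "full_pair I i \<longleftrightarrow> 2 * i - 1 \<in> I \<and> 2 * i \<in> I"

definition empty_pair :: "nat set \<Rightarrow> nat \<Rightarrow> bool" where
  "empty_pair I i \<longleftrightarrow> 2 * i - 1 \<notin> I \<and> 2 * i \<notin> I"

text \<open>The total weight of the moves that replace a pair \<open>{2 i - 1, 2 i}\<close> contained in \<open>I\<close> by a pair
\<open>{2 j - 1, 2 j}\<close> disjoint from \<open>I\<close>.\<close>

definition exchange_weight :: "(nat \<Rightarrow> real) \<Rightarrow> nat \<Rightarrow> nat set \<Rightarrow> real" where
  "exchange_weight b m I =
    (\<Sum>i\<in>{1..m}. \<Sum>j\<in>{1..m}. if full_pair I i \<and> empty_pair I j then \<bar>b i * b j\<bar> else 0)"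

context horizontal_frame
begin

lemma form_inner_contract_le:
  assumes "alternating_form \<omega>" "i \<in> {1..q}"
  shows "\<langle>\<iota> (f i) \<omega>, \<iota> (f i) \<omega>\<rangle> \<le> \<langle>\<omega>, \<omega>\<rangle>"
  unfolding form_inner_contract_frame[OF assms(1,1,2)] unfolding form_inner_def
  by (rule sum_mono2) auto

lemma coeff_insert_square:
  assumes "finite J" "i \<notin> J" "alternating_form \<omega>"
  shows "(\<omega> (f i # frame_list f J))\<^sup>2 = (\<omega> (frame_list f (insert i J)))\<^sup>2"
proof -
  obtain \<sigma> :: real where s: "\<sigma> * \<sigma> = 1"
    "\<And>\<omega>. alternating_form \<omega> \<Longrightarrow> \<omega> (frame_list f (insert i J)) = \<sigma> * \<omega> (f i # frame_list f J)"
    using alternating_insert_sign[OF assms(1,2)] by metis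
  show ?thesis unfolding s(2)[OF assms(3)] using s(1) by (simp add: power_mult_distrib power2_eq_square)
qed

definition contract_pair :: "nat \<Rightarrow> 'e form \<Rightarrow> 'e form" where
  "contract_pair i \<omega> = \<iota> (f (2 * i - 1)) (\<iota> (f (2 * i)) \<omega>)"

lemma contract_pair_coeff:
  assumes "alternating_form \<omega>" "finite J"
  shows "(contract_pair i \<omega> (frame_list f J))\<^sup>2 =
    (if empty_pair J i \<and> i > 0 then (\<omega> (frame_list f (J \<union> {2 * i - 1, 2 * i})))\<^sup>2 else 0)"
proof (cases "empty_pair J i \<and> i > 0")
  case True
  then have ni: "2 * i - 1 \<notin> J" "2 * i \<notin> insert (2 * i - 1) J" by (auto simp: empty_pair_def)
  have "(contract_pair i \<omega> (frame_list f J))\<^sup>2 = (\<iota> (f (2 * i)) \<omega> (f (2 * i - 1) # frame_list f J))\<^sup>2"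
    by (simp add: contract_pair_def contract_apply)
  also have "\<dots> = (\<iota> (f (2 * i)) \<omega> (frame_list f (insert (2 * i - 1) J)))\<^sup>2"
    by (rule coeff_insert_square[OF assms(2) ni(1) alternating_contract[OF assms(1)]])
  also have "\<dots> = (\<omega> (f (2 * i) # frame_list f (insert (2 * i - 1) J)))\<^sup>2"
    by (simp add: contract_apply)
  also have "\<dots> = (\<omega> (frame_list f (insert (2 * i) (insert (2 * i - 1) J))))\<^sup>2"
    by (rule coeff_insert_square[OF _ ni(2) assms(1)]) (simp add: assms(2))
  also have "insert (2 * i) (insert (2 * i - 1) J) = J \<union> {2 * i - 1, 2 * i}" by auto
  finally show ?thesis using True by simp
next
  case False
  have m: "f k \<in> set (frame_list f J)" if "k \<in> J" for k using frame_list_mem[OF assms(2) that] .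
  have "contract_pair i \<omega> (frame_list f J) = 0"
  proof (cases "i = 0")
    case True
    then show ?thesis using contract_twice[OF assms(1)] by (simp add: contract_pair_def)
  next
    case i: False
    show ?thesis
    proof (cases "2 * i \<in> J")
      case True
      then show ?thesis
        using alternating_repeat_mem[OF alternating_contract[OF assms(1)] m, of "2 * i" "f (2 * i - 1)"]
          contract_anticommute[OF assms(1), of "f (2 * i - 1)" "f (2 * i)" "frame_list f J"]
        by (simp add: contract_pair_def contract_apply)
    next
      case 2: False
      then have "2 * i - 1 \<in> J" using False i by (auto simp: empty_pair_def)
      then show ?thesis
        using alternating_repeat_mem[OF alternating_contract[OF assms(1)] m, of "2 * i - 1" "f (2 * i)"]
        by (simp add: contract_pair_def contract_apply)
    qed
  qed
  then show ?thesis unfolding if_not_P[OF False] by simp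
qed

text \<open>Only index sets \<open>J\<close> disjoint from both pairs contribute to the inner product, and there the two factors
are, up to sign, the coefficients of \<open>\<omega>\<close> at \<open>J\<close> enlarged by either pair. The bound is the inequality
\<open>2 x y \<le> x\<^sup>2 + y\<^sup>2\<close>, rewritten as a sum over the enlarged sets.\<close>

lemma contract_pair_cross_term:
  assumes alt: "alternating_form \<omega>" and ij: "i \<in> {1..q div 2}" "j \<in> {1..q div 2}" "i \<noteq> j"
  shows "c * \<langle>contract_pair i \<omega>, contract_pair j \<omega>\<rangle> \<le> (\<Sum>I\<in>Pow {1..q}.
      (if full_pair I i \<and> empty_pair I j then \<bar>c\<bar> * (\<omega> (frame_list f I))\<^sup>2 else 0) +
      (if full_pair I j \<and> empty_pair I i then \<bar>c\<bar> * (\<omega> (frame_list f I))\<^sup>2 else 0)) / 2"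
proof -
  let ?x = "\<lambda>i J. contract_pair i \<omega> (frame_list f J)"
  let ?S = "{J\<in>Pow {1..q}. empty_pair J i \<and> empty_pair J j}"
  have fin: "finite J" if "J \<in> Pow {1..q}" for J using that finite_subset by auto
  have reindex: "(\<Sum>J\<in>{J\<in>Pow {1..q}. empty_pair J k \<and> empty_pair J l}. (?x k J)\<^sup>2) =
      (\<Sum>I\<in>Pow {1..q}. if full_pair I k \<and> empty_pair I l then (\<omega> (frame_list f I))\<^sup>2 else 0)"
    if kl: "k \<in> {1..q div 2}" "l \<in> {1..q div 2}" "k \<noteq> l" for k l
  proof -
    have "(\<Sum>J\<in>{J\<in>Pow {1..q}. empty_pair J k \<and> empty_pair J l}. (?x k J)\<^sup>2) =
        (\<Sum>J\<in>{J\<in>Pow {1..q}. empty_pair J k \<and> empty_pair J l}.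
          (\<omega> (frame_list f (J \<union> {2 * k - 1, 2 * k})))\<^sup>2)"
      by (rule sum.cong[OF refl]) (use kl fin contract_pair_coeff[OF alt] in auto)
    also have "\<dots> = (\<Sum>I\<in>{I\<in>Pow {1..q}. full_pair I k \<and> empty_pair I l}. (\<omega> (frame_list f I))\<^sup>2)"
    proof (rule sum.reindex_bij_witness[of _ "\<lambda>I. I - {2 * k - 1, 2 * k}" "\<lambda>J. J \<union> {2 * k - 1, 2 * k}"])
      have k: "1 \<le> 2 * k - 1" "2 * k \<le> q" "2 * k - 1 \<noteq> 2 * l - 1" "2 * k - 1 \<noteq> 2 * l"
        "2 * k \<noteq> 2 * l - 1" "2 * k \<noteq> 2 * l" using kl unfolding atLeastAtMost_iff by presburger+
      fix J assume J: "J \<in> {J\<in>Pow {1..q}. empty_pair J k \<and> empty_pair J l}"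
      show "J \<union> {2 * k - 1, 2 * k} - {2 * k - 1, 2 * k} = J"
        using J by (auto simp: empty_pair_def)
      show "J \<union> {2 * k - 1, 2 * k} \<in> {I\<in>Pow {1..q}. full_pair I k \<and> empty_pair I l}"
        using J k unfolding empty_pair_def full_pair_def by auto
    next
      fix I assume I: "I \<in> {I\<in>Pow {1..q}. full_pair I k \<and> empty_pair I l}"
      show "I - {2 * k - 1, 2 * k} \<union> {2 * k - 1, 2 * k} = I"
        using I by (auto simp: full_pair_def)
      show "I - {2 * k - 1, 2 * k} \<in> {J\<in>Pow {1..q}. empty_pair J k \<and> empty_pair J l}"
        using I by (auto simp: empty_pair_def)
    qed simp
    also have "\<dots> = (\<Sum>I\<in>Pow {1..q}. if full_pair I k \<and> empty_pair I l then (\<omega> (frame_list f I))\<^sup>2 else 0)"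
      by (rule sum.inter_filter) simp
    finally show ?thesis .
  qed
  have "c * \<langle>contract_pair i \<omega>, contract_pair j \<omega>\<rangle> = (\<Sum>J\<in>Pow {1..q}. c * (?x i J * ?x j J))"
    by (simp add: form_inner_def sum_distrib_left)
  also have "\<dots> = (\<Sum>J\<in>?S. c * (?x i J * ?x j J))"
  proof (rule sum.mono_neutral_right)
    show "\<forall>J\<in>Pow {1..q} - ?S. c * (?x i J * ?x j J) = 0"
    proof
      fix J assume J: "J \<in> Pow {1..q} - ?S"
      then have "(?x i J)\<^sup>2 = 0 \<or> (?x j J)\<^sup>2 = 0"
        using contract_pair_coeff[OF alt fin, of J i] contract_pair_coeff[OF alt fin, of J j] by auto
      then show "c * (?x i J * ?x j J) = 0" by auto
    qed
  qed auto
  also have "\<dots> \<le> (\<Sum>J\<in>?S. \<bar>c\<bar> * ((?x i J)\<^sup>2 + (?x j J)\<^sup>2) / 2)"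
  proof (rule sum_mono)
    fix J
    have "c * (?x i J * ?x j J) \<le> \<bar>c\<bar> * \<bar>?x i J * ?x j J\<bar>"
      by (metis abs_ge_self abs_mult)
    also have "\<bar>?x i J * ?x j J\<bar> \<le> ((?x i J)\<^sup>2 + (?x j J)\<^sup>2) / 2"
      using sum_squares_bound[of "\<bar>?x i J\<bar>" "\<bar>?x j J\<bar>"] by (simp add: abs_mult)
    finally show "c * (?x i J * ?x j J) \<le> \<bar>c\<bar> * ((?x i J)\<^sup>2 + (?x j J)\<^sup>2) / 2"
      by (simp add: mult_left_mono)
  qed
  also have "\<dots> = \<bar>c\<bar> * ((\<Sum>J\<in>?S. (?x i J)\<^sup>2) + (\<Sum>J\<in>?S. (?x j J)\<^sup>2)) / 2"
    by (simp add: sum_divide_distrib[symmetric] sum_distrib_left[symmetric] sum.distrib)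
  also have "?S = {J\<in>Pow {1..q}. empty_pair J j \<and> empty_pair J i}" by auto
  also have "(\<Sum>J\<in>{J\<in>Pow {1..q}. empty_pair J j \<and> empty_pair J i}. (?x i J)\<^sup>2) = (\<Sum>J\<in>?S. (?x i J)\<^sup>2)"
    by (rule sum.cong) auto
  finally show ?thesis
    unfolding reindex[OF ij] reindex[OF ij(2,1) ij(3)[symmetric]]
    by (simp add: sum_distrib_left sum.distrib[symmetric] distrib_left if_distrib[of "(*) _"] cong: if_cong)
qed

text \<open>The diagonal terms of the expanded square are controlled by contracting with one vector of each pair
only; the off-diagonal terms produce the exchange weight, each ordered pair of planes once.\<close>

lemma contract_pairs_norm_le:
  assumes alt: "alternating_form \<omega>"
  shows "4 * \<langle>\<lambda>vs. \<Sum>i\<in>{1..q div 2}. b i * contract_pair i \<omega> vs,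
      \<lambda>vs. \<Sum>i\<in>{1..q div 2}. b i * contract_pair i \<omega> vs\<rangle> \<le>
    2 * (\<Sum>i\<in>{1..q div 2}. (b i)\<^sup>2 * (\<langle>\<iota> (f (2 * i - 1)) \<omega>, \<iota> (f (2 * i - 1)) \<omega>\<rangle> +
      \<langle>\<iota> (f (2 * i)) \<omega>, \<iota> (f (2 * i)) \<omega>\<rangle>))
    + 4 * (\<Sum>I\<in>Pow {1..q}. exchange_weight b (q div 2) I * (\<omega> (frame_list f I))\<^sup>2)"
proof -
  let ?m = "{1..q div 2}"
  let ?L = "\<lambda>i j. \<langle>contract_pair i \<omega>, contract_pair j \<omega>\<rangle>"
  let ?n = "\<lambda>i. \<langle>\<iota> (f i) \<omega>, \<iota> (f i) \<omega>\<rangle>"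
  let ?V = "\<lambda>i j. \<Sum>I\<in>Pow {1..q}.
      if full_pair I i \<and> empty_pair I j then \<bar>b i * b j\<bar> * (\<omega> (frame_list f I))\<^sup>2 else 0"
  have Vdiag: "?V i i = 0" for i
    by (intro sum.neutral ballI) (auto simp: full_pair_def empty_pair_def)
  \<comment> \<open>Contracting once more does not increase the norm; doing this for either vector of the pair and adding
    gives the mean of both norms.\<close>
  have diag: "2 * ?L i i \<le> ?n (2 * i - 1) + ?n (2 * i)" if "i \<in> ?m" for i
  proof -
    have i: "2 * i - 1 \<in> {1..q}" "2 * i \<in> {1..q}" using that by auto
    have "?L i i \<le> ?n (2 * i)"
      unfolding contract_pair_def by (rule form_inner_contract_le[OF alternating_contract[OF alt] i(1)])
    moreover have "contract_pair i \<omega> = (\<lambda>vs. (-1) * \<iota> (f (2 * i)) (\<iota> (f (2 * i - 1)) \<omega>) vs)"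
      using contract_anticommute[OF alt, of "f (2 * i - 1)" "f (2 * i)"] by (auto simp: contract_pair_def)
    then have "?L i i = \<langle>\<iota> (f (2 * i)) (\<iota> (f (2 * i - 1)) \<omega>), \<iota> (f (2 * i)) (\<iota> (f (2 * i - 1)) \<omega>)\<rangle>"
      by (simp add: form_inner_def)
    then have "?L i i \<le> ?n (2 * i - 1)"
      using form_inner_contract_le[OF alternating_contract[OF alt, of "f (2 * i - 1)"] i(2)] by simp
    ultimately show ?thesis by simp
  qed
  have "\<langle>\<lambda>vs. \<Sum>i\<in>?m. b i * contract_pair i \<omega> vs, \<lambda>vs. \<Sum>i\<in>?m. b i * contract_pair i \<omega> vs\<rangle> =
      (\<Sum>i\<in>?m. \<Sum>j\<in>?m. b i * b j * ?L i j)"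
    unfolding form_inner_sum_left form_inner_sum_right by (simp add: sum_distrib_left mult.assoc)
  also have "\<dots> \<le> (\<Sum>i\<in>?m. \<Sum>j\<in>?m. (if i = j then (b i)\<^sup>2 * ?L i i else 0) + (?V i j + ?V j i) / 2)"
  proof (intro sum_mono)
    fix i j assume ij: "i \<in> ?m" "j \<in> ?m"
    show "b i * b j * ?L i j \<le> (if i = j then (b i)\<^sup>2 * ?L i i else 0) + (?V i j + ?V j i) / 2"
    proof (cases "i = j")
      case True
      then show ?thesis by (simp only: Vdiag) (simp add: power2_eq_square)
    next
      case False
      with contract_pair_cross_term[OF alt ij False, of "b i * b j"] show ?thesis
        by (simp add: sum.distrib abs_mult mult_ac cong: if_cong)
    qed
  qed
  also have "\<dots> = (\<Sum>i\<in>?m. (b i)\<^sup>2 * ?L i i) + ((\<Sum>i\<in>?m. \<Sum>j\<in>?m. ?V i j) + (\<Sum>i\<in>?m. \<Sum>j\<in>?m. ?V j i)) / 2"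
    by (simp add: sum.distrib sum_divide_distrib[symmetric])
  also have "(\<Sum>i\<in>?m. \<Sum>j\<in>?m. ?V j i) = (\<Sum>i\<in>?m. \<Sum>j\<in>?m. ?V i j)" by (rule sum.swap)
  also have "(\<Sum>i\<in>?m. \<Sum>j\<in>?m. ?V i j) =
      (\<Sum>I\<in>Pow {1..q}. exchange_weight b (q div 2) I * (\<omega> (frame_list f I))\<^sup>2)"
  proof -
    have "(\<Sum>i\<in>?m. \<Sum>j\<in>?m. ?V i j) = (\<Sum>i\<in>?m. \<Sum>I\<in>Pow {1..q}. \<Sum>j\<in>?m.
        if full_pair I i \<and> empty_pair I j then \<bar>b i * b j\<bar> * (\<omega> (frame_list f I))\<^sup>2 else 0)"
      by (intro sum.cong refl, rule sum.swap)
    also have "\<dots> = (\<Sum>I\<in>Pow {1..q}. \<Sum>i\<in>?m. \<Sum>j\<in>?m.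
        if full_pair I i \<and> empty_pair I j then \<bar>b i * b j\<bar> * (\<omega> (frame_list f I))\<^sup>2 else 0)"
      by (rule sum.swap)
    also have "\<dots> = (\<Sum>I\<in>Pow {1..q}. exchange_weight b (q div 2) I * (\<omega> (frame_list f I))\<^sup>2)"
      unfolding exchange_weight_def sum_distrib_right by (intro sum.cong refl) simp
    finally show ?thesis .
  qed
  also have "(\<Sum>i\<in>?m. (b i)\<^sup>2 * ?L i i) \<le> (\<Sum>i\<in>?m. (b i)\<^sup>2 * (?n (2 * i - 1) + ?n (2 * i)) / 2)"
  proof (rule sum_mono)
    fix i assume "i \<in> ?m"
    from mult_left_mono[OF diag[OF this] zero_le_power2[of "b i"]]
    show "(b i)\<^sup>2 * ?L i i \<le> (b i)\<^sup>2 * (?n (2 * i - 1) + ?n (2 * i)) / 2" by (simp add: algebra_simps)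
  qed
  finally show ?thesis by (simp add: sum_divide_distrib[symmetric])
qed

end

section \<open>The operator of the curvature term\<close>

lemma sum_quadruple_swap:
  fixes Q :: "'a \<Rightarrow> 'a \<Rightarrow> real"
  shows "(\<Sum>r\<in>A. \<Sum>s\<in>A. Q r s * (\<Sum>j\<in>N. \<Sum>i\<in>N. \<Sum>l\<in>N. \<Sum>k\<in>N. C r i j * C s k l * t i j k l)) =
    (\<Sum>j\<in>N. \<Sum>i\<in>N. \<Sum>l\<in>N. \<Sum>k\<in>N. (\<Sum>r\<in>A. \<Sum>s\<in>A. Q r s * C r i j * C s k l) * t i j k l)"
proof -
  let ?N = "N \<times> N \<times> N \<times> N"
  have fold: "(\<Sum>j\<in>N. \<Sum>i\<in>N. \<Sum>l\<in>N. \<Sum>k\<in>N. u j i l k) = (\<Sum>(j, i, l, k)\<in>?N. u j i l k)"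
    for u :: "'b \<Rightarrow> 'b \<Rightarrow> 'b \<Rightarrow> 'b \<Rightarrow> real"
    by (simp add: sum.cartesian_product)
  have "(\<Sum>r\<in>A. \<Sum>s\<in>A. Q r s * (\<Sum>(j, i, l, k)\<in>?N. C r i j * C s k l * t i j k l)) =
      (\<Sum>r\<in>A. \<Sum>s\<in>A. \<Sum>(j, i, l, k)\<in>?N. Q r s * C r i j * C s k l * t i j k l)"
    by (simp add: sum_distrib_left split_def mult.assoc)
  also have "\<dots> = (\<Sum>r\<in>A. \<Sum>(j, i, l, k)\<in>?N. \<Sum>s\<in>A. Q r s * C r i j * C s k l * t i j k l)"
    by (simp add: split_def sum.swap[of _ A ?N])
  also have "\<dots> = (\<Sum>(j, i, l, k)\<in>?N. \<Sum>r\<in>A. \<Sum>s\<in>A. Q r s * C r i j * C s k l * t i j k l)"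
    by (simp add: split_def sum.swap[of _ A ?N])
  finally show ?thesis unfolding fold by (simp add: sum_distrib_right split_def)
qed

lemma ext_power_sum2:
  assumes "\<And>i j. i \<in> A \<Longrightarrow> j \<in> B \<Longrightarrow> \<omega> i j \<in> ext_power Xi p"
  shows "(\<lambda>vs. \<Sum>i\<in>A. \<Sum>j\<in>B. c i j * \<omega> i j vs) \<in> ext_power Xi p"
proof -
  have "(\<lambda>vs. \<Sum>i\<in>A. 1 * (\<Sum>j\<in>B. c i j * \<omega> i j vs)) \<in> ext_power Xi p"
    by (rule ext_power_sum, rule ext_power_sum) (rule assms)
  then show ?thesis by simp
qed

lemma wedge2_apply: "wedge2 G X Y [Z, W] = G X Z * G Y W - G X W * G Y Z"
  by (simp add: wedge2_def wedge_Cons contract_wedge wedge_Nil unit_form_def contract_apply)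

context horizontal_frame
begin

lemma linear_expand2:
  assumes "\<And>W. linear (\<lambda>Z. L Z W)" "\<And>Z. linear (L Z)" "G Z Xi = 0" "G W Xi = 0"
  shows "(\<Sum>k\<in>{1..q}. \<Sum>l\<in>{1..q}. G Z (f k) * G W (f l) * L (f k) (f l)) = (L Z W :: real)"
proof -
  have "L Z W = (\<Sum>k\<in>{1..q}. G Z (f k) * L (f k) W)"
    by (rule linear_expand[OF assms(1,3)])
  also have "\<dots> = (\<Sum>k\<in>{1..q}. G Z (f k) * (\<Sum>l\<in>{1..q}. G W (f l) * L (f k) (f l)))"
    by (intro sum.cong refl arg_cong2[of _ _ _ _ "(*)"] linear_expand assms)
  finally show ?thesis by (simp add: sum_distrib_left mult.assoc)
qed

lemma antisymmetric_expand:
  assumes lin: "\<And>W. linear (\<lambda>Z. L Z W)" "\<And>Z. linear (L Z)" and Z: "G Z Xi = 0" and W: "G W Xi = 0"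
    and anti: "L W Z = - L Z W"
  shows "(\<Sum>k\<in>{1..q}. \<Sum>l\<in>{1..q}. (G Z (f k) * G W (f l) - G W (f k) * G Z (f l)) * L (f k) (f l)) =
    (2 * L Z W :: real)"
  using linear_expand2[OF lin Z W] linear_expand2[OF lin W Z] anti
  by (simp add: left_diff_distrib sum_subtractf)

text \<open>Two applications of \<open>frame_trace\<close>. The order of summation is the one in which the curvature sum is
evaluated later.\<close>

lemma derivation_frame_invariant:
  assumes e: "orthonormal_frame G Xi {1..q} e" and "alternating_form \<alpha>" "alternating_form \<omega>"
  shows "derivation \<alpha> \<omega> = (\<lambda>vs. \<Sum>j\<in>{1..q}. \<Sum>i\<in>{1..q}. \<alpha> [e i, e j] * wedge G (e i) (\<iota> (e j) \<omega>) vs)"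
proof
  fix vs
  have lin1: "linear (\<lambda>v. \<alpha> [u, v])" for u
    using alternating_linear[OF assms(2), of "[u]" "[]"] by simp
  have lin2: "linear (\<lambda>u. \<alpha> [u, v])" for v
    using alternating_linear_hd[OF assms(2), of "[v]"] by simp
  have lin3: "linear (\<lambda>v. wedge G u (\<iota> v \<omega>) vs)" for u
    unfolding wedge_def interior_prod_def
    by (intro linear_compose_sum[rule_format])
      (use linear_iff[THEN iffD1, OF alternating_linear_hd[OF assms(3)]] in
        \<open>auto simp add: linear_iff algebra_simps\<close>)
  have "derivation \<alpha> \<omega> vs =
      (\<Sum>j\<in>{1..q}. \<Sum>k\<in>{1..q}. \<alpha> [f j, e k] * wedge G (f j) (\<iota> (e k) \<omega>) vs)"
    unfolding derivation_def by (intro sum.cong refl frame_trace[OF e, symmetric] lin1 lin3)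
  also have "\<dots> = (\<Sum>k\<in>{1..q}. \<Sum>j\<in>{1..q}. \<alpha> [f j, e k] * wedge G (f j) (\<iota> (e k) \<omega>) vs)"
    by (rule sum.swap)
  also have "\<dots> = (\<Sum>k\<in>{1..q}. \<Sum>j\<in>{1..q}. \<alpha> [e j, e k] * wedge G (e j) (\<iota> (e k) \<omega>) vs)"
    by (intro sum.cong refl frame_trace[OF e, symmetric] lin2 linear_wedge_arg bilinear)
  finally show "derivation \<alpha> \<omega> vs =
      (\<Sum>j\<in>{1..q}. \<Sum>i\<in>{1..q}. \<alpha> [e i, e j] * wedge G (e i) (\<iota> (e j) \<omega>) vs)" .
qed

lemma ext_power_wedge_contract:
  assumes "1 \<le> p" "\<omega> \<in> ext_power Xi p" "G u Xi = 0"
  shows "wedge G u (\<iota> v \<omega>) \<in> ext_power Xi p"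
  using ext_power_wedge[OF bilinear assms(3) ext_power_contract[OF assms(2)], of v] assms(1) by simp

lemma derivation_ext_power:
  assumes "1 \<le> p" "\<omega> \<in> ext_power Xi p"
  shows "derivation \<alpha> \<omega> \<in> ext_power Xi p"
  unfolding derivation_def
  by (intro ext_power_sum2 ext_power_wedge_contract assms frame_horizontal)

text \<open>The adjoint of \<open>f\<^sub>j \<and> (f\<^sub>k \<lrcorner> _)\<close> is \<open>f\<^sub>k \<and> (f\<^sub>j \<lrcorner> _)\<close>, and \<open>\<alpha>\<close> is alternating.\<close>

lemma derivation_skew:
  assumes "alternating_form \<alpha>" "alternating_form \<omega>" "alternating_form \<phi>"
  shows "\<langle>derivation \<alpha> \<omega>, \<phi>\<rangle> = - \<langle>\<omega>, derivation \<alpha> \<phi>\<rangle>"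
proof -
  have T: "\<langle>wedge G (f j) (\<iota> (f k) \<omega>), \<phi>\<rangle> = \<langle>\<omega>, wedge G (f k) (\<iota> (f j) \<phi>)\<rangle>"
    if "j \<in> {1..q}" "k \<in> {1..q}" for j k
  proof -
    have "\<langle>wedge G (f j) (\<iota> (f k) \<omega>), \<phi>\<rangle> = \<langle>\<iota> (f k) \<omega>, \<iota> (f j) \<phi>\<rangle>"
      by (intro wedge_contract_adjoint alternating_contract assms frame_horizontal that)
    also have "\<dots> = \<langle>\<iota> (f j) \<phi>, \<iota> (f k) \<omega>\<rangle>" by (rule form_inner_sym)
    also have "\<dots> = \<langle>wedge G (f k) (\<iota> (f j) \<phi>), \<omega>\<rangle>"
      by (intro wedge_contract_adjoint[symmetric] alternating_contract assms frame_horizontal that)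
    also have "\<dots> = \<langle>\<omega>, wedge G (f k) (\<iota> (f j) \<phi>)\<rangle>" by (rule form_inner_sym)
    finally show ?thesis .
  qed
  have "\<langle>derivation \<alpha> \<omega>, \<phi>\<rangle> =
      (\<Sum>j\<in>{1..q}. \<Sum>k\<in>{1..q}. \<alpha> [f j, f k] * \<langle>\<omega>, wedge G (f k) (\<iota> (f j) \<phi>)\<rangle>)"
    unfolding derivation_def form_inner_sum2_left
    by (intro sum.cong refl arg_cong2[of _ _ _ _ "(*)"] T)
  also have "\<dots> = (\<Sum>j\<in>{1..q}. \<Sum>k\<in>{1..q}. - (\<alpha> [f k, f j] * \<langle>\<omega>, wedge G (f k) (\<iota> (f j) \<phi>)\<rangle>))"
  proof (intro sum.cong refl)
    fix j k
    show "\<alpha> [f j, f k] * \<langle>\<omega>, wedge G (f k) (\<iota> (f j) \<phi>)\<rangle> = - (\<alpha> [f k, f j] * \<langle>\<omega>, wedge G (f k) (\<iota> (f j) \<phi>)\<rangle>)"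
      by (simp add: alternating_pair_swap[OF assms(1), of "f j" "f k"])
  qed
  also have "\<dots> = - \<langle>\<omega>, derivation \<alpha> \<phi>\<rangle>"
    unfolding derivation_def form_inner_sum2_right
    by (subst sum.swap) (simp add: sum_negf)
  finally show ?thesis .
qed

end

locale flow_fibre = horizontal_frame +
  fixes h :: "'a \<Rightarrow> 'a"
  assumes linear_h: "linear h"
    and skew: "\<And>X Y. G X Xi = 0 \<Longrightarrow> G Y Xi = 0 \<Longrightarrow> G (h X) Y = - G (h Y) X"
begin

definition ext_curvature :: "'a \<Rightarrow> 'a \<Rightarrow> 'a \<Rightarrow> 'a \<Rightarrow> real" where
  "ext_curvature X Y Z W = 2 * G (h X) Y * G (h Z) W - G (h Y) Z * G (h X) W - G (h Z) X * G (h Y) W"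

lemma linear_ext_curvature:
  "linear (\<lambda>X. ext_curvature X Y Z W)" "linear (\<lambda>Y. ext_curvature X Y Z W)"
  "linear (\<lambda>Z. ext_curvature X Y Z W)" "linear (\<lambda>W. ext_curvature X Y Z W)"
  unfolding ext_curvature_def linear_iff
  by (simp_all add: linear_add[OF linear_h] linear_cmul[OF linear_h] bilinear_ladd[OF bilinear]
      bilinear_radd[OF bilinear] bilinear_lmul[OF bilinear] bilinear_rmul[OF bilinear] algebra_simps)

text \<open>These symmetries come from the skewness of \<open>h\<close> and make \<open>ext_curvature\<close> a bilinear form on bivectors,
which is what \<open>is_R_ext\<close> asks for.\<close>

lemma ext_curvature_antisymmetric:
  assumes "G X Xi = 0" "G Y Xi = 0" "G Z Xi = 0" "G W Xi = 0"
  shows "ext_curvature Y X Z W = - ext_curvature X Y Z W"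
    "ext_curvature X Y W Z = - ext_curvature X Y Z W"
  unfolding ext_curvature_def
  using skew[OF assms(1,2)] skew[OF assms(1,3)] skew[OF assms(1,4)] skew[OF assms(2,3)]
    skew[OF assms(2,4)] skew[OF assms(3,4)]
  by simp_all

text \<open>The factor \<open>1/4\<close> in the components compensates for summing over all ordered index pairs, both in
\<open>\<alpha>\<close> and in the result.\<close>

lemma is_R_ext_exists: "\<exists>R. is_R_ext q G Xi h f R"
proof
  define c where "c \<alpha> k l = (\<Sum>i\<in>{1..q}. \<Sum>j\<in>{1..q}. \<alpha> [f i, f j] * ext_curvature (f i) (f j) (f k) (f l)) / 4"
    for \<alpha> :: "'a form" and k l
  let ?R = "\<lambda>\<alpha> vs. \<Sum>k\<in>{1..q}. \<Sum>l\<in>{1..q}. c \<alpha> k l * wedge2 G (f k) (f l) vs"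
  show "is_R_ext q G Xi h f ?R"
    unfolding is_R_ext_def
  proof (intro conjI ballI allI)
    show "?R \<alpha> \<in> ext_power Xi 2" for \<alpha>
      by (intro ext_power_sum2 wedge2_ext_power frame_horizontal)
    fix \<alpha> \<beta> :: "'a form" and s t :: real
    have "c (\<lambda>vs. s * \<alpha> vs + t * \<beta> vs) k l = s * c \<alpha> k l + t * c \<beta> k l" for k l
      unfolding c_def by (simp add: distrib_right sum.distrib sum_distrib_left add_divide_distrib mult.assoc)
    then show "?R (\<lambda>vs. s * \<alpha> vs + t * \<beta> vs) = (\<lambda>vs. s * ?R \<alpha> vs + t * ?R \<beta> vs)"
      by (simp add: distrib_right sum.distrib sum_distrib_left mult.assoc)
  next
    fix X Y Z W
    assume "X \<in> horizontal G Xi" "Y \<in> horizontal G Xi" "Z \<in> horizontal G Xi" "W \<in> horizontal G Xi"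
    then have hor: "G X Xi = 0" "G Y Xi = 0" "G Z Xi = 0" "G W Xi = 0" by (auto simp: horizontal_def)
    have c: "c (wedge2 G X Y) k l = ext_curvature X Y (f k) (f l) / 2"
      if "k \<in> {1..q}" "l \<in> {1..q}" for k l
    proof -
      have "4 * c (wedge2 G X Y) k l = (\<Sum>i\<in>{1..q}. \<Sum>j\<in>{1..q}.
          (G X (f i) * G Y (f j) - G Y (f i) * G X (f j)) * ext_curvature (f i) (f j) (f k) (f l))"
        unfolding c_def wedge2_apply by (simp add: mult.commute[of "G X (f _)" "G Y (f _)"])
      also have "\<dots> = 2 * ext_curvature X Y (f k) (f l)"
        by (rule antisymmetric_expand[OF linear_ext_curvature(1,2) hor(1,2)])
          (rule ext_curvature_antisymmetric[OF hor(1,2) frame_horizontal frame_horizontal, OF that])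
      finally show ?thesis by simp
    qed
    have "\<langle>?R (wedge2 G X Y), wedge2 G Z W\<rangle> =
        (\<Sum>k\<in>{1..q}. \<Sum>l\<in>{1..q}. c (wedge2 G X Y) k l * wedge2 G (f k) (f l) [Z, W])"
      unfolding form_inner_sum2_left
    proof (intro sum.cong refl arg_cong2[of _ _ _ _ "(*)"] form_inner_wedge2 hor)
      fix k l assume "k \<in> {1..q}" "l \<in> {1..q}"
      then show "alternating_form (wedge2 G (f k) (f l))"
        using wedge2_ext_power[OF frame_horizontal frame_horizontal]
        by (auto simp: ext_power_iff horizontal_form_def)
    qed
    also have "\<dots> = (\<Sum>k\<in>{1..q}. \<Sum>l\<in>{1..q}.
        ext_curvature X Y (f k) (f l) / 2 * (G Z (f k) * G W (f l) - G W (f k) * G Z (f l)))"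
      by (intro sum.cong refl) (simp add: c wedge2_apply sym[of "f _" Z] sym[of "f _" W])
    also have "\<dots> = (\<Sum>k\<in>{1..q}. \<Sum>l\<in>{1..q}.
        (G Z (f k) * G W (f l) - G W (f k) * G Z (f l)) * ext_curvature X Y (f k) (f l)) / 2"
      by (simp add: sum_divide_distrib mult.commute)
    also have "\<dots> = ext_curvature X Y Z W"
      by (subst antisymmetric_expand[OF linear_ext_curvature(3,4) hor(3,4)])
        (simp_all add: ext_curvature_antisymmetric[OF hor])
    finally show "\<langle>?R (wedge2 G X Y), wedge2 G Z W\<rangle> =
      2 * G (h X) Y * G (h Z) W - G (h Y) Z * G (h X) W - G (h Z) X * G (h Y) W"
      by (simp add: ext_curvature_def)
  qed
qed

abbreviation R :: "'a form \<Rightarrow> 'a form" where "R \<equiv> R_ext q G Xi h f"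

lemma is_R_ext: "is_R_ext q G Xi h f R"
  unfolding R_ext_def by (rule someI_ex[OF is_R_ext_exists])

lemma R_wedge2:
  "G X Xi = 0 \<Longrightarrow> G Y Xi = 0 \<Longrightarrow> G Z Xi = 0 \<Longrightarrow> G W Xi = 0 \<Longrightarrow>
    \<langle>R (wedge2 G X Y), wedge2 G Z W\<rangle> = ext_curvature X Y Z W"
  using is_R_ext unfolding is_R_ext_def ext_curvature_def horizontal_def by blast

lemma R_comb:
  "\<alpha> \<in> ext_power Xi 2 \<Longrightarrow> \<beta> \<in> ext_power Xi 2 \<Longrightarrow>
    R (\<lambda>vs. s * \<alpha> vs + t * \<beta> vs) = (\<lambda>vs. s * R \<alpha> vs + t * R \<beta> vs)"
  using is_R_ext unfolding is_R_ext_def by blast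

lemma R_sum:
  assumes "finite A" "\<And>i. i \<in> A \<Longrightarrow> \<omega> i \<in> ext_power Xi 2"
  shows "R (\<lambda>vs. \<Sum>i\<in>A. c i * \<omega> i vs) = (\<lambda>vs. \<Sum>i\<in>A. c i * R (\<omega> i) vs)"
  using assms
proof (induction A)
  case empty
  have "(\<lambda>_. 0) \<in> ext_power Xi 2"
    using ext_power_sum[where A = "{} :: nat set" and \<omega> = "\<lambda>_ _. 0" and Xi = Xi and p = 2] by simp
  from R_comb[OF this this, of 0 0] show ?case by simp
next
  case (insert a A)
  have "(\<lambda>vs. \<Sum>i\<in>A. c i * \<omega> i vs) \<in> ext_power Xi 2"
    by (rule ext_power_sum) (use insert in auto)
  from R_comb[OF _ this, of "\<omega> a" "c a" 1] insert show ?case by simp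
qed

text \<open>Since derivations by 2-forms are skew, the form \<open>- \<Sum> \<langle>R \<psi>\<^sub>r, \<psi>\<^sub>s\<rangle> D\<^sub>s (D\<^sub>r \<omega>)\<close>, with \<open>D\<^sub>r\<close> the derivation by
\<open>\<psi>\<^sub>r\<close>, represents the functional that defines \<open>B_ext\<close>; it is the only one because the inner product is
definite. The factors \<open>-2\<close> of the two commutators cancel the \<open>1/4\<close>.\<close>

lemma B_ext_inner:
  assumes frame2: "orthonormal_2frame q Xi f \<psi>" and dual2: "dual_2frame q Xi f \<psi> \<psi>'"
    and p: "1 \<le> p" and \<omega>: "\<omega> \<in> ext_power Xi p"
  shows "\<langle>B_ext q G Xi h f \<psi> \<psi>' p \<omega>, \<omega>\<rangle> = (\<Sum>r=1..q choose 2. \<Sum>s=1..q choose 2.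
    \<langle>R (\<psi> r), \<psi> s\<rangle> * \<langle>derivation (\<psi> r) \<omega>, derivation (\<psi> s) \<omega>\<rangle>)"
proof -
  let ?A = "{1..q choose 2}"
  have \<psi>: "\<psi> r \<in> ext_power Xi 2" if "r \<in> ?A" for r
    using frame2 that by (auto simp: orthonormal_2frame_def)
  have dual: "\<psi>' r = \<psi> r" if r: "r \<in> ?A" for r
  proof -
    have "\<psi>' r \<in> ext_power Xi 2" using dual2 r by (auto simp: dual_2frame_def)
    then have "\<psi>' r = (\<lambda>vs. \<Sum>s\<in>?A. \<langle>\<psi>' r, \<psi> s\<rangle> * \<psi> s vs)"
      using frame2 unfolding orthonormal_2frame_def by blast
    also have "\<dots> = (\<lambda>vs. \<Sum>s\<in>?A. if r = s then \<psi> s vs else 0)"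
      using dual2 r by (intro ext sum.cong refl) (auto simp: dual_2frame_def)
    also have "\<dots> = \<psi> r" using r by (auto simp: fun_eq_iff)
    finally show ?thesis .
  qed
  have alt: "alternating_form \<alpha>" if "\<alpha> \<in> ext_power Xi k" for \<alpha> :: "'a form" and k
    using that by (simp add: ext_power_iff horizontal_form_def)
  define rhs where "rhs \<phi> = (\<Sum>r\<in>?A. \<Sum>s\<in>?A.
      \<langle>R (\<psi> r), \<psi> s\<rangle> * \<langle>derivation (\<psi> r) \<omega>, derivation (\<psi> s) \<phi>\<rangle>)" for \<phi>
  have rhs: "(\<Sum>r\<in>?A. \<Sum>s\<in>?A. \<langle>R (\<psi> r), \<psi> s\<rangle> *
      \<langle>clifford_comm q G f (\<psi>' r) \<omega>, clifford_comm q G f (\<psi>' s) \<phi>\<rangle>) / 4 = rhs \<phi>"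
    if "\<phi> \<in> ext_power Xi p" for \<phi>
    unfolding rhs_def sum_divide_distrib
  proof (intro sum.cong refl)
    fix r s assume rs: "r \<in> ?A" "s \<in> ?A"
    have "clifford_comm q G f (\<psi>' r) \<omega> = (\<lambda>vs. -2 * derivation (\<psi> r) \<omega> vs)"
      "clifford_comm q G f (\<psi>' s) \<phi> = (\<lambda>vs. -2 * derivation (\<psi> s) \<phi> vs)"
      unfolding dual[OF rs(1)] dual[OF rs(2)]
      by (rule clifford_comm_derivation[OF \<psi>[OF rs(1)]], use \<omega> in \<open>simp add: ext_power_iff\<close>)
        (rule clifford_comm_derivation[OF \<psi>[OF rs(2)]], use that in \<open>simp add: ext_power_iff\<close>)
    then have "\<langle>clifford_comm q G f (\<psi>' r) \<omega>, clifford_comm q G f (\<psi>' s) \<phi>\<rangle> =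
        4 * \<langle>derivation (\<psi> r) \<omega>, derivation (\<psi> s) \<phi>\<rangle>"
      by (simp only: form_inner_scale_left form_inner_scale_right)
    then show "\<langle>R (\<psi> r), \<psi> s\<rangle> *
        \<langle>clifford_comm q G f (\<psi>' r) \<omega>, clifford_comm q G f (\<psi>' s) \<phi>\<rangle> / 4 =
      \<langle>R (\<psi> r), \<psi> s\<rangle> * \<langle>derivation (\<psi> r) \<omega>, derivation (\<psi> s) \<phi>\<rangle>" by simp
  qed
  \<comment> \<open>The representing form, obtained by moving the second derivation to the other side.\<close>
  define \<theta> where "\<theta> = (\<lambda>vs. \<Sum>r\<in>?A. \<Sum>s\<in>?A. - \<langle>R (\<psi> r), \<psi> s\<rangle> *
      derivation (\<psi> s) (derivation (\<psi> r) \<omega>) vs)"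
  have \<theta>_ext: "\<theta> \<in> ext_power Xi p"
    unfolding \<theta>_def by (intro ext_power_sum2 derivation_ext_power p \<omega>)
  have \<theta>_inner: "\<langle>\<theta>, \<phi>\<rangle> = rhs \<phi>" if "\<phi> \<in> ext_power Xi p" for \<phi>
    unfolding \<theta>_def form_inner_sum2_left rhs_def
  proof (intro sum.cong refl)
    fix r s assume "r \<in> ?A" "s \<in> ?A"
    then show "- \<langle>R (\<psi> r), \<psi> s\<rangle> * \<langle>derivation (\<psi> s) (derivation (\<psi> r) \<omega>), \<phi>\<rangle> =
      \<langle>R (\<psi> r), \<psi> s\<rangle> * \<langle>derivation (\<psi> r) \<omega>, derivation (\<psi> s) \<phi>\<rangle>"
      by (simp add: derivation_skew[OF alt[OF \<psi>] alt[OF derivation_ext_power[OF p \<omega>]] alt[OF that]])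
  qed
  have "B_ext q G Xi h f \<psi> \<psi>' p \<omega> = \<theta>"
    unfolding B_ext_def
  proof (rule the_equality)
    show "\<theta> \<in> ext_power Xi p \<and> (\<forall>\<phi>\<in>ext_power Xi p. \<langle>\<theta>, \<phi>\<rangle> =
        (\<Sum>r\<in>?A. \<Sum>s\<in>?A. \<langle>R (\<psi> r), \<psi> s\<rangle> *
          \<langle>clifford_comm q G f (\<psi>' r) \<omega>, clifford_comm q G f (\<psi>' s) \<phi>\<rangle>) / 4)"
    proof (intro conjI ballI \<theta>_ext)
      fix \<phi> assume "\<phi> \<in> ext_power Xi p"
      then show "\<langle>\<theta>, \<phi>\<rangle> = (\<Sum>r\<in>?A. \<Sum>s\<in>?A. \<langle>R (\<psi> r), \<psi> s\<rangle> *
          \<langle>clifford_comm q G f (\<psi>' r) \<omega>, clifford_comm q G f (\<psi>' s) \<phi>\<rangle>) / 4"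
        by (simp only: \<theta>_inner rhs)
    qed
  next
    fix \<eta> assume \<eta>: "\<eta> \<in> ext_power Xi p \<and> (\<forall>\<phi>\<in>ext_power Xi p. \<langle>\<eta>, \<phi>\<rangle> =
        (\<Sum>r\<in>?A. \<Sum>s\<in>?A. \<langle>R (\<psi> r), \<psi> s\<rangle> *
          \<langle>clifford_comm q G f (\<psi>' r) \<omega>, clifford_comm q G f (\<psi>' s) \<phi>\<rangle>) / 4)"
    let ?d = "\<lambda>vs. 1 * \<eta> vs + (-1) * \<theta> vs"
    have d: "?d \<in> ext_power Xi p" by (rule ext_power_comb) (use \<eta> \<theta>_ext in auto)
    have \<eta>_inner: "\<langle>\<eta>, ?d\<rangle> = rhs ?d"
      unfolding rhs[OF d, symmetric] using \<eta> d by blast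
    have "\<langle>?d, ?d\<rangle> = 1 * \<langle>\<eta>, ?d\<rangle> + (-1) * \<langle>\<theta>, ?d\<rangle>" by (rule form_inner_comb_left)
    also have "\<dots> = 0" unfolding \<eta>_inner \<theta>_inner[OF d] by simp
    finally have "?d = (\<lambda>_. 0)"
      using d by (intro form_inner_definite) (simp_all add: ext_power_iff)
    then show "\<eta> = \<theta>" by (simp add: fun_eq_iff)
  qed
  then show ?thesis using \<theta>_inner[OF \<omega>] by (simp add: rhs_def)
qed

text \<open>The component \<open>\<psi>\<^sub>r(e\<^sub>i, e\<^sub>j)\<close> is the inner product of \<open>\<psi>\<^sub>r\<close> with \<open>e\<^sub>i \<and> e\<^sub>j\<close>. Summing over the basis \<open>\<psi>\<close>
therefore reassembles \<open>e\<^sub>i \<and> e\<^sub>j\<close> and \<open>e\<^sub>k \<and> e\<^sub>l\<close> inside the curvature operator.\<close>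

lemma B_ext_curvature_sum:
  assumes frame2: "orthonormal_2frame q Xi f \<psi>" and dual2: "dual_2frame q Xi f \<psi> \<psi>'"
    and p: "1 \<le> p" and \<omega>: "\<omega> \<in> ext_power Xi p" and e: "orthonormal_frame G Xi {1..q} e"
  shows "\<langle>B_ext q G Xi h f \<psi> \<psi>' p \<omega>, \<omega>\<rangle> =
    (\<Sum>j\<in>{1..q}. \<Sum>i\<in>{1..q}. \<Sum>l\<in>{1..q}. \<Sum>k\<in>{1..q}. ext_curvature (e i) (e j) (e k) (e l) *
      \<langle>wedge G (e i) (\<iota> (e j) \<omega>), wedge G (e k) (\<iota> (e l) \<omega>)\<rangle>)"
proof -
  interpret e: horizontal_frame G Xi q e
    by unfold_locales (use bilinear sym unit e in auto)
  let ?A = "{1..q choose 2}" and ?N = "{1..q}"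
  have \<psi>: "\<psi> r \<in> ext_power Xi 2" if "r \<in> ?A" for r
    using frame2 that by (auto simp: orthonormal_2frame_def)
  then have alt\<psi>: "alternating_form (\<psi> r)" if "r \<in> ?A" for r
    using that by (simp add: ext_power_iff horizontal_form_def)
  have alt: "alternating_form \<omega>" using \<omega> by (simp add: ext_power_iff horizontal_form_def)
  have expand: "\<alpha> = (\<lambda>vs. \<Sum>r\<in>?A. \<langle>\<alpha>, \<psi> r\<rangle> * \<psi> r vs)" if "\<alpha> \<in> ext_power Xi 2" for \<alpha>
    using frame2 that unfolding orthonormal_2frame_def by blast
  have coeff: "(\<Sum>r\<in>?A. \<Sum>s\<in>?A. \<langle>R (\<psi> r), \<psi> s\<rangle> * \<psi> r [e i, e j] * \<psi> s [e k, e l]) =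
      ext_curvature (e i) (e j) (e k) (e l)"
    if "i \<in> ?N" "j \<in> ?N" "k \<in> ?N" "l \<in> ?N" for i j k l
  proof -
    let ?a = "wedge2 G (e i) (e j)" and ?b = "wedge2 G (e k) (e l)"
    note hor = e.frame_horizontal[OF that(1)] e.frame_horizontal[OF that(2)]
      e.frame_horizontal[OF that(3)] e.frame_horizontal[OF that(4)]
    have a: "?a \<in> ext_power Xi 2" and b: "?b \<in> ext_power Xi 2"
      by (rule wedge2_ext_power[OF hor(1,2)], rule wedge2_ext_power[OF hor(3,4)])
    have "ext_curvature (e i) (e j) (e k) (e l) = \<langle>R ?a, ?b\<rangle>"
      by (rule R_wedge2[OF hor, symmetric])
    also have "\<dots> = \<langle>R ?a, \<lambda>vs. \<Sum>s\<in>?A. \<langle>?b, \<psi> s\<rangle> * \<psi> s vs\<rangle>"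
      by (rule arg_cong[OF expand[OF b]])
    also have "R ?a = R (\<lambda>vs. \<Sum>r\<in>?A. \<langle>?a, \<psi> r\<rangle> * \<psi> r vs)"
      by (rule arg_cong[OF expand[OF a]])
    also have "\<dots> = (\<lambda>vs. \<Sum>r\<in>?A. \<langle>?a, \<psi> r\<rangle> * R (\<psi> r) vs)"
      by (rule R_sum) (simp_all add: \<psi>)
    also have "\<langle>\<dots>, \<lambda>vs. \<Sum>s\<in>?A. \<langle>?b, \<psi> s\<rangle> * \<psi> s vs\<rangle> =
        (\<Sum>r\<in>?A. \<Sum>s\<in>?A. \<langle>?a, \<psi> r\<rangle> * (\<langle>?b, \<psi> s\<rangle> * \<langle>R (\<psi> r), \<psi> s\<rangle>))"
      unfolding form_inner_sum_left form_inner_sum_right by (simp add: sum_distrib_left)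
    also have "\<dots> = (\<Sum>r\<in>?A. \<Sum>s\<in>?A. \<langle>R (\<psi> r), \<psi> s\<rangle> * \<psi> r [e i, e j] * \<psi> s [e k, e l])"
    proof (intro sum.cong refl)
      fix r s assume rs: "r \<in> ?A" "s \<in> ?A"
      have "\<langle>?a, \<psi> r\<rangle> = \<psi> r [e i, e j]" "\<langle>?b, \<psi> s\<rangle> = \<psi> s [e k, e l]"
        unfolding form_inner_sym[of q f "wedge2 _ _ _"]
        by (rule form_inner_wedge2[OF hor(1,2) alt\<psi>[OF rs(1)]], rule form_inner_wedge2[OF hor(3,4) alt\<psi>[OF rs(2)]])
      then show "\<langle>?a, \<psi> r\<rangle> * (\<langle>?b, \<psi> s\<rangle> * \<langle>R (\<psi> r), \<psi> s\<rangle>) =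
        \<langle>R (\<psi> r), \<psi> s\<rangle> * \<psi> r [e i, e j] * \<psi> s [e k, e l]" by (simp only: mult_ac)
    qed
    finally show ?thesis ..
  qed
  have "\<langle>B_ext q G Xi h f \<psi> \<psi>' p \<omega>, \<omega>\<rangle> = (\<Sum>r\<in>?A. \<Sum>s\<in>?A.
      \<langle>R (\<psi> r), \<psi> s\<rangle> * (\<Sum>j\<in>?N. \<Sum>i\<in>?N. \<Sum>l\<in>?N. \<Sum>k\<in>?N. \<psi> r [e i, e j] * \<psi> s [e k, e l] *
        \<langle>wedge G (e i) (\<iota> (e j) \<omega>), wedge G (e k) (\<iota> (e l) \<omega>)\<rangle>))"
    unfolding B_ext_inner[OF frame2 dual2 p \<omega>]
  proof (intro sum.cong refl arg_cong2[of _ _ _ _ "(*)"])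
    fix r s assume "r \<in> ?A" "s \<in> ?A"
    then show "\<langle>derivation (\<psi> r) \<omega>, derivation (\<psi> s) \<omega>\<rangle> =
      (\<Sum>j\<in>?N. \<Sum>i\<in>?N. \<Sum>l\<in>?N. \<Sum>k\<in>?N. \<psi> r [e i, e j] * \<psi> s [e k, e l] *
        \<langle>wedge G (e i) (\<iota> (e j) \<omega>), wedge G (e k) (\<iota> (e l) \<omega>)\<rangle>)"
      unfolding derivation_frame_invariant[OF e alt\<psi>[OF \<open>r \<in> ?A\<close>] alt]
        derivation_frame_invariant[OF e alt\<psi>[OF \<open>s \<in> ?A\<close>] alt]
        form_inner_sum2_left form_inner_sum2_right
      by (simp add: sum_distrib_left mult.assoc)
  qed
  also have "\<dots> = (\<Sum>j\<in>?N. \<Sum>i\<in>?N. \<Sum>l\<in>?N. \<Sum>k\<in>?N.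
      (\<Sum>r\<in>?A. \<Sum>s\<in>?A. \<langle>R (\<psi> r), \<psi> s\<rangle> * \<psi> r [e i, e j] * \<psi> s [e k, e l]) *
      \<langle>wedge G (e i) (\<iota> (e j) \<omega>), wedge G (e k) (\<iota> (e l) \<omega>)\<rangle>)"
    by (rule sum_quadruple_swap)
  also have "\<dots> = (\<Sum>j\<in>?N. \<Sum>i\<in>?N. \<Sum>l\<in>?N. \<Sum>k\<in>?N. ext_curvature (e i) (e j) (e k) (e l) *
      \<langle>wedge G (e i) (\<iota> (e j) \<omega>), wedge G (e k) (\<iota> (e l) \<omega>)\<rangle>)"
    by (intro sum.cong refl arg_cong2[of _ _ _ _ "(*)"] coeff)
  finally show ?thesis .
qed

text \<open>In the adapted frame each row of \<open>h\<close> has at most one nonzero entry, so the two sums in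
\<open>curvature_form_lower_bound\<close> are those in \<open>contract_pairs_norm_le\<close>. The vector \<open>e\<^sub>q\<close> without a partner,
if there is one, contributes nothing since \<open>h\<close> kills it.\<close>

lemma B_ext_exchange_bound:
  assumes frame2: "orthonormal_2frame q Xi f \<psi>" and dual2: "dual_2frame q Xi f \<psi> \<psi>'"
    and p: "1 \<le> p" and \<omega>: "\<omega> \<in> ext_power Xi p" and e: "orthonormal_frame G Xi {1..q} e"
    and h_odd: "\<And>i. i \<in> {1..q div 2} \<Longrightarrow> h (e (2 * i - 1)) = b i *\<^sub>R e (2 * i)"
    and h_even: "\<And>i. i \<in> {1..q div 2} \<Longrightarrow> h (e (2 * i)) = - b i *\<^sub>R e (2 * i - 1)"
    and h_last: "odd q \<Longrightarrow> h (e q) = 0"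
  shows "\<langle>B_ext q G Xi h f \<psi> \<psi>' p \<omega>, \<omega>\<rangle> \<ge>
    - 4 * (\<Sum>I\<in>Pow {1..q}. exchange_weight b (q div 2) I * (\<omega> (frame_list e I))\<^sup>2)"
proof -
  interpret e: horizontal_frame G Xi q e
    by unfold_locales (use bilinear sym unit e in auto)
  let ?N = "{1..q}" and ?m = "{1..q div 2}"
  let ?H = "\<lambda>i j. G (h (e i)) (e j)"
  let ?n = "\<lambda>v. form_inner q e (\<iota> v \<omega>) (\<iota> v \<omega>)"
  have hf: "horizontal_form Xi \<omega>" using \<omega> by (simp add: ext_power_iff)
  then have alt: "alternating_form \<omega>" by (simp add: horizontal_form_def)
  have scale: "\<omega> ((c *\<^sub>R v) # vs) = c * \<omega> (v # vs)" for c v vs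
    using linear_cmul[OF alternating_linear_hd[OF alt]] by simp
  have zero: "\<omega> (0 # vs) = 0" for vs
    using linear_0[OF alternating_linear_hd[OF alt]] by simp
  have n_scale: "?n (c *\<^sub>R v) = c\<^sup>2 * ?n v" for c v
    unfolding form_inner_def contract_apply scale
    by (simp add: sum_distrib_left power2_eq_square mult_ac)
  have row: "(\<lambda>vs. \<Sum>j\<in>?N. ?H s j * \<iota> (e j) \<omega> vs) = \<iota> (h (e s)) \<omega>" for s
    by (rule ext) (simp add: contract_apply e.horizontal_form_expand[OF hf, of "h (e s)"])
  have norms: "(\<Sum>s\<in>?N. ?n (h (e s))) = (\<Sum>i\<in>?m. (b i)\<^sup>2 * (?n (e (2 * i - 1)) + ?n (e (2 * i))))"
  proof -
    have "(\<Sum>s\<in>?N. ?n (h (e s))) = (\<Sum>i\<in>?m. ?n (h (e (2 * i - 1))) + ?n (h (e (2 * i))))"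
      by (rule sum_split_pairs) (simp add: h_last form_inner_def contract_apply zero)
    also have "\<dots> = (\<Sum>i\<in>?m. (b i)\<^sup>2 * (?n (e (2 * i - 1)) + ?n (e (2 * i))))"
      by (rule sum.cong[OF refl]) (simp only: h_odd h_even n_scale, simp add: algebra_simps)
    finally show ?thesis .
  qed
  have pairs: "(\<lambda>vs. \<Sum>i\<in>?N. \<Sum>j\<in>?N. ?H i j * \<iota> (e i) (\<iota> (e j) \<omega>) vs) =
      (\<lambda>vs. 2 * (\<Sum>i\<in>?m. b i * e.contract_pair i \<omega> vs))"
  proof
    fix vs
    have "(\<Sum>i\<in>?N. \<Sum>j\<in>?N. ?H i j * \<iota> (e i) (\<iota> (e j) \<omega>) vs) = (\<Sum>i\<in>?N. \<omega> (h (e i) # e i # vs))"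
      by (intro sum.cong refl) (simp add: contract_apply e.horizontal_form_expand[OF hf, of "h (e _)"])
    also have "\<dots> = (\<Sum>i\<in>?m. \<omega> (h (e (2 * i - 1)) # e (2 * i - 1) # vs) + \<omega> (h (e (2 * i)) # e (2 * i) # vs))"
      by (rule sum_split_pairs) (simp add: h_last zero)
    also have "\<dots> = (\<Sum>i\<in>?m. 2 * (b i * e.contract_pair i \<omega> vs))"
    proof (rule sum.cong[OF refl])
      fix i assume i: "i \<in> ?m"
      show "\<omega> (h (e (2 * i - 1)) # e (2 * i - 1) # vs) + \<omega> (h (e (2 * i)) # e (2 * i) # vs) =
        2 * (b i * e.contract_pair i \<omega> vs)"
        using alternating_swap[OF alt, of "[]" "e (2 * i - 1)" "e (2 * i)" vs]
        unfolding h_odd[OF i] h_even[OF i] scale by (simp add: e.contract_pair_def contract_apply)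
    qed
    finally show "(\<Sum>i\<in>?N. \<Sum>j\<in>?N. ?H i j * \<iota> (e i) (\<iota> (e j) \<omega>) vs) =
        2 * (\<Sum>i\<in>?m. b i * e.contract_pair i \<omega> vs)" by (simp add: sum_distrib_left)
  qed
  have "\<langle>B_ext q G Xi h f \<psi> \<psi>' p \<omega>, \<omega>\<rangle> =
    (\<Sum>j\<in>?N. \<Sum>i\<in>?N. \<Sum>l\<in>?N. \<Sum>k\<in>?N. (2 * ?H i j * ?H k l - ?H j k * ?H i l - ?H k i * ?H j l) *
      form_inner q e (wedge G (e i) (\<iota> (e j) \<omega>)) (wedge G (e k) (\<iota> (e l) \<omega>)))"
    unfolding B_ext_curvature_sum[OF frame2 dual2 p \<omega> e] ext_curvature_def
    by (intro sum.cong refl arg_cong2[of _ _ _ _ "(*)"] form_inner_frame_invariant[OF e, where p = p, symmetric]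
        ext_power_wedge_contract[OF p \<omega>] e.frame_horizontal)
  also have "\<dots> \<ge> 2 * (\<Sum>s\<in>?N. ?n (h (e s))) -
      form_inner q e (\<lambda>vs. 2 * (\<Sum>i\<in>?m. b i * e.contract_pair i \<omega> vs))
        (\<lambda>vs. 2 * (\<Sum>i\<in>?m. b i * e.contract_pair i \<omega> vs))"
    by (rule e.curvature_form_lower_bound[OF hf, of ?H, unfolded row pairs])
      (intro skew e.frame_horizontal)
  finally show ?thesis
    using e.contract_pairs_norm_le[OF alt, of b]
    unfolding norms form_inner_scale_left form_inner_scale_right by simp
qed

end

section \<open>Counting full and empty pairs\<close>

lemma card_pairs_le:
  fixes P S :: "nat set"
  assumes "finite S" "\<And>i. i \<in> P \<Longrightarrow> 1 \<le> i \<and> 2 * i - 1 \<in> S \<and> 2 * i \<in> S"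
  shows "2 * card P \<le> card S"
proof -
  have "card (P \<times> {0, 1 :: nat}) \<le> card S"
  proof (rule card_inj_on_le)
    show "inj_on (\<lambda>(i, t). 2 * i - t) (P \<times> {0, 1})"
    proof (rule inj_onI, clarify)
      fix i t j u assume a: "i \<in> P" "j \<in> P" "t \<in> {0, 1 :: nat}" "u \<in> {0, 1 :: nat}"
        and eq: "2 * i - t = 2 * j - u"
      have "1 \<le> i" "1 \<le> j" using assms(2) a by auto
      moreover have "t = 0 \<or> t = 1" "u = 0 \<or> u = 1" using a by auto
      ultimately show "i = j \<and> t = u" using eq by presburger
    qed
  qed (use assms in auto)
  then show ?thesis by (simp add: card_cartesian_product)
qed

lemma exchange_weight_alt:
  "exchange_weight b m I =
    (\<Sum>i\<in>{i\<in>{1..m}. full_pair I i}. \<Sum>j\<in>{j\<in>{1..m}. empty_pair I j}. \<bar>b i * b j\<bar>)"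
  unfolding exchange_weight_def
  by (subst sum.inter_filter, simp, intro sum.cong refl, subst sum.inter_filter) auto

lemma exchange_weight_bounds:
  fixes b :: "nat \<Rightarrow> real"
  assumes I: "I \<subseteq> {1..q}" and b: "\<And>i. i \<in> {1..q div 2} \<Longrightarrow> \<bar>b i\<bar> \<le> \<bar>b (q div 2)\<bar>"
  defines "k \<equiv> card {i\<in>{1..q div 2}. full_pair I i}" and "l \<equiv> card {j\<in>{1..q div 2}. empty_pair I j}"
  shows "exchange_weight b (q div 2) I \<le> real k * real l * (b (q div 2))\<^sup>2"
    "2 * k \<le> card I" "2 * l \<le> q - card I"
proof -
  have fin: "finite I" using I by (rule finite_subset) simp
  show "2 * k \<le> card I"
    unfolding k_def by (rule card_pairs_le[OF fin]) (auto simp: full_pair_def)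
  have "2 * l \<le> card ({1..q} - I)"
    unfolding l_def by (rule card_pairs_le) (auto simp: empty_pair_def)
  then show "2 * l \<le> q - card I" using I fin by (simp add: card_Diff_subset)
  have "\<bar>b i * b j\<bar> \<le> (b (q div 2))\<^sup>2" if "i \<in> {1..q div 2}" "j \<in> {1..q div 2}" for i j
    using mult_mono[OF b[OF that(1)] b[OF that(2)]] by (simp add: abs_mult power2_eq_square)
  then have "exchange_weight b (q div 2) I \<le>
    (\<Sum>i\<in>{i\<in>{1..q div 2}. full_pair I i}. \<Sum>j\<in>{j\<in>{1..q div 2}. empty_pair I j}. (b (q div 2))\<^sup>2)"
    unfolding exchange_weight_alt by (intro sum_mono) auto
  then show "exchange_weight b (q div 2) I \<le> real k * real l * (b (q div 2))\<^sup>2"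
    by (simp add: k_def l_def mult.assoc)
qed

lemma exchange_weight_le:
  fixes b :: "nat \<Rightarrow> real"
  assumes I: "I \<subseteq> {1..q}" and b: "\<And>i. i \<in> {1..q div 2} \<Longrightarrow> \<bar>b i\<bar> \<le> \<bar>b (q div 2)\<bar>"
  shows "4 * exchange_weight b (q div 2) I \<le> real (card I) * (real q - real (card I)) * (b (q div 2))\<^sup>2"
proof -
  let ?k = "card {i\<in>{1..q div 2}. full_pair I i}" and ?l = "card {j\<in>{1..q div 2}. empty_pair I j}"
  note w = exchange_weight_bounds[of I q b, OF I b]
  have c: "card I \<le> q" using card_mono[OF _ I] by simp
  have k: "2 * real ?k \<le> real (card I)" using w(2) by linarith
  have l: "2 * real ?l \<le> real q - real (card I)" using w(3) c by linarith
  have "4 * exchange_weight b (q div 2) I \<le> (2 * real ?k) * (2 * real ?l) * (b (q div 2))\<^sup>2"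
    using w(1) by simp
  also have "\<dots> \<le> real (card I) * (real q - real (card I)) * (b (q div 2))\<^sup>2"
    using k l by (intro mult_right_mono mult_mono) auto
  finally show ?thesis .
qed

text \<open>With \<open>k\<close> full and \<open>l\<close> empty pairs, equality forces \<open>2 k = card I\<close> and \<open>2 l = q - card I\<close>. So \<open>k\<close> and \<open>l\<close> are
positive with \<open>k + l = q / 2\<close>, every pair is full or empty, and each product of a full with an empty
pair attains its maximum.\<close>

lemma exchange_weight_eq:
  fixes b :: "nat \<Rightarrow> real"
  assumes I: "I \<subseteq> {1..q}" and b: "\<And>i. i \<in> {1..q div 2} \<Longrightarrow> \<bar>b i\<bar> \<le> \<bar>b (q div 2)\<bar>"
    and nz: "b (q div 2) \<noteq> 0" and p: "1 \<le> card I" "card I < q"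
    and eq: "4 * exchange_weight b (q div 2) I = real (card I) * (real q - real (card I)) * (b (q div 2))\<^sup>2"
  shows "q div 2 \<ge> 2" "\<forall>i\<in>{1..q div 2}. \<bar>b i\<bar> = \<bar>b (q div 2)\<bar>"
proof -
  let ?m = "q div 2"
  let ?F = "{i\<in>{1..?m}. full_pair I i}" and ?E = "{j\<in>{1..?m}. empty_pair I j}"
  let ?k = "card ?F" and ?l = "card ?E"
  note w = exchange_weight_bounds[of I q b, OF I b]
  have k: "2 * real ?k \<le> real (card I)" using w(2) by linarith
  have l: "2 * real ?l \<le> real q - real (card I)" using w(3) p by linarith
  have "real (card I) * (real q - real (card I)) * (b ?m)\<^sup>2 \<le> (2 * real ?k) * (2 * real ?l) * (b ?m)\<^sup>2"
    using w(1) eq by simp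
  then have ge: "real (card I) * (real q - real (card I)) \<le> (2 * real ?k) * (2 * real ?l)"
    using nz by simp
  have kp: "2 * real ?k = real (card I)"
  proof (rule ccontr)
    assume "2 * real ?k \<noteq> real (card I)"
    then have "2 * real ?k < real (card I)" using k by simp
    then have "(2 * real ?k) * (real q - real (card I)) < real (card I) * (real q - real (card I))"
      using p by (intro mult_strict_right_mono) auto
    moreover have "(2 * real ?k) * (2 * real ?l) \<le> (2 * real ?k) * (real q - real (card I))"
      using l by (intro mult_left_mono) auto
    ultimately show False using ge by linarith
  qed
  have "real (card I) * (real q - real (card I)) \<le> real (card I) * (2 * real ?l)"
    using ge unfolding kp .
  then have lp: "2 * real ?l = real q - real (card I)"
    using l p by simp
  have kl: "?k \<ge> 1" "?l \<ge> 1" "?k + ?l = ?m"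
    using kp lp p by linarith+
  then show "?m \<ge> 2" by simp
  have "card (?F \<union> ?E) = ?m"
    using kl(3) by (subst card_Un_disjoint) (auto simp: full_pair_def empty_pair_def)
  then have cover: "?F \<union> ?E = {1..?m}"
    by (intro card_subset_eq) auto
  have weq: "exchange_weight b ?m I = real ?k * real ?l * (b ?m)\<^sup>2"
  proof -
    have "4 * exchange_weight b ?m I = (2 * real ?k) * (2 * real ?l) * (b ?m)\<^sup>2"
      using eq by (simp only: kp lp)
    then show ?thesis by simp
  qed
  have le: "\<bar>b i * b j\<bar> \<le> (b ?m)\<^sup>2" if "i \<in> {1..?m}" "j \<in> {1..?m}" for i j
    using mult_mono[OF b[OF that(1)] b[OF that(2)]] by (simp add: abs_mult power2_eq_square)
  have "(\<Sum>i\<in>?F. \<Sum>j\<in>?E. (b ?m)\<^sup>2 - \<bar>b i * b j\<bar>) = 0"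
    using weq by (simp add: exchange_weight_alt sum_subtractf)
  then have "\<forall>i\<in>?F. (\<Sum>j\<in>?E. (b ?m)\<^sup>2 - \<bar>b i * b j\<bar>) = 0"
    by (subst (asm) sum_nonneg_eq_0_iff) (auto intro!: sum_nonneg le)
  then have prod: "\<bar>b i\<bar> * \<bar>b j\<bar> = \<bar>b ?m\<bar> * \<bar>b ?m\<bar>" if "i \<in> ?F" "j \<in> ?E" for i j
  proof -
    have "(\<Sum>j\<in>?E. (b ?m)\<^sup>2 - \<bar>b i * b j\<bar>) = 0"
      using \<open>\<forall>i\<in>?F. (\<Sum>j\<in>?E. (b ?m)\<^sup>2 - \<bar>b i * b j\<bar>) = 0\<close> that(1) by blast
    then have "\<forall>j\<in>?E. (b ?m)\<^sup>2 - \<bar>b i * b j\<bar> = 0"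
      using that(1) by (subst (asm) sum_nonneg_eq_0_iff) (auto intro!: le)
    then have "(b ?m)\<^sup>2 = \<bar>b i * b j\<bar>" using that(2) by auto
    then show ?thesis by (simp add: abs_mult power2_eq_square abs_mult_self_eq)
  qed
  have max: "\<bar>b i\<bar> = \<bar>b ?m\<bar> \<and> \<bar>b j\<bar> = \<bar>b ?m\<bar>" if ij: "i \<in> ?F" "j \<in> ?E" for i j
  proof -
    have le_m: "\<bar>b i\<bar> \<le> \<bar>b ?m\<bar>" "\<bar>b j\<bar> \<le> \<bar>b ?m\<bar>" and pos: "0 < \<bar>b ?m\<bar>" using b ij nz by auto
    have "\<not> \<bar>b i\<bar> < \<bar>b ?m\<bar>"
    proof
      assume less: "\<bar>b i\<bar> < \<bar>b ?m\<bar>"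
      have "\<bar>b i\<bar> * \<bar>b j\<bar> \<le> \<bar>b i\<bar> * \<bar>b ?m\<bar>" by (rule mult_left_mono[OF le_m(2)]) simp
      also have "\<dots> < \<bar>b ?m\<bar> * \<bar>b ?m\<bar>" by (rule mult_strict_right_mono[OF less pos])
      finally show False using prod[OF ij] by simp
    qed
    with le_m(1) have i: "\<bar>b i\<bar> = \<bar>b ?m\<bar>" by linarith
    then have "\<bar>b ?m\<bar> * \<bar>b j\<bar> = \<bar>b ?m\<bar> * \<bar>b ?m\<bar>" using prod[OF ij] by (simp only:)
    then have "\<bar>b j\<bar> = \<bar>b ?m\<bar>" using pos unfolding mult_cancel_left by linarith
    with i show ?thesis ..
  qed
  have "0 < ?k" "0 < ?l" using kl by linarith+
  then have "?F \<noteq> {}" "?E \<noteq> {}" unfolding card_gt_0_iff by blast+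
  then have "\<bar>b i\<bar> = \<bar>b ?m\<bar>" if "i \<in> ?F \<union> ?E" for i
    using max that by blast
  then show "\<forall>i\<in>{1..?m}. \<bar>b i\<bar> = \<bar>b ?m\<bar>" by (simp only: cover) blast
qed

context horizontal_frame
begin

text \<open>The matrix of \<open>h\<close> in an adapted frame consists of skew 2-by-2 blocks and possibly a zero.\<close>

lemma skew_if_adapted:
  assumes "linear h"
    and h_odd: "\<And>i. i \<in> {1..q div 2} \<Longrightarrow> h (f (2 * i - 1)) = b i *\<^sub>R f (2 * i)"
    and h_even: "\<And>i. i \<in> {1..q div 2} \<Longrightarrow> h (f (2 * i)) = - b i *\<^sub>R f (2 * i - 1)"
    and h_last: "odd q \<Longrightarrow> h (f q) = 0"
    and X: "G X Xi = 0" and Y: "G Y Xi = 0"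
  shows "G (h X) Y = - G (h Y) X"
proof -
  have lin1: "linear (\<lambda>X. G (h X) Y)" and lin2: "linear (\<lambda>X. G (h Y) X)" for Y
    by (simp_all add: linear_iff linear_add[OF assms(1)] linear_cmul[OF assms(1)] bilinear_ladd[OF bilinear]
        bilinear_radd[OF bilinear] bilinear_lmul[OF bilinear] bilinear_rmul[OF bilinear])
  have val: "G (h (f s)) (f t) = (if odd s \<and> t = s + 1 then b (t div 2)
      else if even s \<and> s = t + 1 then - b (s div 2) else 0)"
    if s: "s \<in> {1..q}" and t: "t \<in> {1..q}" for s t
  proof (cases "even s")
    case True
    then obtain i where i: "s = 2 * i" by blast
    then have "i \<in> {1..q div 2}" "2 * i - 1 \<in> {1..q}" using s by auto
    then show ?thesis
      using h_even[of i] frame_orthonormal[of "2 * i - 1" t] t i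
      by (auto simp: bilinear_lmul[OF bilinear] bilinear_lneg[OF bilinear])
  next
    case False
    show ?thesis
    proof (cases "s = q")
      case True
      then show ?thesis using h_last \<open>odd s\<close> t by (auto simp: bilinear_lzero[OF bilinear])
    next
      case sq: False
      obtain k where "s = 2 * k + 1" using \<open>odd s\<close> by (rule oddE)
      then obtain i where i: "s = 2 * i - 1" "s + 1 = 2 * i" by (intro that[of "k + 1"]) simp_all
      then have "i \<in> {1..q div 2}" "2 * i \<in> {1..q}" using s sq by auto
      then show ?thesis
        using h_odd[of i] frame_orthonormal[of "2 * i" t] t i \<open>odd s\<close>
        by (auto simp: bilinear_lmul[OF bilinear])
    qed
  qed
  have skew_f: "G (h (f s)) (f t) = - G (h (f t)) (f s)" if "s \<in> {1..q}" "t \<in> {1..q}" for s t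
    unfolding val[OF that] val[OF that(2,1)] by (cases "even s"; cases "even t") auto
  have "G (h X) (f t) = - G (h (f t)) X" if t: "t \<in> {1..q}" for t
    unfolding linear_expand[OF lin1 X] linear_expand[OF lin2 X] sum_negf[symmetric]
    by (intro sum.cong refl) (simp add: skew_f[OF _ t])
  then show ?thesis
    unfolding linear_expand[OF lin1 Y] linear_expand[OF lin2 Y] sum_negf[symmetric]
    by (intro sum.cong refl) simp
qed

text \<open>This makes the vector in the definition of the Christoffel symbols explicit, so that its dependence on
the linear functional can be read off.\<close>

lemma riesz_the:
  assumes "linear L"
  shows "(THE t. \<forall>w. G t w = L w) = L Xi *\<^sub>R Xi + (\<Sum>i\<in>{1..q}. L (f i) *\<^sub>R f i)"
proof (rule the_equality)
  let ?t = "L Xi *\<^sub>R Xi + (\<Sum>i\<in>{1..q}. L (f i) *\<^sub>R f i)"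
  have lin: "linear (\<lambda>v. G v w)" for w using bilinear by (simp add: bilinear_def)
  show "\<forall>w. G ?t w = L w"
  proof
    fix w
    have "L w = L (G w Xi *\<^sub>R Xi + (\<Sum>i\<in>{1..q}. G w (f i) *\<^sub>R f i))"
      by (simp only: full_expand[of w, symmetric])
    also have "\<dots> = G w Xi * L Xi + (\<Sum>i\<in>{1..q}. G w (f i) * L (f i))"
      by (simp add: linear_add[OF assms] linear_sum[OF assms] linear_cmul[OF assms])
    also have "\<dots> = L Xi * G Xi w + (\<Sum>i\<in>{1..q}. L (f i) * G (f i) w)"
      by (simp add: mult.commute sym[of w])
    also have "\<dots> = G ?t w"
      by (simp add: linear_add[OF lin] linear_sum[OF lin] linear_cmul[OF lin])
    finally show "G ?t w = L w" ..
  qed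
  fix t assume "\<forall>w. G t w = L w"
  then show "t = ?t" using full_expand[of t] by simp
qed

end

context flow_fibre
begin

text \<open>The coefficients of \<open>\<omega>\<close> live on index sets of size \<open>p\<close>, so both claims compare, set by set, the exchange
weight with \<open>p (q - p) b\<^sub>m\<^sup>2 / 4\<close>. In the case of equality a single index set with nonzero coefficient
determines all \<open>|b\<^sub>i|\<close>.\<close>

lemma B_ext_bound:
  assumes frame2: "orthonormal_2frame q Xi f \<psi>" and dual2: "dual_2frame q Xi f \<psi> \<psi>'"
    and p: "1 \<le> p" "p < q" and \<omega>: "\<omega> \<in> ext_power Xi p" and e: "orthonormal_frame G Xi {1..q} e"
    and h_odd: "\<And>i. i \<in> {1..q div 2} \<Longrightarrow> h (e (2 * i - 1)) = b i *\<^sub>R e (2 * i)"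
    and h_even: "\<And>i. i \<in> {1..q div 2} \<Longrightarrow> h (e (2 * i)) = - b i *\<^sub>R e (2 * i - 1)"
    and h_last: "odd q \<Longrightarrow> h (e q) = 0"
    and b: "\<And>i. i \<in> {1..q div 2} \<Longrightarrow> \<bar>b i\<bar> \<le> \<bar>b (q div 2)\<bar>"
  shows "\<langle>B_ext q G Xi h f \<psi> \<psi>' p \<omega>, \<omega>\<rangle> \<ge> - real p * (real q - real p) * (b (q div 2))\<^sup>2 * \<langle>\<omega>, \<omega>\<rangle>"
    and "\<omega> \<noteq> (\<lambda>_. 0) \<Longrightarrow> \<langle>B_ext q G Xi h f \<psi> \<psi>' p \<omega>, \<omega>\<rangle> =
        - real p * (real q - real p) * (b (q div 2))\<^sup>2 * \<langle>\<omega>, \<omega>\<rangle> \<Longrightarrow>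
      (\<forall>i\<in>{1..q div 2}. \<bar>b i\<bar> = \<bar>b (q div 2)\<bar>) \<and> (q div 2 \<ge> 2 \<or> b (q div 2) = 0)"
proof -
  interpret e: horizontal_frame G Xi q e
    by unfold_locales (use bilinear sym unit e in auto)
  let ?C = "real p * (real q - real p) * (b (q div 2))\<^sup>2"
  let ?w = "exchange_weight b (q div 2)"
  let ?B = "\<langle>B_ext q G Xi h f \<psi> \<psi>' p \<omega>, \<omega>\<rangle>"
  let ?c = "\<lambda>I. \<omega> (frame_list e I)"
  have card: "card I = p" if "?c I \<noteq> 0" for I
    using ext_power_coeff_zero[OF \<omega>, of I e] that by blast
  have norm: "\<langle>\<omega>, \<omega>\<rangle> = (\<Sum>I\<in>Pow {1..q}. (?c I)\<^sup>2)"
    unfolding form_inner_frame_invariant[OF e \<omega> \<omega>, symmetric]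
    by (simp add: form_inner_def power2_eq_square)
  have nonneg: "0 \<le> (?C - 4 * ?w I) * (?c I)\<^sup>2" if "I \<in> Pow {1..q}" for I
  proof (cases "?c I = 0")
    case False
    then show ?thesis using exchange_weight_le[of I q b, OF _ b] that card[OF False] by simp
  qed simp
  have lower: "?B + ?C * \<langle>\<omega>, \<omega>\<rangle> \<ge> (\<Sum>I\<in>Pow {1..q}. (?C - 4 * ?w I) * (?c I)\<^sup>2)"
    using B_ext_exchange_bound[OF frame2 dual2 p(1) \<omega> e h_odd h_even h_last]
    unfolding norm by (simp add: left_diff_distrib sum_subtractf sum_distrib_left sum_negf mult.assoc)
  moreover have "0 \<le> (\<Sum>I\<in>Pow {1..q}. (?C - 4 * ?w I) * (?c I)\<^sup>2)"
    by (rule sum_nonneg[OF nonneg])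
  ultimately show "?B \<ge> - real p * (real q - real p) * (b (q div 2))\<^sup>2 * \<langle>\<omega>, \<omega>\<rangle>"
    by simp
  assume nz: "\<omega> \<noteq> (\<lambda>_. 0)" and "?B = - real p * (real q - real p) * (b (q div 2))\<^sup>2 * \<langle>\<omega>, \<omega>\<rangle>"
  then have "(\<Sum>I\<in>Pow {1..q}. (?C - 4 * ?w I) * (?c I)\<^sup>2) \<le> 0"
    using lower by simp
  then have "(\<Sum>I\<in>Pow {1..q}. (?C - 4 * ?w I) * (?c I)\<^sup>2) = 0"
    using sum_nonneg[OF nonneg] by (rule antisym)
  then have "\<forall>I\<in>Pow {1..q}. (?C - 4 * ?w I) * (?c I)\<^sup>2 = 0"
    by (rule sum_nonneg_eq_0_iff[THEN iffD1, rotated 2]) (use nonneg in auto)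
  moreover obtain I where I: "I \<subseteq> {1..q}" "?c I \<noteq> 0"
  proof (rule ccontr)
    assume "\<not> thesis"
    then have "\<omega> vs = 0" for vs
      using e.horizontal_form_zeroI[of \<omega> vs] that \<omega> unfolding ext_power_iff by blast
    with nz show False by auto
  qed
  ultimately have "(?C - 4 * ?w I) * (?c I)\<^sup>2 = 0" by blast
  with I(2) have eq: "4 * ?w I = ?C" by simp
  show "(\<forall>i\<in>{1..q div 2}. \<bar>b i\<bar> = \<bar>b (q div 2)\<bar>) \<and> (q div 2 \<ge> 2 \<or> b (q div 2) = 0)"
  proof (cases "b (q div 2) = 0")
    case True
    then show ?thesis using b by fastforce
  next
    case False
    note equality = exchange_weight_eq[of I q b, OF I(1) _ False, unfolded card[OF I(2)], OF b p eq]
    show ?thesis using equality by blast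
  qed
qed

end

section \<open>Linearity of the O'Neill tensor\<close>

lemma smooth_on_differentiable:
  assumes "smooth_on S F" "open S" "y \<in> S"
  shows "F differentiable (at y)"
proof -
  have "Ck_on (Suc 0) S F" using assms(1) unfolding smooth_on_def by blast
  then have "F differentiable_on S" by simp
  then have "F differentiable (at y within S)"
    using assms(3) unfolding differentiable_on_def by blast
  then show ?thesis unfolding at_within_open[OF assms(3,2)] .
qed

lemma dir_deriv_linear:
  assumes "(F \<circ> chart_inv c) differentiable (at (snd c x))"
  shows "linear (dir_deriv c F x)"
  using linear_frechet_derivative[OF assms] by (simp add: dir_deriv_def[abs_def])

text \<open>The identity between the functions is only required on the chart domain, which suffices because its
image is open. The metric is only known to be bilinear at the points of that domain.\<close>

lemma dir_deriv_comb:
  assumes F1: "(F1 \<circ> chart_inv c) differentiable (at (snd c x))"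
    and F2: "(F2 \<circ> chart_inv c) differentiable (at (snd c x))"
    and "open (chart_image c)" "x \<in> fst c"
    and eq: "\<And>x'. x' \<in> fst c \<Longrightarrow> F x' = r *\<^sub>R F1 x' + s *\<^sub>R F2 x'"
  shows "dir_deriv c F x v = r *\<^sub>R dir_deriv c F1 x v + s *\<^sub>R dir_deriv c F2 x v"
proof -
  let ?D1 = "frechet_derivative (F1 \<circ> chart_inv c) (at (snd c x))"
  let ?D2 = "frechet_derivative (F2 \<circ> chart_inv c) (at (snd c x))"
  have "((\<lambda>y. r *\<^sub>R (F1 \<circ> chart_inv c) y + s *\<^sub>R (F2 \<circ> chart_inv c) y) has_derivative
      (\<lambda>v. r *\<^sub>R ?D1 v + s *\<^sub>R ?D2 v)) (at (snd c x))"
    using F1 F2 unfolding frechet_derivative_works by (intro has_derivative_add has_derivative_scaleR_right)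
  then have "((F \<circ> chart_inv c) has_derivative (\<lambda>v. r *\<^sub>R ?D1 v + s *\<^sub>R ?D2 v)) (at (snd c x))"
  proof (rule has_derivative_transform_within_open[OF _ assms(3)])
    show "snd c x \<in> chart_image c" using assms(4) by (simp add: chart_image_def)
    fix y assume "y \<in> chart_image c"
    then have "chart_inv c y \<in> fst c"
      unfolding chart_image_def chart_inv_def by (rule inv_into_into)
    then show "r *\<^sub>R (F1 \<circ> chart_inv c) y + s *\<^sub>R (F2 \<circ> chart_inv c) y = (F \<circ> chart_inv c) y"
      by (simp add: eq)
  qed
  then show ?thesis
    unfolding dir_deriv_def by (simp add: frechet_derivative_at[symmetric])
qed

text \<open>The Koszul formula is linear in the direction \<open>u\<close> for each test vector, hence so is the vector that
represents it. Linearity is needed on all of \<open>Q\<close>, as adapted frames only describe \<open>h\<close> on a basis.\<close>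

lemma oneill_linear:
  assumes "riemannian_manifold M A g" "smooth_vector_field A \<xi>" "c \<in> A" "x \<in> fst c"
    and "horizontal_frame (g c x) (\<xi> c x) q f"
  shows "linear (oneill g \<xi> c x)"
proof -
  interpret horizontal_frame "g c x" "\<xi> c x" q f by (rule assms(5))
  let ?Z = "\<xi> c x"
  have op: "open (chart_image c)"
    using assms(1,3) unfolding riemannian_manifold_def smooth_manifold_def smooth_atlas_def by blast
  have y: "snd c x \<in> chart_image c" using assms(4) by (simp add: chart_image_def)
  have bil: "bilinear (g c x')" if "x' \<in> fst c" for x'
    using assms(1,3) that unfolding riemannian_manifold_def riemannian_metric_def by blast
  have dg: "((\<lambda>x. g c x u v) \<circ> chart_inv c) differentiable (at (snd c x))" for u v
    by (rule smooth_on_differentiable[OF _ op y])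
      (use assms(1,3) in \<open>unfold riemannian_manifold_def riemannian_metric_def, blast\<close>)
  have d\<xi>: "(\<xi> c \<circ> chart_inv c) differentiable (at (snd c x))"
    by (rule smooth_on_differentiable[OF _ op y])
      (use assms(2,3) in \<open>unfold smooth_vector_field_def, blast\<close>)
  let ?d = "\<lambda>u v w. dir_deriv c (\<lambda>x'. g c x' u v) x w"
  have lin3: "linear (?d u v)" for u v by (rule dir_deriv_linear[OF dg])
  have comb1: "?d (r *\<^sub>R u + s *\<^sub>R u') v w = r * ?d u v w + s * ?d u' v w" for r s u u' v w
    using dir_deriv_comb[OF dg dg op assms(4), of "\<lambda>x'. g c x' (r *\<^sub>R u + s *\<^sub>R u') v" r u v s u' v w]
    by (simp add: bilinear_ladd[OF bil] bilinear_lmul[OF bil])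
  have comb2: "?d v (r *\<^sub>R u + s *\<^sub>R u') w = r * ?d v u w + s * ?d v u' w" for r s u u' v w
    using dir_deriv_comb[OF dg dg op assms(4), of "\<lambda>x'. g c x' v (r *\<^sub>R u + s *\<^sub>R u')" r v u s v u' w]
    by (simp add: bilinear_radd[OF bil] bilinear_rmul[OF bil])
  have linI: "linear L" if "\<And>r s u u'. L (r *\<^sub>R u + s *\<^sub>R u') = r * L u + s * L u'"
    for L :: "'b \<Rightarrow> real"
    using that[of 1 _ 1] that[of _ _ 0 0] by (simp add: linear_iff)
  have lin1: "linear (\<lambda>u. ?d u v w)" for v w by (rule linI) (rule comb1)
  have lin2: "linear (\<lambda>v. ?d u v w)" for u w by (rule linI) (rule comb2)
  let ?L = "\<lambda>u w. (?d ?Z w u + ?d u w ?Z - ?d u ?Z w) / 2"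
  have Lw: "linear (?L u)" for u
    using lin2[of ?Z u] lin2[of u ?Z] lin3[of u ?Z]
    by (simp add: linear_iff field_simps)
  have Lu: "linear (\<lambda>u. ?L u w)" for w
    using lin3[of ?Z w] lin1[of w ?Z] lin1[of ?Z w]
    by (simp add: linear_iff field_simps)
  have chr: "christoffel g c x u ?Z = ?L u ?Z *\<^sub>R ?Z + (\<Sum>i\<in>{1..q}. ?L u (f i) *\<^sub>R f i)" for u
    unfolding christoffel_def by (rule riesz_the[OF Lw])
  have scale: "linear (\<lambda>u. L u *\<^sub>R z)" if "linear L" for L :: "'b \<Rightarrow> real" and z :: 'b
    using that by (simp add: linear_iff scaleR_add_left)
  have "linear (\<lambda>u. ?L u ?Z *\<^sub>R ?Z + (\<Sum>i\<in>{1..q}. ?L u (f i) *\<^sub>R f i))"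
    by (intro linear_compose_add linear_compose_sum[rule_format] ballI scale Lu)
  then have "linear (\<lambda>u. christoffel g c x u ?Z)" unfolding chr .
  then show ?thesis
    using linear_compose_add[OF dir_deriv_linear[OF d\<xi>]]
    by (simp add: oneill_def[abs_def] levi_civita_def)
qed

section \<open>The curvature estimate\<close>

lemma orthonormal_frame_reindex:
  assumes e: "orthonormal_frame G Xi J e" and \<sigma>: "bij_betw \<sigma> I J"
  shows "orthonormal_frame G Xi I (e \<circ> \<sigma>)"
proof -
  have "(\<Sum>i\<in>I. G v (e (\<sigma> i)) *\<^sub>R e (\<sigma> i)) = (\<Sum>j\<in>J. G v (e j) *\<^sub>R e j)" for v
    by (rule sum.reindex_bij_betw[OF \<sigma>])
  moreover have "\<sigma> i = \<sigma> j \<longleftrightarrow> i = j" if "i \<in> I" "j \<in> I" for i j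
    using \<sigma> that by (auto simp: bij_betw_def inj_on_def)
  moreover have "\<sigma> i \<in> J" if "i \<in> I" for i using \<sigma> that by (auto simp: bij_betw_def)
  ultimately show ?thesis
    using e bij_betw_finite[OF \<sigma>] unfolding orthonormal_frame_def by auto
qed

theorem theorem4p2:
  fixes M :: "'a topology"
    and A :: "('a, 'e::euclidean_space) chart set"
    and g :: "('a, 'e) metric_field"
    and \<xi> :: "('a, 'e) vector_field"
    and \<omega> :: "('a, 'e) form_field"
    and c :: "('a, 'e) chart"
    and x :: 'a
    and e f :: "nat \<Rightarrow> 'e"
    and b :: "nat \<Rightarrow> real"
    and \<psi> \<psi>' :: "nat \<Rightarrow> 'e form"
    and B :: "'e form \<Rightarrow> 'e form"
    and q m p :: nat
  assumes manifold: "riemannian_manifold M A g"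
    and dim: "DIM('e) = q + 1"
    and flow: "riemannian_flow A g \<xi>"
    and m: "m = q div 2"
    and p: "1 \<le> p" "p \<le> q - 1"
    and basic: "basic_form A \<xi> p \<omega>"
    and point: "c \<in> A" "x \<in> fst c"
    and adapted: "adapted_frame q (g c x) (\<xi> c x) (oneill g \<xi> c x) e b"
    and frame: "orthonormal_frame (g c x) (\<xi> c x) {1..q} f"
    and frame2: "orthonormal_2frame q (\<xi> c x) f \<psi>"
    and dual2: "dual_2frame q (\<xi> c x) f \<psi> \<psi>'"
    and B: "B = B_ext q (g c x) (\<xi> c x) (oneill g \<xi> c x) f \<psi> \<psi>' p"
  shows "form_inner q f (B (\<omega> c x)) (\<omega> c x)
           \<ge> - real p * (real q - real p) * (b m)\<^sup>2 * form_inner q f (\<omega> c x) (\<omega> c x) \<and>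
         (\<omega> c x \<noteq> (\<lambda>_. 0) \<and>
          form_inner q f (B (\<omega> c x)) (\<omega> c x)
            = - real p * (real q - real p) * (b m)\<^sup>2 * form_inner q f (\<omega> c x) (\<omega> c x) \<longrightarrow>
            (p \<in> {1..m} \<longrightarrow> (\<forall>i\<in>{1..m}. \<bar>b i\<bar> = \<bar>b m\<bar>)) \<and>
            (m = 1 \<longrightarrow> b 1 = 0))"
proof -
  let ?G = "g c x" and ?Xi = "\<xi> c x" and ?h = "oneill g \<xi> c x"
  have G: "bilinear ?G" "\<And>u v. ?G u v = ?G v u"
    using manifold point unfolding riemannian_manifold_def riemannian_metric_def by blast+
  have smooth: "smooth_vector_field A \<xi>" and unit: "?G ?Xi ?Xi = 1"
    using flow point unfolding riemannian_flow_def by blast+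
  interpret frame: horizontal_frame ?G ?Xi q f
    by unfold_locales (fact G unit frame)+
  have lin: "linear ?h"
    by (rule oneill_linear[OF manifold smooth point frame.horizontal_frame_axioms])
  \<comment> \<open>For odd \<open>q\<close> the extra vector of the adapted frame has index \<open>0\<close>; it is moved to index \<open>q\<close>, so that both
    frames are indexed by \<open>{1..q}\<close> and the pairs \<open>{2 i - 1, 2 i}\<close> stay in place.\<close>
  define \<sigma> where "\<sigma> i = (if odd q \<and> i = q then 0 else i)" for i :: nat
  have bij: "bij_betw \<sigma> {1..q} (if even q then {1..q} else {0..<q})"
    by (rule bij_betw_byWitness[where f' = "\<lambda>i. if odd q \<and> i = 0 then q else i"])
      (auto simp: \<sigma>_def intro: odd_pos)
  let ?e = "e \<circ> \<sigma>"
  have e: "orthonormal_frame ?G ?Xi {1..q} ?e"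
    using adapted unfolding adapted_frame_def by (intro orthonormal_frame_reindex[OF _ bij]) blast
  interpret e: horizontal_frame ?G ?Xi q ?e
    by unfold_locales (fact G unit e)+
  have \<sigma>: "\<sigma> (2 * i - 1) = 2 * i - 1" "\<sigma> (2 * i) = 2 * i" if "i \<in> {1..q div 2}" for i
    using that unfolding \<sigma>_def atLeastAtMost_iff by (simp_all, presburger+)
  have h_odd: "?h (?e (2 * i - 1)) = b i *\<^sub>R ?e (2 * i)"
    and h_even: "?h (?e (2 * i)) = - b i *\<^sub>R ?e (2 * i - 1)" if "i \<in> {1..q div 2}" for i
    using adapted \<sigma>[OF that] that unfolding adapted_frame_def by auto
  have h_last: "?h (?e q) = 0" if "odd q"
    using adapted that unfolding adapted_frame_def by (simp add: \<sigma>_def)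
  have b: "\<bar>b i\<bar> \<le> \<bar>b (q div 2)\<bar>" if "i \<in> {1..q div 2}" for i
    using adapted that unfolding adapted_frame_def by auto
  interpret flow_fibre ?G ?Xi q f ?h
    by (intro flow_fibre.intro flow_fibre_axioms.intro frame.horizontal_frame_axioms lin)
      (rule e.skew_if_adapted[OF lin h_odd h_even h_last])
  have \<omega>: "\<omega> c x \<in> ext_power ?Xi p"
    using basic point unfolding basic_form_def smooth_form_field_def ext_power_def by blast
  have pq: "p < q" using p by simp
  note bound = B_ext_bound[OF frame2 dual2 p(1) pq \<omega> e h_odd h_even h_last b]
  show ?thesis
    unfolding B m
  proof (intro conjI impI)
    assume eq: "\<omega> c x \<noteq> (\<lambda>_. 0) \<and>
      form_inner q f (B_ext q ?G ?Xi ?h f \<psi> \<psi>' p (\<omega> c x)) (\<omega> c x) =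
        - real p * (real q - real p) * (b (q div 2))\<^sup>2 * form_inner q f (\<omega> c x) (\<omega> c x)"
    have equality: "(\<forall>i\<in>{1..q div 2}. \<bar>b i\<bar> = \<bar>b (q div 2)\<bar>) \<and> (q div 2 \<ge> 2 \<or> b (q div 2) = 0)"
      by (rule bound(2)) (assumption | rule conjunct1[OF eq] conjunct2[OF eq])+
    show "\<forall>i\<in>{1..q div 2}. \<bar>b i\<bar> = \<bar>b (q div 2)\<bar>" by (rule conjunct1[OF equality])
    show "b 1 = 0" if "q div 2 = 1" using conjunct2[OF equality] that by simp
  qed (rule bound(1))
qed

end
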